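(* The set $\mathcal{K}=\{F\in\mathcal{S}\mid \mathbf{m}(\mathrm{Indiff}(F))>0\}$ is a subset of a countable union of small subsets of $\mathcal{S}$. In particular, $\mathcal{K}$ is meager in $\mathcal{S}$.
   Context: Setting. $\sigma\colon\Sigma\to\Sigma$ is a bilateral (two-sided) transitive subshift of finite type (topological Markov chain), $\Sigma\subset\{1,\dots,N\}^{\mathbb{Z}}$, with the metric $d(\bar\omega,\omega)=2^{-\min\{|n|:\bar\omega_n\ne\omega_n\}}$ for $\bar\omega\neq\omega$ and $d(\omega,\omega)=0$. A $\sigma$-invariant ergodic Markov measure $\mu$ (a probability measure) on $\Sigma$ is fixed. $I=[0,1]$ is the unit interval. The class $\mathcal{S}$ (the space of skew products) consists of the skew products $F\colon\Sigma\times I\to\Sigma\times I$, $F(\omega,x)=(\sigma\omega,f_\omega(x))$, such that each $f_\omega\colon I\to f_\omega(I)\subset I$ is an orientation preserving $C^1$ diffeomorphism onto its image, and $\omega\mapsto f_\omega$ is continuous in the $C^1$ topology. $\mathcal{S}$ carries the metric $\mathrm{dist}(F,\tilde F)=\max_\omega \mathrm{dist}_{C^1}(f_\omega^{\pm1},\tilde f_\omega^{\pm1})$. The standard measure $\mathbf{m}$ on $\Sigma\times I$ is the product of $\mu$ and Lebesgue measure on $I$. Drifting points. For graphs $\Gamma_1,\Gamma_2$ of functions $\varphi_1,\varphi_2\colon\Sigma\to I$, write $\Gamma_1<\Gamma_2$ if $\varphi_1(\omega)<\varphi_2(\omega)$ for all $\omega\in\Sigma$. The image $F(\Gamma)$ of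 the graph $\Gamma$ of $\gamma\colon\Sigma\to I$ is the graph of $\omega\mapsto f_{\sigma^{-1}\omega}(\gamma(\sigma^{-1}\omega))$. A graph $\Gamma$ drifts up (down) under $F$ if $F(\Gamma)>\Gamma$ (respectively $F(\Gamma)<\Gamma$). A point $p=(\omega,x)$ drifts up if there is a continuous $\gamma\colon\Sigma\to I$ whose graph drifts up under $F$ and $\gamma(\omega)<x<f_{\sigma^{-1}\omega}(\gamma(\sigma^{-1}\omega))$; it drifts down if there is a continuous $\gamma\colon\Sigma\to I$ whose graph drifts down and $f_{\sigma^{-1}\omega}(\gamma(\sigma^{-1}\omega))<x<\gamma(\omega)$. $\mathrm{Up}(F)$ and $\mathrm{Down}(F)$ are the sets of points drifting up, respectively down, and $\mathrm{Indiff}(F)=(\Sigma\times I)\setminus(\mathrm{Up}(F)\cup\mathrm{Down}(F))$ is the anchored set. Families and small sets. $F\prec\tilde F$ means $f_\omega(x)<\tilde f_\omega(x)$ for all $\omega\in\Sigma$, $x\in I$. A family $F_\tau$, $\tau$ in an open interval $(a,b)$, of skew products in $\mathcal{S}$ is monotone increasing if $F_{\tau_1}\prec F_{\tau_2}$ whenever $\tau_1<\tau_2$; monotone decreasing if $F_{\tau_2}\prec F_{\tau_1}$ whenever $\tau_1<\tau_2$; monotone if it is one of these. It is continuous if $\tau\mapsto F_\tau$ is continuous with respect to the metric on $\mathcal{S}$. A subset of $\mathcal{S}$ is small if it is closed, nowhere dense, and any continuous monotone family intersects it at a finite number of points.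
   Formalization: The Markov measure μ is assumed to give positive transition probability to exactly the admissible transitions of Σ (so μ has full support); for Markov measures carried by a proper subchain of Σ the claim fails. *)

theory Defs
  imports "HOL-Probability.Probability"
begin

section \<open>Topological Markov chains\<close>

abbreviation unit_interval :: "real set" where
  "unit_interval \<equiv> {0..1}"

definition left_shift :: "(int \<Rightarrow> nat) \<Rightarrow> (int \<Rightarrow> nat)" where
  "left_shift \<omega> = (\<lambda>n. \<omega> (n + 1))"

definition right_shift :: "(int \<Rightarrow> nat) \<Rightarrow> (int \<Rightarrow> nat)" where
  "right_shift \<omega> = (\<lambda>n. \<omega> (n - 1))"

definition markov_chain_space :: "nat \<Rightarrow> (nat \<Rightarrow> nat \<Rightarrow> bool) \<Rightarrow> (int \<Rightarrow> nat) set" where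
  "markov_chain_space N A = {\<omega>. \<forall>n. \<omega> n \<in> {1..N} \<and> A (\<omega> n) (\<omega> (n + 1))}"

definition shift_dist :: "(int \<Rightarrow> nat) \<Rightarrow> (int \<Rightarrow> nat) \<Rightarrow> real" where
  "shift_dist \<eta> \<omega> =
     (if \<eta> = \<omega> then 0 else (1 / 2) ^ (LEAST k. \<exists>n. k = nat \<bar>n\<bar> \<and> \<eta> n \<noteq> \<omega> n))"

abbreviation shift_topology :: "(int \<Rightarrow> nat) set \<Rightarrow> (int \<Rightarrow> nat) topology" where
  "shift_topology X \<equiv> Metric_space.mtopology X shift_dist"

lemma shift_dist_less_iff:
  "shift_dist \<eta> \<omega> < (1 / 2) ^ k \<longleftrightarrow> (\<forall>n. nat \<bar>n\<bar> \<le> k \<longrightarrow> \<eta> n = \<omega> n)"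
proof (cases "\<eta> = \<omega>")
  case True
  then show ?thesis by (simp add: shift_dist_def)
next
  case False
  let ?P = "\<lambda>k. \<exists>n. k = nat \<bar>n\<bar> \<and> \<eta> n \<noteq> \<omega> n"
  define m where "m = (LEAST k. ?P k)"
  from False obtain n where "\<eta> n \<noteq> \<omega> n" by blast
  then have ex: "?P (nat \<bar>n\<bar>)" by blast
  have m: "?P m" unfolding m_def by (rule LeastI[where P = ?P, OF ex])
  have least: "m \<le> j" if "?P j" for j
    unfolding m_def by (rule Least_le[where P = ?P, OF that])
  have "shift_dist \<eta> \<omega> = (1 / 2) ^ m"
    using False by (simp add: shift_dist_def m_def)
  then have "shift_dist \<eta> \<omega> < (1 / 2) ^ k \<longleftrightarrow> k < m"
    by (simp add: power_strict_decreasing_iff)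
  also have "\<dots> \<longleftrightarrow> (\<forall>n. nat \<bar>n\<bar> \<le> k \<longrightarrow> \<eta> n = \<omega> n)"
    using m least by (metis le_trans not_le)
  finally show ?thesis .
qed

lemma shift_dist_pos: "\<eta> \<noteq> \<omega> \<Longrightarrow> \<exists>m. shift_dist \<eta> \<omega> = (1 / 2) ^ m"
  by (auto simp: shift_dist_def)

lemma shift_dist_commute: "shift_dist \<eta> \<omega> = shift_dist \<omega> \<eta>"
proof -
  have "(\<eta> n \<noteq> \<omega> n) = (\<omega> n \<noteq> \<eta> n)" for n by auto
  then show ?thesis by (simp add: shift_dist_def eq_commute[of \<eta> \<omega>])
qed

lemma Metric_space_shift_dist: "Metric_space X shift_dist"
proof
  fix x y z :: "int \<Rightarrow> nat"
  show nn: "0 \<le> shift_dist a b" for a b by (simp add: shift_dist_def)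
  show "shift_dist x y = shift_dist y x" by (rule shift_dist_commute)
  show "shift_dist x y = 0 \<longleftrightarrow> x = y"
    by (auto simp: shift_dist_def)
  show "shift_dist x z \<le> shift_dist x y + shift_dist y z"
  proof (cases "x = z")
    case True
    then show ?thesis using nn[of x y] nn[of y z] by (simp add: shift_dist_def)
  next
    case False
    then obtain m where m: "shift_dist x z = (1 / 2) ^ m" using shift_dist_pos by blast
    have "\<not> (shift_dist x y < (1 / 2) ^ m \<and> shift_dist y z < (1 / 2) ^ m)"
      using m shift_dist_less_iff[of x z m] shift_dist_less_iff[of x y m]
        shift_dist_less_iff[of y z m] by auto
    then show ?thesis using m nn[of x y] nn[of y z] by linarith
  qed
qed

lemma compact_space_markov_chain:
  "compact_space (shift_topology (markov_chain_space N A))"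
proof -
  let ?X = "markov_chain_space N A"
  interpret Metric_space ?X shift_dist by (rule Metric_space_shift_dist)
  define T where "T = product_topology (\<lambda>n::int. discrete_topology {1..N}) UNIV"
  have comp: "compact_space T"
    unfolding T_def by (simp add: compact_space_product_topology compact_space_discrete_topology)
  have topT: "topspace T = {\<omega>. \<forall>n. \<omega> n \<in> {1..N}}"
    unfolding T_def by (auto simp: PiE_def Pi_def)
  have cyl: "openin T {\<omega> \<in> topspace T. \<omega> n \<in> V}" for n V
  proof -
    have "continuous_map T (discrete_topology {1..N}) (\<lambda>\<omega>. \<omega> n)"
      unfolding T_def by (rule continuous_map_product_projection) simp
    from openin_continuous_map_preimage[OF this, of "V \<inter> {1..N}"]
    have "openin T {\<omega> \<in> topspace T. \<omega> n \<in> V \<inter> {1..N}}" by simp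
    moreover have "{\<omega> \<in> topspace T. \<omega> n \<in> V \<inter> {1..N}} = {\<omega> \<in> topspace T. \<omega> n \<in> V}"
      using topT by auto
    ultimately show ?thesis by simp
  qed
  have "closedin T ?X"
  proof -
    have "topspace T - ?X =
      (\<Union>(n, i, j)\<in>{(n, i, j). \<not> A i j}.
         {\<omega> \<in> topspace T. \<omega> n \<in> {i}} \<inter> {\<omega> \<in> topspace T. \<omega> (n + 1) \<in> {j}})"
      unfolding markov_chain_space_def topT by auto
    also have "openin T \<dots>" by (rule openin_Union) (use cyl[of _ "{_}"] in \<open>auto intro!: openin_Int\<close>)
    finally show ?thesis unfolding closedin_def topT by (auto simp: markov_chain_space_def)
  qed
  then have "compactin T ?X" using comp by (rule closedin_compact_space[rotated])
  then have cX: "compactin (subtopology T ?X) ?X" by (simp add: compactin_subtopology)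
  have sub: "?X \<subseteq> topspace T" unfolding topT markov_chain_space_def by auto
  have "continuous_map (subtopology T ?X) mtopology id"
    unfolding continuous_map_to_metric
  proof (intro ballI allI impI)
    fix \<omega> and \<epsilon> :: real assume w: "\<omega> \<in> topspace (subtopology T ?X)" and "\<epsilon> > 0"
    obtain k where k: "(1 / 2) ^ k < \<epsilon>" using real_arch_pow_inv[OF \<open>\<epsilon> > 0\<close>, of "1 / 2"] by auto
    define U where "U = topspace T \<inter> (\<Inter>n\<in>{n::int. nat \<bar>n\<bar> \<le> k}. {\<eta> \<in> topspace T. \<eta> n \<in> {\<omega> n}})"
    have "{n::int. nat \<bar>n\<bar> \<le> k} \<subseteq> {- int k..int k}" by auto
    then have fin: "finite {n::int. nat \<bar>n\<bar> \<le> k}" using finite_subset by blast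
    have "openin T U" unfolding U_def
      by (subst Int_commute, rule openin_INT) (use fin cyl[of _ "{_}"] in auto)
    then have "openin (subtopology T ?X) (U \<inter> ?X)" by (rule openin_subtopology_Int)
    moreover have "\<omega> \<in> U \<inter> ?X" using w by (auto simp: U_def)
    moreover have "id \<eta> \<in> mball (id \<omega>) \<epsilon>" if "\<eta> \<in> U \<inter> ?X" for \<eta>
    proof -
      have "shift_dist \<omega> \<eta> < (1 / 2) ^ k"
        unfolding shift_dist_less_iff using that by (auto simp: U_def)
      then show ?thesis using that w k by auto
    qed
    ultimately show "\<exists>U. openin (subtopology T ?X) U \<and> \<omega> \<in> U \<and> (\<forall>\<eta>\<in>U. id \<eta> \<in> mball (id \<omega>) \<epsilon>)"
      by blast
  qed
  from image_compactin[OF cX this] show ?thesis by (simp add: compact_space_def)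
qed

definition topologically_transitive :: "(int \<Rightarrow> nat) set \<Rightarrow> bool" where
  "topologically_transitive X \<longleftrightarrow>
     (\<forall>U V. openin (shift_topology X) U \<and> openin (shift_topology X) V \<and> U \<noteq> {} \<and> V \<noteq> {} \<longrightarrow>
        (\<exists>n. (left_shift ^^ n) ` U \<inter> V \<noteq> {}))"


section \<open>Markov measures\<close>

text \<open>
  As usual for a Markov measure on a topological Markov chain, the transition probability
  \<^term>\<open>P i j\<close> is positive exactly when the transition from \<^term>\<open>i\<close> to \<^term>\<open>j\<close> is admissible,
  so that the measure lives on the whole chain and not on a smaller subshift.
\<close>

definition markov_measure :: "nat \<Rightarrow> (nat \<Rightarrow> nat \<Rightarrow> bool) \<Rightarrow> (int \<Rightarrow> nat) measure \<Rightarrow> bool" where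
  "markov_measure N A \<mu> \<longleftrightarrow>
     space \<mu> = markov_chain_space N A \<and>
     sets \<mu> = sigma_sets (markov_chain_space N A) {U. openin (shift_topology (markov_chain_space N A)) U} \<and>
     prob_space \<mu> \<and>
     (\<exists>(p :: nat \<Rightarrow> real) (P :: nat \<Rightarrow> nat \<Rightarrow> real).
        (\<forall>i\<in>{1..N}. 0 \<le> p i) \<and> (\<Sum>i\<in>{1..N}. p i) = 1 \<and>
        (\<forall>i\<in>{1..N}. \<forall>j\<in>{1..N}. 0 \<le> P i j \<and> (0 < P i j \<longleftrightarrow> A i j)) \<and>
        (\<forall>i\<in>{1..N}. (\<Sum>j\<in>{1..N}. P i j) = 1) \<and>
        (\<forall>j\<in>{1..N}. (\<Sum>i\<in>{1..N}. p i * P i j) = p j) \<and>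
        (\<forall>(m :: int) w. w \<noteq> [] \<and> set w \<subseteq> {1..N} \<longrightarrow>
           measure \<mu> {\<omega> \<in> markov_chain_space N A. \<forall>k<length w. \<omega> (m + int k) = w ! k} =
           p (w ! 0) * (\<Prod>k<length w - 1. P (w ! k) (w ! (k + 1)))))"

definition shift_invariant :: "(int \<Rightarrow> nat) measure \<Rightarrow> bool" where
  "shift_invariant \<mu> \<longleftrightarrow> left_shift \<in> measurable \<mu> \<mu> \<and> distr \<mu> \<mu> left_shift = \<mu>"

definition shift_ergodic :: "(int \<Rightarrow> nat) measure \<Rightarrow> bool" where
  "shift_ergodic \<mu> \<longleftrightarrow>
     (\<forall>B\<in>sets \<mu>. left_shift -` B \<inter> space \<mu> = B \<longrightarrow> measure \<mu> B = 0 \<or> measure \<mu> B = 1)"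

definition standard_measure :: "(int \<Rightarrow> nat) measure \<Rightarrow> ((int \<Rightarrow> nat) \<times> real) measure" where
  "standard_measure \<mu> = \<mu> \<Otimes>\<^sub>M restrict_space lborel unit_interval"


section \<open>Skew products over the interval\<close>

text \<open>
  Derivatives are taken within the set under consideration, hence one-sided at the end points of
  an interval.
\<close>

definition C1_on :: "real set \<Rightarrow> (real \<Rightarrow> real) \<Rightarrow> bool" where
  "C1_on S f \<longleftrightarrow>
     (\<exists>f'. (\<forall>x\<in>S. (f has_real_derivative f' x) (at x within S)) \<and> continuous_on S f')"

definition C1_diffeo_onto_image :: "(real \<Rightarrow> real) \<Rightarrow> bool" where
  "C1_diffeo_onto_image f \<longleftrightarrow>
     C1_on unit_interval f \<and> inj_on f unit_interval \<and>
     C1_on (f ` unit_interval) (inv_into unit_interval f)"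

abbreviation unit_deriv :: "(real \<Rightarrow> real) \<Rightarrow> real \<Rightarrow> real" where
  "unit_deriv f x \<equiv> vector_derivative f (at x within unit_interval)"

definition C1_dist :: "(real \<Rightarrow> real) \<Rightarrow> (real \<Rightarrow> real) \<Rightarrow> real" where
  "C1_dist f g =
     (SUP x\<in>unit_interval. max \<bar>f x - g x\<bar> \<bar>unit_deriv f x - unit_deriv g x\<bar>)"

text \<open>
  The inverses of two fiber maps have different domains. To compare them, a map of the
  interval is extended to the real line with constant derivative on either side of the interval;
  the inverse of the extension agrees with the inverse of the map on the image of the interval,
  and it is defined on the whole unit interval.
\<close>

definition linear_extension :: "(real \<Rightarrow> real) \<Rightarrow> real \<Rightarrow> real" where
  "linear_extension f x =
     (let c = max 0 (min 1 x)
      in f c + unit_deriv f c * (x - c))"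

definition C1_dist_inverse :: "(real \<Rightarrow> real) \<Rightarrow> (real \<Rightarrow> real) \<Rightarrow> real" where
  "C1_dist_inverse f g = C1_dist (inv (linear_extension f)) (inv (linear_extension g))"

type_synonym skew_map = "(int \<Rightarrow> nat) \<times> real \<Rightarrow> (int \<Rightarrow> nat) \<times> real"

definition fiber :: "skew_map \<Rightarrow> (int \<Rightarrow> nat) \<Rightarrow> real \<Rightarrow> real" where
  "fiber F \<omega> x = snd (F (\<omega>, x))"

definition skew_products :: "(int \<Rightarrow> nat) set \<Rightarrow> skew_map set" where
  "skew_products X =
     {F \<in> extensional (X \<times> unit_interval).
        (\<forall>\<omega>\<in>X. \<forall>x\<in>unit_interval. fst (F (\<omega>, x)) = left_shift \<omega>) \<and>
        (\<forall>\<omega>\<in>X. fiber F \<omega> ` unit_interval \<subseteq> unit_interval \<and>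
                C1_diffeo_onto_image (fiber F \<omega>) \<and>
                strict_mono_on unit_interval (fiber F \<omega>)) \<and>
        (\<forall>\<omega>\<in>X. \<forall>\<epsilon>>0. \<exists>\<delta>>0. \<forall>\<eta>\<in>X.
           shift_dist \<eta> \<omega> < \<delta> \<longrightarrow> C1_dist (fiber F \<eta>) (fiber F \<omega>) < \<epsilon>)}"

definition skew_dist :: "(int \<Rightarrow> nat) set \<Rightarrow> skew_map \<Rightarrow> skew_map \<Rightarrow> real" where
  "skew_dist X F G =
     (if F \<in> skew_products X \<and> G \<in> skew_products X then
        SUP \<omega>\<in>X. max (C1_dist (fiber F \<omega>) (fiber G \<omega>)) (C1_dist_inverse (fiber F \<omega>) (fiber G \<omega>))
      else 0)"

abbreviation skew_topology :: "(int \<Rightarrow> nat) set \<Rightarrow> skew_map topology" where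
  "skew_topology X \<equiv> Metric_space.mtopology (skew_products X) (skew_dist X)"


section \<open>The distance on skew products is a metric\<close>

definition C1_bounded :: "real \<Rightarrow> (real \<Rightarrow> real) \<Rightarrow> bool" where
  "C1_bounded B f \<longleftrightarrow> (\<forall>x\<in>unit_interval. \<bar>f x\<bar> \<le> B \<and> \<bar>unit_deriv f x\<bar> \<le> B)"

lemma C1_dist_pointwise:
  assumes "C1_bounded B f" "C1_bounded C g" "x \<in> unit_interval"
  shows "max \<bar>f x - g x\<bar> \<bar>unit_deriv f x - unit_deriv g x\<bar> \<le> C1_dist f g"
  unfolding C1_dist_def
proof (rule cSUP_upper[OF assms(3)])
  show "bdd_above ((\<lambda>x. max \<bar>f x - g x\<bar> \<bar>unit_deriv f x - unit_deriv g x\<bar>) ` unit_interval)"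
  proof (rule bdd_aboveI2)
    fix x :: real assume "x \<in> unit_interval"
    then have "\<bar>f x\<bar> \<le> B" "\<bar>unit_deriv f x\<bar> \<le> B" "\<bar>g x\<bar> \<le> C" "\<bar>unit_deriv g x\<bar> \<le> C"
      using assms unfolding C1_bounded_def by blast+
    then show "max \<bar>f x - g x\<bar> \<bar>unit_deriv f x - unit_deriv g x\<bar> \<le> B + C" by linarith
  qed
qed

lemma C1_dist_leI:
  assumes "\<And>x. x \<in> unit_interval \<Longrightarrow> max \<bar>f x - g x\<bar> \<bar>unit_deriv f x - unit_deriv g x\<bar> \<le> r"
  shows "C1_dist f g \<le> r"
  unfolding C1_dist_def by (rule cSUP_least) (use assms in auto)

lemma C1_dist_commute: "C1_dist f g = C1_dist g f"
  unfolding C1_dist_def by (simp add: abs_minus_commute)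

lemma C1_dist_le_add:
  assumes "C1_bounded B f" "C1_bounded C g" shows "C1_dist f g \<le> B + C"
proof (rule C1_dist_leI)
  fix x :: real assume "x \<in> unit_interval"
  then have "\<bar>f x\<bar> \<le> B" "\<bar>unit_deriv f x\<bar> \<le> B" "\<bar>g x\<bar> \<le> C" "\<bar>unit_deriv g x\<bar> \<le> C"
    using assms unfolding C1_bounded_def by blast+
  then show "max \<bar>f x - g x\<bar> \<bar>unit_deriv f x - unit_deriv g x\<bar> \<le> B + C" by linarith
qed

lemma C1_dist_nonneg:
  assumes "C1_bounded B f" "C1_bounded C g" shows "0 \<le> C1_dist f g"
  using C1_dist_pointwise[OF assms, of 0] by auto

lemma C1_dist_triangle:
  assumes "C1_bounded B f" "C1_bounded C g" "C1_bounded D h"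
  shows "C1_dist f h \<le> C1_dist f g + C1_dist g h"
proof (rule C1_dist_leI)
  fix x :: real assume x: "x \<in> unit_interval"
  show "max \<bar>f x - h x\<bar> \<bar>unit_deriv f x - unit_deriv h x\<bar> \<le> C1_dist f g + C1_dist g h"
    using C1_dist_pointwise[OF assms(1,2) x] C1_dist_pointwise[OF assms(2,3) x] by linarith
qed

lemma C1_on_unit_deriv:
  assumes "C1_on unit_interval f"
  shows "\<And>x. x \<in> unit_interval \<Longrightarrow> (f has_real_derivative unit_deriv f x) (at x within unit_interval)"
    and "continuous_on unit_interval (unit_deriv f)"
proof -
  obtain f' where f': "\<And>x. x \<in> unit_interval \<Longrightarrow> (f has_real_derivative f' x) (at x within unit_interval)"
    and c: "continuous_on unit_interval f'" using assms unfolding C1_on_def by blast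
  have eq: "unit_deriv f x = f' x" if "x \<in> unit_interval" for x
    using vector_derivative_within_cbox[of 0 1 x f "f' x"] f'[OF that] that
    by (simp add: has_real_derivative_iff_has_vector_derivative)
  show "\<And>x. x \<in> unit_interval \<Longrightarrow> (f has_real_derivative unit_deriv f x) (at x within unit_interval)"
    using f' eq by simp
  show "continuous_on unit_interval (unit_deriv f)" by (rule continuous_on_eq[OF c]) (simp add: eq)
qed

lemma C1_on_bounded:
  assumes "C1_on unit_interval f" shows "\<exists>B. C1_bounded B f"
proof -
  have "continuous_on unit_interval f"
    by (rule DERIV_continuous_on[OF C1_on_unit_deriv(1)[OF assms]])
  then have "bounded (f ` unit_interval)" "bounded (unit_deriv f ` unit_interval)"
    using C1_on_unit_deriv(2)[OF assms] by (auto intro!: compact_imp_bounded compact_continuous_image)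
  then obtain a b where "\<forall>x\<in>unit_interval. \<bar>f x\<bar> \<le> a" "\<forall>x\<in>unit_interval. \<bar>unit_deriv f x\<bar> \<le> b"
    unfolding bounded_iff by auto
  then have "C1_bounded (max a b) f" unfolding C1_bounded_def by (auto simp: le_max_iff_disj)
  then show ?thesis ..
qed

lemma unit_deriv_pos:
  assumes "C1_diffeo_onto_image f" "strict_mono_on unit_interval f" "x \<in> unit_interval"
  shows "0 < unit_deriv f x"
proof -
  let ?I = unit_interval and ?g = "inv_into unit_interval f"
  have c1: "C1_on ?I f" and inj: "inj_on f ?I" and c2: "C1_on (f ` ?I) ?g"
    using assms(1) unfolding C1_diffeo_onto_image_def by auto
  have df: "(f has_real_derivative unit_deriv f x) (at x within ?I)" using C1_on_unit_deriv(1)[OF c1 assms(3)] .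
  obtain g' where g': "(?g has_real_derivative g') (at (f x) within f ` ?I)"
    using c2 assms(3) unfolding C1_on_def by blast
  have "((?g \<circ> f) has_real_derivative g' * unit_deriv f x) (at x within ?I)"
    by (rule DERIV_image_chain[OF g' df])
  then have "((\<lambda>x. x) has_real_derivative g' * unit_deriv f x) (at x within ?I)"
    by (rule has_field_derivative_transform_within[where d = 1]) (use assms(3) inj in auto)
  moreover have "((\<lambda>x. x) has_real_derivative 1) (at x within ?I)" by (rule DERIV_ident)
  ultimately have "g' * unit_deriv f x = 1"
    using vector_derivative_unique_within[of x ?I "\<lambda>x. x" "g' * unit_deriv f x" 1] assms(3)
    by (simp add: has_real_derivative_iff_has_vector_derivative trivial_limit_within islimpt_Icc)
  then have ne: "unit_deriv f x \<noteq> 0" by auto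
  have "0 \<le> unit_deriv f x"
  proof (rule tendsto_lowerbound)
    show "((\<lambda>y. (f y - f x) / (y - x)) \<longlongrightarrow> unit_deriv f x) (at x within ?I)"
      using df by (simp add: has_field_derivative_iff)
    show "\<forall>\<^sub>F y in at x within ?I. 0 \<le> (f y - f x) / (y - x)"
      unfolding eventually_at
    proof (intro exI[of _ 1] conjI ballI impI)
      fix y assume y: "y \<in> ?I" "y \<noteq> x \<and> dist y x < 1"
      show "0 \<le> (f y - f x) / (y - x)"
      proof (cases "y < x")
        case True
        then have "f y < f x" using strict_mono_onD[OF assms(2) y(1) assms(3)] by blast
        with True show ?thesis by (simp add: divide_nonpos_neg)
      next
        case False
        then have "x < y" using y by auto
        then have "f x < f y" using \<open>x < y\<close> strict_mono_onD[OF assms(2) assms(3) y(1)] by blast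
        with \<open>x < y\<close> show ?thesis by simp
      qed
    qed simp
    show "at x within ?I \<noteq> bot"
      using assms(3) by (simp add: trivial_limit_within islimpt_Icc)
  qed
  with ne show ?thesis by simp
qed


lemma DERIV_linear_extension:
  assumes "C1_on unit_interval f"
  shows "(linear_extension f has_real_derivative unit_deriv f (max 0 (min 1 x))) (at x)"
proof -
  let ?L = "linear_extension f"
  have mid: "(?L has_real_derivative unit_deriv f y) (at y within {0..1})" if "y \<in> {0..1}" for y
    by (rule has_field_derivative_transform_within[OF C1_on_unit_deriv(1)[OF assms that], of 1])
      (use that in \<open>auto simp: linear_extension_def\<close>)
  have lo: "(?L has_real_derivative unit_deriv f 0) (at y within {..0})" if "y \<le> 0" for y
    by (rule has_field_derivative_transform_within[of "\<lambda>x. f 0 + unit_deriv f 0 * x" _ _ _ 1])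
      (use that in \<open>auto simp: linear_extension_def intro!: derivative_eq_intros\<close>)
  have hi: "(?L has_real_derivative unit_deriv f 1) (at y within {1..})" if "1 \<le> y" for y
    by (rule has_field_derivative_transform_within[of "\<lambda>x. f 1 + unit_deriv f 1 * (x - 1)" _ _ _ 1])
      (use that in \<open>auto simp: linear_extension_def intro!: derivative_eq_intros\<close>)
  have un: "(?L has_real_derivative D) (at y within S \<union> T)"
    if "(?L has_real_derivative D) (at y within S)" "(?L has_real_derivative D) (at y within T)"
    for D y S T
    using that unfolding has_field_derivative_iff by (rule Lim_Un)
  consider "x < 0" | "x = 0" | "0 < x" "x < 1" | "x = 1" | "1 < x" by linarith
  then show ?thesis
  proof cases
    case 1
    then have "at x within {..0} = at x" by (intro at_within_interior) auto
    with lo[of x] 1 show ?thesis by simp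
  next
    case 2
    have "at (0::real) within {..0} \<union> {0..1} = at 0"
    proof (rule at_within_interior)
      have "{..0} \<union> {0..1} = {..1::real}" by auto
      then show "(0::real) \<in> interior ({..0} \<union> {0..1})" by simp
    qed
    with un[OF lo[of 0] mid[of 0]] 2 show ?thesis by simp
  next
    case 3
    then have "at x within {0..1} = at x" by (intro at_within_interior) auto
    with mid[of x] 3 show ?thesis by simp
  next
    case 4
    have "{0..1} \<union> {1..} = {0::real..}" by auto
    then have "at (1::real) within {0..1} \<union> {1..} = at 1"
      by (subst at_within_interior) auto
    with un[OF mid[of 1] hi[of 1]] 4 show ?thesis by simp
  next
    case 5
    then have "at x within {1..} = at x" by (intro at_within_interior) auto
    with hi[of x] 5 show ?thesis by simp
  qed
qed

lemma C1_bounded_inverse: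
  assumes "C1_on unit_interval f" "f ` unit_interval \<subseteq> unit_interval"
    and c: "0 < c" "\<And>x. x \<in> unit_interval \<Longrightarrow> c \<le> unit_deriv f x"
  shows "C1_bounded (1 / c) (inv (linear_extension f))"
proof -
  let ?L = "linear_extension f"
  let ?D = "\<lambda>x. unit_deriv f (max 0 (min 1 x))"
  have D: "c \<le> ?D x" for x by (rule c(2)) auto
  note der = DERIV_linear_extension[OF assms(1)]
  have exp1: "c * (b - a) \<le> ?L b - ?L a" if ab: "a < b" for a b
  proof -
    obtain z where "?L b - ?L a = (b - a) * ?D z" using MVT2[of a b ?L ?D] ab der by blast
    with D[of z] ab show ?thesis by (simp add: mult.commute mult_left_mono)
  qed
  have exp: "c * \<bar>b - a\<bar> \<le> \<bar>?L b - ?L a\<bar>" for a b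
    using exp1[of a b] exp1[of b a] by (cases a b rule: linorder_cases) auto
  have inj: "inj ?L"
  proof (rule injI)
    fix a b assume "?L a = ?L b"
    with exp[of b a] c(1) show "a = b" by (simp add: mult_le_0_iff)
  qed
  have cont: "continuous_on S ?L" for S
    by (meson DERIV_isCont continuous_at_imp_continuous_on der)
  have "surj ?L"
  unfolding surj_def
  proof
    fix y
    define r where "r = (\<bar>y\<bar> + \<bar>?L 0\<bar> + 1) / c"
    have r: "0 < r" "c * r = \<bar>y\<bar> + \<bar>?L 0\<bar> + 1" using c(1) by (auto simp: r_def)
    have "?L (- r) \<le> y" "y \<le> ?L r"
      using exp1[of 0 r] exp1[of "- r" 0] r by auto
    then show "\<exists>x. y = ?L x"
      using IVT'[of ?L "- r" y r] cont r by force
  qed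
  then have L_inv: "?L (inv ?L y) = y" for y by (rule surj_f_inv_f)
  have lip: "\<bar>inv ?L y - inv ?L z\<bar> \<le> \<bar>y - z\<bar> / c" for y z
    using exp[of "inv ?L y" "inv ?L z"] c(1) by (simp add: L_inv field_simps)
  have isc: "isCont (inv ?L) y" for y
  proof -
    have "((\<lambda>z. \<bar>z - y\<bar> / c) \<longlongrightarrow> \<bar>y - y\<bar> / c) (at y)"
      by (intro tendsto_intros) (use c(1) in simp)
    then have lim: "((\<lambda>z. \<bar>z - y\<bar> / c) \<longlongrightarrow> 0) (at y)" by simp
    have "((\<lambda>z. inv ?L z - inv ?L y) \<longlongrightarrow> 0) (at y)"
      by (rule Lim_null_comparison[OF _ lim]) (simp add: lip)
    then show ?thesis unfolding isCont_def by (rule LIM_zero_cancel)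
  qed
  have inv_der: "(inv ?L has_real_derivative inverse (?D (inv ?L y))) (at y)" for y
  proof (rule DERIV_inverse_function[OF der, where a = "y - 1" and b = "y + 1"])
    show "?D (inv ?L y) \<noteq> 0" using D[of "inv ?L y"] c(1) by linarith
  qed (simp_all add: L_inv isc)
  have L0: "?L 0 = f 0" "f 0 \<in> unit_interval"
    using subsetD[OF assms(2) imageI[of 0]] by (auto simp: linear_extension_def)
  show ?thesis unfolding C1_bounded_def
  proof (intro ballI conjI)
    fix y :: real assume y: "y \<in> unit_interval"
    have "inv ?L (f 0) = 0" using inj L0(1) by (metis inv_f_f)
    then have "\<bar>inv ?L y\<bar> \<le> \<bar>y - f 0\<bar> / c" using lip[of y "f 0"] by simp
    also have "\<dots> \<le> 1 / c" using y L0(2) c(1) by (intro divide_right_mono) auto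
    finally show "\<bar>inv ?L y\<bar> \<le> 1 / c" .
    have "(inv ?L has_vector_derivative inverse (?D (inv ?L y))) (at y within unit_interval)"
      using inv_der[of y]
      by (simp add: has_real_derivative_iff_has_vector_derivative has_vector_derivative_at_within)
    then have "unit_deriv (inv ?L) y = inverse (?D (inv ?L y))"
      by (intro vector_derivative_within_cbox[of 0 1 y, simplified cbox_interval])
        (use y in simp_all)
    then show "\<bar>unit_deriv (inv ?L) y\<bar> \<le> 1 / c"
      using le_imp_inverse_le[OF D c(1), of "inv ?L y"] c(1) less_le_trans[OF c(1) D, of "inv ?L y"]
      by (simp add: inverse_eq_divide)
  qed
qed

lemma skew_products_uniform_bounds:
  assumes X: "compact_space (shift_topology X)" and F: "F \<in> skew_products X"
  shows "\<exists>B. \<forall>\<omega>\<in>X. C1_bounded B (fiber F \<omega>) \<and> C1_bounded B (inv (linear_extension (fiber F \<omega>)))"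
proof -
  interpret Metric_space X shift_dist by (rule Metric_space_shift_dist)
  have fF: "fiber F \<omega> ` unit_interval \<subseteq> unit_interval" "C1_diffeo_onto_image (fiber F \<omega>)"
    "strict_mono_on unit_interval (fiber F \<omega>)" "C1_on unit_interval (fiber F \<omega>)" if "\<omega> \<in> X" for \<omega>
    using F that unfolding skew_products_def C1_diffeo_onto_image_def by auto
  have contF: "\<exists>\<delta>>0. \<forall>\<eta>\<in>X. shift_dist \<eta> \<omega> < \<delta> \<longrightarrow> C1_dist (fiber F \<eta>) (fiber F \<omega>) < \<epsilon>"
    if "\<omega> \<in> X" "\<epsilon> > 0" for \<omega> \<epsilon>
    using F that unfolding skew_products_def by blast
  have "\<exists>\<delta> c. 0 < \<delta> \<and> 0 < c \<and> (\<forall>\<eta>\<in>X. shift_dist \<eta> \<omega> < \<delta> \<longrightarrow>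
      (\<forall>x\<in>unit_interval. c \<le> unit_deriv (fiber F \<eta>) x \<and> unit_deriv (fiber F \<eta>) x \<le> 1 / c))" if w: "\<omega> \<in> X" for \<omega>
  proof -
    let ?h = "unit_deriv (fiber F \<omega>)"
    have "continuous_on unit_interval ?h" by (rule C1_on_unit_deriv(2)[OF fF(4)[OF w]])
    then obtain z where z: "z \<in> unit_interval" "\<And>x. x \<in> unit_interval \<Longrightarrow> ?h z \<le> ?h x"
      using continuous_attains_inf[of unit_interval ?h] by auto
    obtain M where M: "C1_bounded M (fiber F \<omega>)" using C1_on_bounded[OF fF(4)[OF w]] ..
    have pos: "0 < ?h z" by (rule unit_deriv_pos[OF fF(2,3)[OF w] z(1)])
    have hM: "\<bar>?h x\<bar> \<le> M" if "x \<in> unit_interval" for x using M that unfolding C1_bounded_def by blast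
    have M0: "0 < M" using hM[OF z(1)] pos by linarith
    obtain \<delta> where \<delta>: "\<delta> > 0" "\<And>\<eta>. \<eta> \<in> X \<Longrightarrow> shift_dist \<eta> \<omega> < \<delta> \<Longrightarrow> C1_dist (fiber F \<eta>) (fiber F \<omega>) < ?h z / 2"
      using contF[OF w, of "?h z / 2"] pos by auto
    define c where "c = min (?h z / 2) (1 / (2 * M))"
    have c0: "0 < c" using pos M0 by (simp add: c_def)
    have "c \<le> 1 / (2 * M)" by (simp add: c_def)
    then have cM: "2 * M \<le> 1 / c" using c0 M0 by (simp add: field_simps)
    show ?thesis
    proof (intro exI conjI ballI impI)
      show "0 < \<delta>" "0 < c" by fact+
      fix \<eta> x assume e: "\<eta> \<in> X" "shift_dist \<eta> \<omega> < \<delta>" and x: "x \<in> unit_interval"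
      obtain M' where M': "C1_bounded M' (fiber F \<eta>)" using C1_on_bounded[OF fF(4)[OF e(1)]] ..
      have "\<bar>unit_deriv (fiber F \<eta>) x - ?h x\<bar> < ?h z / 2"
        using C1_dist_pointwise[OF M' M x] \<delta>(2)[OF e] by linarith
      then have "?h z / 2 \<le> unit_deriv (fiber F \<eta>) x" "unit_deriv (fiber F \<eta>) x \<le> 2 * M"
        using z(2)[OF x] hM[OF x] hM[OF z(1)] by linarith+
      then show "c \<le> unit_deriv (fiber F \<eta>) x" "unit_deriv (fiber F \<eta>) x \<le> 1 / c"
        using cM by (auto simp: c_def)
    qed
  qed
  then obtain \<delta> c where dc: "\<And>\<omega>. \<omega> \<in> X \<Longrightarrow> 0 < \<delta> \<omega>" "\<And>\<omega>. \<omega> \<in> X \<Longrightarrow> 0 < (c \<omega> :: real)"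
    "\<And>\<omega> \<eta> x. \<omega> \<in> X \<Longrightarrow> \<eta> \<in> X \<Longrightarrow> shift_dist \<eta> \<omega> < \<delta> \<omega> \<Longrightarrow> x \<in> unit_interval \<Longrightarrow>
      c \<omega> \<le> unit_deriv (fiber F \<eta>) x \<and> unit_deriv (fiber F \<eta>) x \<le> 1 / c \<omega>"
    by metis
  have "\<exists>\<F>. finite \<F> \<and> \<F> \<subseteq> (\<lambda>\<omega>. mball \<omega> (\<delta> \<omega>)) ` X \<and> topspace mtopology \<subseteq> \<Union>\<F>"
    using X unfolding compact_space_def
  proof (rule compactinD)
    show "openin mtopology U" if "U \<in> (\<lambda>\<omega>. mball \<omega> (\<delta> \<omega>)) ` X" for U
      using that by auto
    show "topspace mtopology \<subseteq> \<Union>((\<lambda>\<omega>. mball \<omega> (\<delta> \<omega>)) ` X)"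
      using dc(1) by fastforce
  qed
  then obtain \<F> where fin: "finite \<F>" and sub: "\<F> \<subseteq> (\<lambda>\<omega>. mball \<omega> (\<delta> \<omega>)) ` X"
    and cover: "X \<subseteq> \<Union>\<F>" by auto
  obtain Y where "Y \<subseteq> X" "finite Y" "\<F> = (\<lambda>\<omega>. mball \<omega> (\<delta> \<omega>)) ` Y"
    using finite_subset_image[OF fin sub] by blast
  with cover have Y: "finite Y" "Y \<subseteq> X" "X \<subseteq> (\<Union>\<omega>\<in>Y. mball \<omega> (\<delta> \<omega>))" by auto
  define k where "k = Min (insert 1 (c ` Y))"
  have k: "0 < k" "k \<le> 1" "\<And>\<omega>. \<omega> \<in> Y \<Longrightarrow> k \<le> c \<omega>"
    using Y dc(2) by (auto simp: k_def)
  have "C1_bounded (1 / k) (fiber F \<eta>) \<and> C1_bounded (1 / k) (inv (linear_extension (fiber F \<eta>)))"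
    if e: "\<eta> \<in> X" for \<eta>
  proof -
    obtain \<omega> where w: "\<omega> \<in> Y" "\<eta> \<in> mball \<omega> (\<delta> \<omega>)" using Y(3) e by blast
    then have wX: "\<omega> \<in> X" "shift_dist \<eta> \<omega> < \<delta> \<omega>" using Y(2) by (auto simp: shift_dist_commute)
    have ck: "1 / c \<omega> \<le> 1 / k" using k(1) k(3)[OF w(1)] by (simp add: frac_le)
    have b: "k \<le> unit_deriv (fiber F \<eta>) x" "unit_deriv (fiber F \<eta>) x \<le> 1 / k" if "x \<in> unit_interval" for x
      using dc(3)[OF wX(1) e wX(2) that] k(3)[OF w(1)] ck by linarith+
    have "C1_bounded (1 / k) (fiber F \<eta>)" unfolding C1_bounded_def
    proof (intro ballI conjI)
      fix x :: real assume x: "x \<in> unit_interval"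
      then have "fiber F \<eta> x \<in> unit_interval" using fF(1)[OF e] by blast
      moreover have "1 \<le> 1 / k" using k by simp
      ultimately show "\<bar>fiber F \<eta> x\<bar> \<le> 1 / k" by auto
      show "\<bar>unit_deriv (fiber F \<eta>) x\<bar> \<le> 1 / k" using b[OF x] k(1) by linarith
    qed
    moreover have "C1_bounded (1 / k) (inv (linear_extension (fiber F \<eta>)))"
      by (rule C1_bounded_inverse[OF fF(4,1)[OF e] k(1) b(1)])
    ultimately show ?thesis ..
  qed
  then show ?thesis by blast
qed

lemma Metric_space_skew_dist:
  assumes X: "compact_space (shift_topology X)" and ne: "X \<noteq> {}"
  shows "Metric_space (skew_products X) (skew_dist X)"
proof -
  let ?S = "skew_products X"
  let ?d = "\<lambda>F G \<omega>. max (C1_dist (fiber F \<omega>) (fiber G \<omega>)) (C1_dist_inverse (fiber F \<omega>) (fiber G \<omega>))"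
  obtain B where B: "\<And>F \<omega>. F \<in> ?S \<Longrightarrow> \<omega> \<in> X \<Longrightarrow> C1_bounded (B F) (fiber F \<omega>)"
    "\<And>F \<omega>. F \<in> ?S \<Longrightarrow> \<omega> \<in> X \<Longrightarrow> C1_bounded (B F) (inv (linear_extension (fiber F \<omega>)))"
    using skew_products_uniform_bounds[OF X] by metis
  have up: "?d F G \<omega> \<le> skew_dist X F G" if "F \<in> ?S" "G \<in> ?S" "\<omega> \<in> X" for F G \<omega>
  proof -
    have "bdd_above (?d F G ` X)"
      by (rule bdd_aboveI2[where M = "B F + B G"])
        (use B that C1_dist_le_add in \<open>auto simp: C1_dist_inverse_def\<close>)
    then show ?thesis using that unfolding skew_dist_def by (auto intro: cSUP_upper2[where x = \<omega>])
  qed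
  have least: "skew_dist X F G \<le> r" if "F \<in> ?S" "G \<in> ?S" "\<And>\<omega>. \<omega> \<in> X \<Longrightarrow> ?d F G \<omega> \<le> r" for F G r
    using that ne unfolding skew_dist_def by (auto intro!: cSUP_least)
  obtain \<omega>0 where w0: "\<omega>0 \<in> X" using ne by blast
  show ?thesis
  proof
    show "0 \<le> skew_dist X F G" for F G
    proof (cases "F \<in> ?S \<and> G \<in> ?S")
      case True
      then have "0 \<le> C1_dist (fiber F \<omega>0) (fiber G \<omega>0)" using B(1) w0 by (meson C1_dist_nonneg)
      with up[of F G \<omega>0] True w0 show ?thesis by auto
    qed (auto simp: skew_dist_def)
    show "skew_dist X F G = skew_dist X G F" for F G
      unfolding skew_dist_def C1_dist_inverse_def by (auto simp: C1_dist_commute)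
    show "skew_dist X F H \<le> skew_dist X F G + skew_dist X G H"
      if S: "F \<in> ?S" "G \<in> ?S" "H \<in> ?S" for F G H
    proof (rule least[OF S(1,3)])
      fix \<omega> assume w: "\<omega> \<in> X"
      show "?d F H \<omega> \<le> skew_dist X F G + skew_dist X G H"
        using up[OF S(1,2) w] up[OF S(2,3) w]
          C1_dist_triangle[OF B(1)[OF S(1) w] B(1)[OF S(2) w] B(1)[OF S(3) w]]
          C1_dist_triangle[OF B(2)[OF S(1) w] B(2)[OF S(2) w] B(2)[OF S(3) w]]
        unfolding C1_dist_inverse_def by linarith
    qed
    show "skew_dist X F G = 0 \<longleftrightarrow> F = G" if S: "F \<in> ?S" "G \<in> ?S" for F G
    proof
      assume 0: "skew_dist X F G = 0"
      show "F = G"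
      proof (rule extensionalityI[of _ "X \<times> unit_interval"])
        show "F \<in> extensional (X \<times> unit_interval)" "G \<in> extensional (X \<times> unit_interval)"
          using S by (auto simp: skew_products_def)
        fix q assume "q \<in> X \<times> unit_interval"
        then obtain \<omega> x where q: "q = (\<omega>, x)" "\<omega> \<in> X" "x \<in> unit_interval" by blast
        have "fiber F \<omega> x = fiber G \<omega> x"
          using C1_dist_pointwise[OF B(1)[OF S(1) q(2)] B(1)[OF S(2) q(2)] q(3)] up[OF S q(2)] 0 by auto
        moreover have "fst (F q) = left_shift \<omega>" "fst (G q) = left_shift \<omega>"
          using S q by (auto simp: skew_products_def)
        ultimately show "F q = G q" using q(1) by (intro prod_eqI) (simp_all add: fiber_def)
      qed
    next
      assume "F = G"
      then show "skew_dist X F G = 0"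
        using S ne by (simp add: skew_dist_def C1_dist_def C1_dist_inverse_def)
    qed
  qed
qed


section \<open>Drifting points and the anchored set\<close>

text \<open>Graphs are represented by the functions that they are graphs of.\<close>

definition graph_image :: "skew_map \<Rightarrow> ((int \<Rightarrow> nat) \<Rightarrow> real) \<Rightarrow> (int \<Rightarrow> nat) \<Rightarrow> real" where
  "graph_image F \<gamma> \<omega> = fiber F (right_shift \<omega>) (\<gamma> (right_shift \<omega>))"

definition graph_less ::
  "(int \<Rightarrow> nat) set \<Rightarrow> ((int \<Rightarrow> nat) \<Rightarrow> real) \<Rightarrow> ((int \<Rightarrow> nat) \<Rightarrow> real) \<Rightarrow> bool" where
  "graph_less X \<phi>1 \<phi>2 \<longleftrightarrow> (\<forall>\<omega>\<in>X. \<phi>1 \<omega> < \<phi>2 \<omega>)"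

abbreviation continuous_graph :: "(int \<Rightarrow> nat) set \<Rightarrow> ((int \<Rightarrow> nat) \<Rightarrow> real) \<Rightarrow> bool" where
  "continuous_graph X \<gamma> \<equiv> continuous_map (shift_topology X) (top_of_set unit_interval) \<gamma>"

definition Up :: "(int \<Rightarrow> nat) set \<Rightarrow> skew_map \<Rightarrow> ((int \<Rightarrow> nat) \<times> real) set" where
  "Up X F = {(\<omega>, x) \<in> X \<times> unit_interval.
     \<exists>\<gamma>. continuous_graph X \<gamma> \<and> graph_less X \<gamma> (graph_image F \<gamma>) \<and>
         \<gamma> \<omega> < x \<and> x < graph_image F \<gamma> \<omega>}"

definition Down :: "(int \<Rightarrow> nat) set \<Rightarrow> skew_map \<Rightarrow> ((int \<Rightarrow> nat) \<times> real) set" where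
  "Down X F = {(\<omega>, x) \<in> X \<times> unit_interval.
     \<exists>\<gamma>. continuous_graph X \<gamma> \<and> graph_less X (graph_image F \<gamma>) \<gamma> \<and>
         graph_image F \<gamma> \<omega> < x \<and> x < \<gamma> \<omega>}"

definition Indiff :: "(int \<Rightarrow> nat) set \<Rightarrow> skew_map \<Rightarrow> ((int \<Rightarrow> nat) \<times> real) set" where
  "Indiff X F = X \<times> unit_interval - (Up X F \<union> Down X F)"


section \<open>Monotone families, small sets, meager sets\<close>

definition skew_less :: "(int \<Rightarrow> nat) set \<Rightarrow> skew_map \<Rightarrow> skew_map \<Rightarrow> bool" where
  "skew_less X F G \<longleftrightarrow> (\<forall>\<omega>\<in>X. \<forall>x\<in>unit_interval. fiber F \<omega> x < fiber G \<omega> x)"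

definition monotone_family ::
  "(int \<Rightarrow> nat) set \<Rightarrow> real \<Rightarrow> real \<Rightarrow> (real \<Rightarrow> skew_map) \<Rightarrow> bool" where
  "monotone_family X a b \<Phi> \<longleftrightarrow>
     (\<forall>s\<in>{a<..<b}. \<forall>t\<in>{a<..<b}. s < t \<longrightarrow> skew_less X (\<Phi> s) (\<Phi> t)) \<or>
     (\<forall>s\<in>{a<..<b}. \<forall>t\<in>{a<..<b}. s < t \<longrightarrow> skew_less X (\<Phi> t) (\<Phi> s))"

definition continuous_family ::
  "(int \<Rightarrow> nat) set \<Rightarrow> real \<Rightarrow> real \<Rightarrow> (real \<Rightarrow> skew_map) \<Rightarrow> bool" where
  "continuous_family X a b \<Phi> \<longleftrightarrow> continuous_map (top_of_set {a<..<b}) (skew_topology X) \<Phi>"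

definition nowhere_dense_in :: "'a topology \<Rightarrow> 'a set \<Rightarrow> bool" where
  "nowhere_dense_in T C \<longleftrightarrow>
     C \<subseteq> topspace T \<and> T interior_of (T closure_of C) = {}"

definition meager_in :: "'a topology \<Rightarrow> 'a set \<Rightarrow> bool" where
  "meager_in T K \<longleftrightarrow>
     (\<exists>\<C>. countable \<C> \<and> (\<forall>C\<in>\<C>. nowhere_dense_in T C) \<and> K = \<Union>\<C>)"

definition small :: "(int \<Rightarrow> nat) set \<Rightarrow> skew_map set \<Rightarrow> bool" where
  "small X C \<longleftrightarrow>
     closedin (skew_topology X) C \<and>
     nowhere_dense_in (skew_topology X) C \<and>
     (\<forall>a b \<Phi>. a < b \<and> continuous_family X a b \<Phi> \<and> monotone_family X a b \<Phi> \<longrightarrow>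
        finite {\<tau> \<in> {a<..<b}. \<Phi> \<tau> \<in> C})"

definition thick_anchored :: "(int \<Rightarrow> nat) set \<Rightarrow> (int \<Rightarrow> nat) measure \<Rightarrow> skew_map set" where
  "thick_anchored X \<mu> =
     {F \<in> skew_products X. measure (standard_measure \<mu>) (Indiff X F) > 0}"

end

theory Submission
  imports Defs
begin

text \<open>
  The set of \<^term>\<open>F\<close> whose anchored set has measure at least \<^term>\<open>c > (0 :: real)\<close> is closed, since
  drifting is an open condition. The heart of the matter is that the anchored sets of two comparable
  skew products intersect in a null set: if \<^term>\<open>F\<close> lies strictly below \<^term>\<open>G\<close> and both half-orbits of
  \<^term>\<open>\<omega>\<close> are dense, then every interior point over \<^term>\<open>\<omega>\<close> drifts up under \<^term>\<open>G\<close> or down under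
  \<^term>\<open>F\<close>. Hence a monotone family has fewer than \<^term>\<open>1 / c + 1\<close> members with an anchored set of
  measure at least \<^term>\<open>c\<close>, and affine perturbations of the fiber maps provide such families
  arbitrarily close to any \<^term>\<open>F\<close>, which gives nowhere density.

  For the dichotomy, a cocycle of monotone self-maps of a finite grid through the given point,
  depending on finitely many coordinates, is inserted between \<^term>\<open>F\<close> and \<^term>\<open>G\<close>. Compositions of
  minimal rank occur along both half-orbits. The future decides which point \<^term>\<open>a\<close> of the image of
  the grid along the past is eventually identified with the given point. If \<^term>\<open>a\<close> lies above the
  given point, the lower boundary of the set reachable from the latter is a graph that drifts up and
  whose iterates climb to \<^term>\<open>a\<close>; the other case is its mirror image.
\<close>

section \<open>Windows of symbols, splicing and compactness\<close>

section \<open>The shift topology\<close>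

text \<open>The gap between the two skew products is uniform by compactness, so it can pay for
  freezing the fiber maps on cylinders and for rounding to a grid. Reachability then depends on
  finitely many symbols and heights, and the lowest reachable height is a locally constant, hence
  continuous, graph.

  The danger is that itineraries leaving the given point come back on both sides of it; then neither
  extreme of the reachable set would climb or sink past it. Minimal rank excludes this: a loop
  returning along the past of \<open>\<omega>0\<close> maps the image of that past injectively into
  itself, since otherwise the rank would drop, and a monotone injection of a finite chain into
  itself is the identity. As \<open>a\<close> lies in this image and merges with the given point in
  the future, all such loops end exactly at \<open>a\<close>. Here the order on the fiber is
  essential.

  The combinatorial graph drifts only weakly. Lowering it slightly makes the drift strict, and one
  application of the fiber maps regains the loss, so it does not accumulate.

  Fiber maps may touch the end points of the interval; the perturbations therefore contract before
  they lift.\<close>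

definition sh :: "int \<Rightarrow> (int \<Rightarrow> nat) \<Rightarrow> int \<Rightarrow> nat" where
  "sh n \<omega> = (\<lambda>m. \<omega> (m + n))"

text \<open>The window is symmetric, so this is the open ball of radius \<open>(1 / 2) ^ k\<close>;
  windows replace the metric from here on.\<close>

definition agree :: "nat \<Rightarrow> (int \<Rightarrow> nat) \<Rightarrow> (int \<Rightarrow> nat) \<Rightarrow> bool" where
  "agree k \<omega> \<eta> \<longleftrightarrow> (\<forall>n. \<bar>n\<bar> \<le> int k \<longrightarrow> \<omega> n = \<eta> n)"

lemma sh_sh [simp]: "sh m (sh n \<omega>) = sh (m + n) \<omega>"
  by (simp add: sh_def add_ac)

lemma sh_0 [simp]: "sh 0 \<omega> = \<omega>"
  by (simp add: sh_def)

lemma left_shift_eq: "left_shift = sh 1" and right_shift_eq: "right_shift = sh (-1)"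
  by (auto simp: left_shift_def right_shift_def sh_def fun_eq_iff)

lemma left_shift_funpow: "(left_shift ^^ n) \<omega> = sh (int n) \<omega>"
  by (induction n) (auto simp: left_shift_eq)

lemma agreeD: "agree k \<omega> \<eta> \<Longrightarrow> - int k \<le> n \<Longrightarrow> n \<le> int k \<Longrightarrow> \<omega> n = \<eta> n"
  by (simp add: agree_def)

lemma agree_refl [simp]: "agree k \<omega> \<omega>"
  by (simp add: agree_def)

lemma agree_sym: "agree k \<omega> \<eta> \<Longrightarrow> agree k \<eta> \<omega>"
  by (simp add: agree_def)

lemma agree_trans: "agree k \<omega> \<eta> \<Longrightarrow> agree k \<eta> \<zeta> \<Longrightarrow> agree k \<omega> \<zeta>"
  by (simp add: agree_def)

lemma agree_mono: "agree k \<omega> \<eta> \<Longrightarrow> j \<le> k \<Longrightarrow> agree j \<omega> \<eta>"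
  by (simp add: agree_def)

lemma agree_sh: "agree (k + nat \<bar>n\<bar>) \<omega> \<eta> \<Longrightarrow> agree k (sh n \<omega>) (sh n \<eta>)"
  by (simp add: agree_def sh_def)

lemma shift_dist_less_iff_agree: "shift_dist \<eta> \<omega> < (1 / 2) ^ k \<longleftrightarrow> agree k \<eta> \<omega>"
  unfolding shift_dist_less_iff agree_def by (simp add: nat_le_iff)

lemma sh_markov_chain_space: "\<omega> \<in> markov_chain_space N A \<Longrightarrow> sh n \<omega> \<in> markov_chain_space N A"
proof -
  assume w: "\<omega> \<in> markov_chain_space N A"
  have "m + 1 + n = m + n + 1" for m by simp
  with w show ?thesis unfolding markov_chain_space_def sh_def mem_Collect_eq by metis
qed

text \<open>Admissibility only relates neighbouring symbols, so a past and a future sharing one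
  symbol can be glued there. All rerouting of itineraries below rests on this.\<close>

lemma splice_markov_chain_space:
  assumes "\<omega> \<in> markov_chain_space N A" "\<eta> \<in> markov_chain_space N A" "\<omega> j = \<eta> j"
  shows "(\<lambda>i. if i \<le> j then \<omega> i else \<eta> i) \<in> markov_chain_space N A"
  unfolding markov_chain_space_def mem_Collect_eq
proof
  fix n
  consider "n < j" | "n = j" | "j < n" by linarith
  then show "(if n \<le> j then \<omega> n else \<eta> n) \<in> {1..N} \<and>
      A (if n \<le> j then \<omega> n else \<eta> n) (if n + 1 \<le> j then \<omega> (n + 1) else \<eta> (n + 1))"
    by cases (use assms in \<open>auto simp: markov_chain_space_def\<close>)
qed

lemma openin_shift_iff:
  "openin (shift_topology X) U \<longleftrightarrow> U \<subseteq> X \<and> (\<forall>\<omega>\<in>U. \<exists>k. \<forall>\<eta>\<in>X. agree k \<eta> \<omega> \<longrightarrow> \<eta> \<in> U)"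
proof -
  interpret Metric_space X shift_dist by (rule Metric_space_shift_dist)
  have "(\<exists>r>0. mball \<omega> r \<subseteq> U) \<longleftrightarrow> (\<exists>k. \<forall>\<eta>\<in>X. agree k \<eta> \<omega> \<longrightarrow> \<eta> \<in> U)" if "\<omega> \<in> X" for \<omega>
  proof
    assume "\<exists>r>0. mball \<omega> r \<subseteq> U"
    then obtain r where r: "r > 0" "mball \<omega> r \<subseteq> U" by blast
    obtain k where k: "(1 / 2) ^ k < r" using real_arch_pow_inv[OF \<open>r > 0\<close>, of "1 / 2"] by auto
    have "\<eta> \<in> U" if e: "\<eta> \<in> X" "agree k \<eta> \<omega>" for \<eta>
    proof -
      have "shift_dist \<omega> \<eta> < r"
        using e k shift_dist_less_iff_agree[of \<omega> \<eta> k] agree_sym by force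
      then show ?thesis using r e \<open>\<omega> \<in> X\<close> by auto
    qed
    then show "\<exists>k. \<forall>\<eta>\<in>X. agree k \<eta> \<omega> \<longrightarrow> \<eta> \<in> U" by blast
  next
    assume "\<exists>k. \<forall>\<eta>\<in>X. agree k \<eta> \<omega> \<longrightarrow> \<eta> \<in> U"
    then obtain k where "\<forall>\<eta>\<in>X. agree k \<eta> \<omega> \<longrightarrow> \<eta> \<in> U" by blast
    then have "mball \<omega> ((1 / 2) ^ k) \<subseteq> U"
      by (auto simp: shift_dist_commute[of \<omega>] shift_dist_less_iff_agree)
    then show "\<exists>r>0. mball \<omega> r \<subseteq> U" by (intro exI[of _ "(1 / 2) ^ k"]) simp
  qed
  then show ?thesis unfolding openin_mtopology by blast
qed

lemma continuous_graph_iff: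
  "continuous_graph X \<gamma> \<longleftrightarrow> (\<forall>\<omega>\<in>X. \<gamma> \<omega> \<in> unit_interval) \<and>
     (\<forall>\<omega>\<in>X. \<forall>e>0. \<exists>k. \<forall>\<eta>\<in>X. agree k \<eta> \<omega> \<longrightarrow> \<bar>\<gamma> \<eta> - \<gamma> \<omega>\<bar> < e)"
proof -
  interpret Metric_space X shift_dist by (rule Metric_space_shift_dist)
  have "continuous_map mtopology euclidean \<gamma> \<longleftrightarrow>
     (\<forall>\<omega>\<in>X. \<forall>e>0. \<exists>k. \<forall>\<eta>\<in>X. agree k \<eta> \<omega> \<longrightarrow> \<bar>\<gamma> \<eta> - \<gamma> \<omega>\<bar> < e)"
  proof
    assume c: "continuous_map mtopology euclidean \<gamma>"
    show "\<forall>\<omega>\<in>X. \<forall>e>0. \<exists>k. \<forall>\<eta>\<in>X. agree k \<eta> \<omega> \<longrightarrow> \<bar>\<gamma> \<eta> - \<gamma> \<omega>\<bar> < e"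
    proof (intro ballI allI impI)
      fix \<omega> and e :: real assume w: "\<omega> \<in> X" and e: "e > 0"
      have "openin mtopology {\<eta> \<in> topspace mtopology. \<gamma> \<eta> \<in> ball (\<gamma> \<omega>) e}"
        by (rule openin_continuous_map_preimage[OF c]) simp
      then obtain k where "\<forall>\<eta>\<in>X. agree k \<eta> \<omega> \<longrightarrow> \<gamma> \<eta> \<in> ball (\<gamma> \<omega>) e"
        unfolding openin_shift_iff using w e by auto
      then show "\<exists>k. \<forall>\<eta>\<in>X. agree k \<eta> \<omega> \<longrightarrow> \<bar>\<gamma> \<eta> - \<gamma> \<omega>\<bar> < e"
        by (auto simp: dist_real_def abs_minus_commute)
    qed
  next
    assume r: "\<forall>\<omega>\<in>X. \<forall>e>0. \<exists>k. \<forall>\<eta>\<in>X. agree k \<eta> \<omega> \<longrightarrow> \<bar>\<gamma> \<eta> - \<gamma> \<omega>\<bar> < e"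
    have "openin mtopology {\<eta> \<in> X. \<gamma> \<eta> \<in> U}" if "open U" for U
      unfolding openin_shift_iff
    proof (intro conjI ballI)
      fix \<omega> assume w: "\<omega> \<in> {\<eta> \<in> X. \<gamma> \<eta> \<in> U}"
      then obtain e where e: "e > 0" "\<And>y. dist y (\<gamma> \<omega>) < e \<Longrightarrow> y \<in> U"
        using \<open>open U\<close> unfolding open_dist by blast
      obtain k where "\<forall>\<eta>\<in>X. agree k \<eta> \<omega> \<longrightarrow> \<bar>\<gamma> \<eta> - \<gamma> \<omega>\<bar> < e" using r w e(1) by blast
      then show "\<exists>k. \<forall>\<eta>\<in>X. agree k \<eta> \<omega> \<longrightarrow> \<eta> \<in> {\<eta> \<in> X. \<gamma> \<eta> \<in> U}"
        using e(2) by (auto simp: dist_real_def)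
    qed auto
    then show "continuous_map mtopology euclidean \<gamma>"
      by (simp add: continuous_map_def)
  qed
  then show ?thesis by (auto simp: continuous_map_in_subtopology)
qed

lemma finite_cylinder_cover:
  assumes "compact_space (shift_topology X)"
  shows "\<exists>Y. finite Y \<and> Y \<subseteq> X \<and> (\<forall>\<eta>\<in>X. \<exists>\<omega>\<in>Y. agree (\<kappa> \<omega>) \<eta> \<omega>)"
proof -
  interpret Metric_space X shift_dist by (rule Metric_space_shift_dist)
  let ?C = "\<lambda>\<omega>. {\<eta> \<in> X. agree (\<kappa> \<omega>) \<eta> \<omega>}"
  have "\<exists>\<F>. finite \<F> \<and> \<F> \<subseteq> ?C ` X \<and> topspace mtopology \<subseteq> \<Union>\<F>"
    using assms unfolding compact_space_def
  proof (rule compactinD)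
    show "openin mtopology U" if "U \<in> ?C ` X" for U
      unfolding openin_shift_iff using that by (auto dest: agree_trans)
    show "topspace mtopology \<subseteq> \<Union>(?C ` X)" by fastforce
  qed
  then obtain \<F> where \<F>: "finite \<F>" "\<F> \<subseteq> ?C ` X" and cover: "X \<subseteq> \<Union>\<F>" by auto
  obtain Y where Y: "Y \<subseteq> X" "finite Y" "\<F> = ?C ` Y"
    using finite_subset_image[OF \<F>] by blast
  with cover have "\<forall>\<eta>\<in>X. \<exists>\<omega>\<in>Y. agree (\<kappa> \<omega>) \<eta> \<omega>" by auto
  with Y show ?thesis by blast
qed

text \<open>Local positive constants become one global constant: \<open>P\<close> survives a
  decrease of its second argument, so the minimum over a finite cylinder cover works.\<close>

lemma compact_uniform:
  assumes X: "compact_space (shift_topology X)"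
    and loc: "\<And>\<omega>. \<omega> \<in> X \<Longrightarrow> \<exists>k. \<exists>t>0. \<forall>\<eta>\<in>X. agree k \<eta> \<omega> \<longrightarrow> P \<eta> t"
    and mono: "\<And>\<eta> s t. P \<eta> t \<Longrightarrow> 0 < s \<Longrightarrow> s \<le> t \<Longrightarrow> P \<eta> s"
  shows "\<exists>t>0::real. \<forall>\<eta>\<in>X. P \<eta> t"
proof -
  obtain \<kappa> T where kT: "\<And>\<omega>. \<omega> \<in> X \<Longrightarrow> 0 < T \<omega> \<and> (\<forall>\<eta>\<in>X. agree (\<kappa> \<omega>) \<eta> \<omega> \<longrightarrow> P \<eta> (T \<omega>))"
    using loc by metis
  obtain Y where Y: "finite Y" "Y \<subseteq> X" "\<And>\<eta>. \<eta> \<in> X \<Longrightarrow> \<exists>\<omega>\<in>Y. agree (\<kappa> \<omega>) \<eta> \<omega>"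
    using finite_cylinder_cover[OF X, of \<kappa>] by blast
  \<comment> \<open>The inserted 1 gives the minimum a value when \<open>Y\<close> is empty.\<close>
  define t where "t = Min (insert 1 (T ` Y))"
  have t: "0 < t" "\<And>\<omega>. \<omega> \<in> Y \<Longrightarrow> t \<le> T \<omega>" using Y kT by (auto simp: t_def)
  have "P \<eta> t" if e: "\<eta> \<in> X" for \<eta>
  proof -
    obtain \<omega> where w: "\<omega> \<in> Y" "agree (\<kappa> \<omega>) \<eta> \<omega>" using Y(3)[OF e] by blast
    then have "P \<eta> (T \<omega>)" using kT Y(2) e by blast
    then show ?thesis using mono t w by blast
  qed
  with t show ?thesis by blast
qed


section \<open>Cocycles over a finite set of heights\<close>

locale topological_markov_chain =
  fixes N :: nat and A :: "nat \<Rightarrow> nat \<Rightarrow> bool" and X :: "(int \<Rightarrow> nat) set"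
  assumes X_def: "X = markov_chain_space N A"
begin

lemma sh_X [simp]: "\<omega> \<in> X \<Longrightarrow> sh n \<omega> \<in> X"
  unfolding X_def by (rule sh_markov_chain_space)

lemma splice_X:
  "\<omega> \<in> X \<Longrightarrow> \<eta> \<in> X \<Longrightarrow> \<omega> j = \<eta> j \<Longrightarrow> (\<lambda>i. if i \<le> j then \<omega> i else \<eta> i) \<in> X"
  unfolding X_def by (rule splice_markov_chain_space)

lemma compact_X: "compact_space (shift_topology X)"
  unfolding X_def by (rule compact_space_markov_chain)

definition dense_future :: "(int \<Rightarrow> nat) \<Rightarrow> bool" where
  "dense_future \<omega> \<longleftrightarrow> (\<forall>\<eta>\<in>X. \<forall>L. \<exists>n. agree L (sh (int n) \<omega>) \<eta>)"

definition dense_past :: "(int \<Rightarrow> nat) \<Rightarrow> bool" where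
  "dense_past \<omega> \<longleftrightarrow> (\<forall>\<eta>\<in>X. \<forall>L. \<exists>n. agree L (sh (- int n) \<omega>) \<eta>)"

end

section \<open>Iterated monotone maps on a finite chain\<close>

primrec cocycle :: "((int \<Rightarrow> nat) \<Rightarrow> real \<Rightarrow> real) \<Rightarrow> nat \<Rightarrow> (int \<Rightarrow> nat) \<Rightarrow> real \<Rightarrow> real" where
  "cocycle h 0 \<omega> y = y"
| "cocycle h (Suc n) \<omega> y = h (sh (int n) \<omega>) (cocycle h n \<omega> y)"

lemma cocycle_add: "cocycle h (m + n) \<omega> y = cocycle h n (sh (int m) \<omega>) (cocycle h m \<omega> y)"
  by (induction n) (simp_all add: add.commute)

text \<open>If \<open>a\<close> were moved, strict monotonicity would make its whole orbit strictly
  increasing or strictly decreasing, hence infinite, inside a finite set.\<close>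

lemma mono_inj_finite_fixes:
  fixes u :: "'a::linorder \<Rightarrow> 'a"
  assumes fin: "finite A" and uA: "u ` A \<subseteq> A"
    and mono: "\<And>x y. x \<in> A \<Longrightarrow> y \<in> A \<Longrightarrow> x \<le> y \<Longrightarrow> u x \<le> u y"
    and inj: "inj_on u A" and a: "a \<in> A"
  shows "u a = a"
proof (rule ccontr)
  assume ne: "u a \<noteq> a"
  have strict: "u x < u y" if "x \<in> A" "y \<in> A" "x < y" for x y
    using that mono[of x y] inj by (metis inj_onD le_less order.strict_implies_not_eq)
  have mem: "(u ^^ n) a \<in> A" for n using uA a by (induction n) auto
  have "inj (\<lambda>n. (u ^^ n) a)"
  proof (cases "a < u a")
    case True
    have "(u ^^ n) a < (u ^^ Suc n) a" for n
      using True strict mem mem[of "Suc _"] by (induction n) simp_all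
    then show ?thesis by (intro strict_mono_imp_inj_on strict_mono_Suc_iff[THEN iffD2] allI)
  next
    case False
    with ne have "u a < a" by simp
    then have dec: "(u ^^ Suc n) a < (u ^^ n) a" for n
      using strict mem mem[of "Suc _"] by (induction n) simp_all
    have "(u ^^ n) a < (u ^^ m) a" if "m < n" for m n
      using that by (induction rule: less_Suc_induct) (use dec in \<open>auto intro: less_trans\<close>)
    then show ?thesis by (auto intro!: injI) (metis linorder_neqE_nat less_irrefl)
  qed
  then have "infinite (range (\<lambda>n. (u ^^ n) a))" by (rule range_inj_infinite)
  moreover have "range (\<lambda>n. (u ^^ n) a) \<subseteq> A" using mem by auto
  ultimately show False using fin finite_subset by blast
qed

locale finite_cocycle = topological_markov_chain N A X
  for N A X +
  fixes k :: nat and G :: "real set" and h :: "(int \<Rightarrow> nat) \<Rightarrow> real \<Rightarrow> real"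
  assumes finite_G: "finite G"
    and h_in: "\<omega> \<in> X \<Longrightarrow> y \<in> G \<Longrightarrow> h \<omega> y \<in> G"
    and h_mono: "\<omega> \<in> X \<Longrightarrow> x \<in> G \<Longrightarrow> y \<in> G \<Longrightarrow> x \<le> y \<Longrightarrow> h \<omega> x \<le> h \<omega> y"
    and h_local: "\<omega> \<in> X \<Longrightarrow> \<eta> \<in> X \<Longrightarrow> agree k \<omega> \<eta> \<Longrightarrow> y \<in> G \<Longrightarrow> h \<omega> y = h \<eta> y"
begin

lemma cocycle_in: "\<omega> \<in> X \<Longrightarrow> y \<in> G \<Longrightarrow> cocycle h n \<omega> y \<in> G"
  by (induction n) (auto intro: h_in)

text \<open>Monotonicity survives composition, which later lets a whole loop act monotonically on
  the image of the past.\<close>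

lemma cocycle_mono:
  "\<omega> \<in> X \<Longrightarrow> x \<in> G \<Longrightarrow> y \<in> G \<Longrightarrow> x \<le> y \<Longrightarrow> cocycle h n \<omega> x \<le> cocycle h n \<omega> y"
  by (induction n) (auto intro!: h_mono cocycle_in)

text \<open>The maps applied sit at positions \<open>0\<close> to \<open>n - 1\<close> and each
  reads \<open>k\<close> symbols on either side, which gives the half-open range of indices.\<close>

lemma cocycle_local:
  assumes "\<omega> \<in> X" "\<eta> \<in> X" "y \<in> G" "\<And>i. - int k \<le> i \<Longrightarrow> i < int n + int k \<Longrightarrow> \<omega> i = \<eta> i"
  shows "cocycle h n \<omega> y = cocycle h n \<eta> y"
  using assms(4)
proof (induction n)
  case (Suc n)
  then have "cocycle h n \<omega> y = cocycle h n \<eta> y" by auto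
  moreover have "agree k (sh (int n) \<omega>) (sh (int n) \<eta>)"
    unfolding agree_def sh_def using Suc.prems by auto
  ultimately show ?case using assms(1-3) by (simp add: h_local cocycle_in)
qed simp

text \<open>Only the lower bound is recorded; that \<open>r\<close> is attained along a given
  segment is always a separate fact.\<close>

definition minimal_rank :: "nat \<Rightarrow> bool" where
  "minimal_rank r \<longleftrightarrow> (\<forall>\<omega>\<in>X. \<forall>n. r \<le> card (cocycle h n \<omega> ` G))"

text \<open>
  The image of \<^term>\<open>G\<close> along the past of \<^term>\<open>\<omega>0\<close> has minimal cardinality \<^term>\<open>r\<close>. Hence every
  itinerary that leaves from \<^term>\<open>\<omega>0\<close> and returns to it along this past permutes the image
  monotonically, that is, it fixes the image pointwise. The graph below is the lower boundary of the
  set of points reachable from the point at height \<^term>\<open>x0\<close> over \<^term>\<open>\<omega>0\<close>.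
\<close>

lemma drifting_graph:
  assumes w0: "\<omega>0 \<in> X" and x0: "x0 \<in> G" and a: "a \<in> cocycle h n (sh (- int n) \<omega>0) ` G"
    and forward_dense: "dense_future \<omega>0"
    and r: "minimal_rank r"
    and rn: "card (cocycle h n (sh (- int n) \<omega>0) ` G) = r"
    and M: "M \<le> n" "cocycle h M \<omega>0 a = cocycle h M \<omega>0 x0"
  shows "\<exists>\<gamma> L. (\<forall>\<omega>\<in>X. \<gamma> \<omega> \<in> G \<and> \<gamma> (sh 1 \<omega>) \<le> h \<omega> (\<gamma> \<omega>)) \<and>
    (\<forall>\<omega>\<in>X. \<forall>\<eta>\<in>X. agree L \<omega> \<eta> \<longrightarrow> \<gamma> \<omega> = \<gamma> \<eta>) \<and> \<gamma> \<omega>0 \<le> x0 \<and>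
    cocycle h n (sh (- int n) \<omega>0) (\<gamma> (sh (- int n) \<omega>0)) = a"
proof -
  \<comment> \<open>Wide enough for one application of \<open>h\<close> at either end of an
    itinerary, and for its first \<open>M\<close> steps to coincide with those along
    \<open>\<omega>0\<close>.\<close>
  define L where "L = k + M"
  \<comment> \<open>Start and end are prescribed only up to windows of size \<open>L\<close>. Hence
    \<open>T \<omega>\<close> depends on finitely many symbols of \<open>\<omega>\<close>, and so
    does its minimum.\<close>
  define T where "T \<omega> = {cocycle h j \<omega>' x0 | j \<omega>'. \<omega>' \<in> X \<and> agree L \<omega>' \<omega>0 \<and> agree L (sh (int j) \<omega>') \<omega>}"
    for \<omega>
  define \<gamma> where "\<gamma> \<omega> = Min (T \<omega>)" for \<omega>
  let ?v = "sh (- int n) \<omega>0"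
  let ?A = "cocycle h n ?v ` G"
  have TG: "T \<omega> \<subseteq> G" for \<omega> unfolding T_def using x0 cocycle_in by auto
  then have finT: "finite (T \<omega>)" for \<omega> using finite_G finite_subset by blast
  have neT: "T \<omega> \<noteq> {}" if "\<omega> \<in> X" for \<omega>
    using forward_dense that w0 unfolding T_def dense_future_def by fastforce
  have mem: "\<gamma> \<omega> \<in> T \<omega>" if "\<omega> \<in> X" for \<omega>
    unfolding \<gamma>_def using Min_in[OF finT neT[OF that]] .
  have aG: "a \<in> G" using a cocycle_in w0 by auto

  \<comment> \<open>The itinerary ends in a window of \<open>\<omega>\<close> and can be rerouted to
    follow \<open>\<omega>\<close> forever. The overlap of radius \<open>L\<close> around time
    \<open>j\<close> covers everything that the first \<open>j\<close> maps read, so the heights do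
    not change.\<close>
  have join: "\<exists>\<zeta>\<in>X. agree L \<zeta> \<omega>0 \<and> (\<forall>i\<ge>-int L. sh (int j) \<zeta> i = \<omega> i) \<and>
      (\<forall>y\<in>G. cocycle h j \<zeta> y = cocycle h j \<omega>' y)"
    if "\<omega>' \<in> X" "agree L \<omega>' \<omega>0" "agree L (sh (int j) \<omega>') \<omega>" "\<omega> \<in> X" for \<omega>' \<omega> j
  proof -
    define \<zeta> where "\<zeta> = (\<lambda>i. if i \<le> int j then \<omega>' i else sh (- int j) \<omega> i)"
    have e: "\<omega>' i = sh (- int j) \<omega> i" if "int j - int L \<le> i" "i \<le> int j + int L" for i
      using agreeD[OF \<open>agree L (sh (int j) \<omega>') \<omega>\<close>, of "i - int j"] that by (simp add: sh_def)
    have zX: "\<zeta> \<in> X" unfolding \<zeta>_def by (rule splice_X) (use that e[of "int j"] in auto)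
    have z1: "\<zeta> i = \<omega>' i" if "i \<le> int j + int L" for i using that e[of i] by (auto simp: \<zeta>_def)
    have z2: "\<zeta> i = sh (- int j) \<omega> i" if "int j - int L \<le> i" for i using that e[of i] by (auto simp: \<zeta>_def)
    have "agree L \<zeta> \<omega>0" using z1 that(2) by (auto simp: agree_def)
    moreover have "\<forall>i\<ge>-int L. sh (int j) \<zeta> i = \<omega> i"
    proof (intro allI impI)
      fix i assume "- int L \<le> i"
      then show "sh (int j) \<zeta> i = \<omega> i" using z2[of "i + int j"] by (simp add: sh_def)
    qed
    moreover have "\<forall>y\<in>G. cocycle h j \<zeta> y = cocycle h j \<omega>' y"
      using zX that(1) z1 by (intro ballI cocycle_local) (auto simp: L_def)
    ultimately show ?thesis using zX by blast
  qed

  have drift: "\<gamma> (sh 1 \<omega>) \<le> h \<omega> (\<gamma> \<omega>)" if w: "\<omega> \<in> X" for \<omega>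
  proof -
    obtain j \<omega>' where j: "\<gamma> \<omega> = cocycle h j \<omega>' x0" "\<omega>' \<in> X" "agree L \<omega>' \<omega>0" "agree L (sh (int j) \<omega>') \<omega>"
      using mem[OF w] unfolding T_def by blast
    obtain \<zeta> where z: "\<zeta> \<in> X" "agree L \<zeta> \<omega>0" "\<And>i. -int L \<le> i \<Longrightarrow> sh (int j) \<zeta> i = \<omega> i"
      "\<And>y. y \<in> G \<Longrightarrow> cocycle h j \<zeta> y = cocycle h j \<omega>' y"
      using join[OF j(2-4) w] by blast
    \<comment> \<open>After rerouting, one more step ends near the successor of
      \<open>\<omega>\<close>, and \<open>h\<close> acts there as it does over
      \<open>\<omega>\<close>; the successor height is therefore reachable.\<close>
    have "agree L (sh (int (Suc j)) \<zeta>) (sh 1 \<omega>)"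
      unfolding agree_def
    proof (intro allI impI)
      fix i assume "\<bar>i\<bar> \<le> int L"
      then show "sh (int (Suc j)) \<zeta> i = sh 1 \<omega> i"
        using z(3)[of "i + 1"] by (simp add: sh_def add_ac)
    qed
    with z have "cocycle h (Suc j) \<zeta> x0 \<in> T (sh 1 \<omega>)" unfolding T_def by blast
    moreover have "h (sh (int j) \<zeta>) y = h \<omega> y" if "y \<in> G" for y
      using z w that by (intro h_local) (auto simp: agree_def L_def)
    ultimately have "h \<omega> (\<gamma> \<omega>) \<in> T (sh 1 \<omega>)" using x0 j z(4) by (simp add: cocycle_in)
    then show ?thesis unfolding \<gamma>_def[of "sh 1 \<omega>"] using finT by auto
  qed

  have return: "cocycle h n ?v (\<gamma> ?v) = a"
  proof -
    obtain j \<omega>' where j: "\<gamma> ?v = cocycle h j \<omega>' x0" "\<omega>' \<in> X" "agree L \<omega>' \<omega>0" "agree L (sh (int j) \<omega>') ?v"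
      using mem[OF sh_X[OF w0, of "- int n"]] unfolding T_def by blast
    obtain \<zeta> where z: "\<zeta> \<in> X" "agree L \<zeta> \<omega>0" "\<And>i. -int L \<le> i \<Longrightarrow> sh (int j) \<zeta> i = ?v i"
      "\<And>y. y \<in> G \<Longrightarrow> cocycle h j \<zeta> y = cocycle h j \<omega>' y"
      using join[OF j(2-4)] w0 by (metis sh_X)
    let ?u = "cocycle h (j + n) \<zeta>"
    \<comment> \<open>From time \<open>j\<close> on the loop retraces the past of
      \<open>\<omega>0\<close>, so its image lies in \<open>?A\<close>.\<close>
    have u: "?u y = cocycle h n ?v (cocycle h j \<zeta> y)" if "y \<in> G" for y
      unfolding cocycle_add
      by (rule cocycle_local) (use z(1,3) w0 that in \<open>auto intro: cocycle_in simp: L_def\<close>)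
    then have uA: "?u ` G \<subseteq> ?A" using z(1) cocycle_in by (auto simp: image_iff)
    define \<xi> where "\<xi> = (\<lambda>i. if i \<le> 0 then \<omega>0 i else \<zeta> i)"
    have xiX: "\<xi> \<in> X" unfolding \<xi>_def by (rule splice_X) (use w0 z(1) agreeD[OF z(2), of 0] in auto)
    have xi1: "\<xi> i = \<zeta> i" if "- int L \<le> i" for i
      using that agreeD[OF z(2), of i] by (auto simp: \<xi>_def)
    have xi2: "\<xi> i = \<omega>0 i" if "i \<le> int L" for i
      using that agreeD[OF z(2), of i] by (auto simp: \<xi>_def)
    have x1: "cocycle h n (sh (- int n) \<xi>) y = cocycle h n ?v y" if "y \<in> G" for y
    proof (rule cocycle_local)
      show "sh (- int n) \<xi> i = ?v i" if "i < int n + int k" for i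
        using xi2[of "i - int n"] that by (simp add: sh_def L_def)
    qed (use xiX w0 that in auto)
    have x2: "cocycle h (j + n) \<xi> y = ?u y" if "y \<in> G" for y
      by (rule cocycle_local) (use xiX z(1) that in \<open>auto simp: L_def intro!: xi1\<close>)
    have "cocycle h (n + (j + n)) (sh (- int n) \<xi>) y = ?u (cocycle h n ?v y)" if "y \<in> G" for y
      unfolding cocycle_add[of h n] using x1 x2 that w0 by (simp add: cocycle_in)
    then have "cocycle h (n + (j + n)) (sh (- int n) \<xi>) ` G = ?u ` ?A"
      by (auto simp: image_iff)
    \<comment> \<open>Minimality forbids the loop to identify two points of
      \<open>?A\<close>.\<close>
    then have "card ?A \<le> card (?u ` ?A)" using r rn sh_X[OF xiX, of "- int n"] unfolding minimal_rank_def by metis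
    then have "inj_on ?u ?A" using finite_G by (intro eq_card_imp_inj_on) (auto intro: antisym card_image_le)
    moreover have AG: "?A \<subseteq> G" using w0 cocycle_in by auto
    ultimately have ua: "?u a = a"
    proof (intro mono_inj_finite_fixes[of ?A])
      show "?u ` ?A \<subseteq> ?A" using image_mono[OF AG, of ?u] uA by (rule subset_trans)
      show "?u x \<le> ?u y" if "x \<in> ?A" "y \<in> ?A" "x \<le> y" for x y
        using subsetD[OF AG that(1)] subsetD[OF AG that(2)] that(3) by (rule cocycle_mono[OF z(1)])
    qed (use a finite_G in auto)
    \<comment> \<open>The loop begins with \<open>M\<close> steps along \<open>\<omega>0\<close>,
      after which \<open>a\<close> and \<open>x0\<close> have merged.\<close>
    have *: "?u y = cocycle h (j + n - M) (sh (int M) \<zeta>) (cocycle h M \<omega>0 y)" if "y \<in> G" for y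
    proof -
      have "cocycle h M \<zeta> y = cocycle h M \<omega>0 y"
        by (rule cocycle_local) (use z(1) w0 that agreeD[OF z(2)] in \<open>auto simp: L_def\<close>)
      then show ?thesis using cocycle_add[of h M "j + n - M" \<zeta> y] M(1) by simp
    qed
    have "cocycle h n ?v (\<gamma> ?v) = ?u x0" using u[OF x0] j(1) z(4)[OF x0] by simp
    also have "\<dots> = ?u a" using *[OF x0] *[OF aG] M(2) by simp
    finally show ?thesis using ua by simp
  qed

  have "x0 \<in> T \<omega>0" unfolding T_def using w0 by (auto intro!: exI[of _ "0::nat"] exI[of _ \<omega>0])
  then have "\<gamma> \<omega>0 \<le> x0" unfolding \<gamma>_def using finT by simp
  moreover have "\<gamma> \<omega> = \<gamma> \<eta>" if "agree L \<omega> \<eta>" for \<omega> \<eta>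
  proof -
    have "agree L \<zeta> \<omega> \<longleftrightarrow> agree L \<zeta> \<eta>" for \<zeta> using that agree_trans agree_sym by blast
    then show ?thesis unfolding \<gamma>_def T_def by simp
  qed
  moreover have "\<gamma> \<omega> \<in> G" if "\<omega> \<in> X" for \<omega> using mem[OF that] TG by blast
  ultimately show ?thesis using drift return by (intro exI[of _ \<gamma>] exI[of _ L]) blast
qed

text \<open>A block of minimal rank occurs both in the past and in the future of
  \<open>\<omega>0\<close>. Once the past has reduced the rank to \<open>r\<close>, the future
  cannot reduce it further, so every point of its image, in particular that of \<open>x0\<close>, is
  already attained from the image of the past.\<close>

lemma minimal_rank_along_orbit:
  assumes w0: "\<omega>0 \<in> X" and x0: "x0 \<in> G"
    and forward_dense: "dense_future \<omega>0"
    and backward_dense: "dense_past \<omega>0"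
  obtains r n M a where "minimal_rank r"
    "card (cocycle h n (sh (- int n) \<omega>0) ` G) = r" "1 \<le> n" "M \<le> n"
    "a \<in> cocycle h n (sh (- int n) \<omega>0) ` G" "cocycle h M \<omega>0 a = cocycle h M \<omega>0 x0"
proof -
  define R where "R = {card (cocycle h n \<omega> ` G) | n \<omega>. \<omega> \<in> X}"
  define r where "r = (LEAST r. r \<in> R)"
  have "card (cocycle h 0 \<omega>0 ` G) \<in> R" unfolding R_def using w0 by blast
  then have "r \<in> R" unfolding r_def by (rule LeastI)
  then obtain m \<omega>1 where w1: "\<omega>1 \<in> X" "card (cocycle h m \<omega>1 ` G) = r" unfolding R_def by blast
  have r: "r \<le> card (cocycle h n \<omega> ` G)" if "\<omega> \<in> X" for \<omega> n
    unfolding r_def by (rule Least_le) (use that in \<open>auto simp: R_def\<close>)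
  \<comment> \<open>Passing through the minimal block leaves at most \<open>r\<close> heights,
    whatever comes before or after it.\<close>
  have small_rank: "card (cocycle h (p + (m + q)) \<omega> ` G) = r" if w: "\<omega> \<in> X" and
    ag: "agree (k + m) (sh (int p) \<omega>) \<omega>1" for p q \<omega>
  proof -
    have "cocycle h (m + q) (sh (int p) \<omega>) y = cocycle h q (sh (int (p + m)) \<omega>) (cocycle h m \<omega>1 y)"
      if "y \<in> G" for y
    proof -
      have "cocycle h m (sh (int p) \<omega>) y = cocycle h m \<omega>1 y"
        by (rule cocycle_local) (use w w1(1) that agreeD[OF ag] in auto)
      then show ?thesis by (simp add: cocycle_add add.commute)
    qed
    then have "cocycle h (p + (m + q)) \<omega> ` G \<subseteq> cocycle h q (sh (int (p + m)) \<omega>) ` (cocycle h m \<omega>1 ` G)"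
      unfolding cocycle_add[of h p] using w cocycle_in by auto
    then have "card (cocycle h (p + (m + q)) \<omega> ` G) \<le> card (cocycle h q (sh (int (p + m)) \<omega>) ` (cocycle h m \<omega>1 ` G))"
      using finite_G by (intro card_mono) auto
    also have "\<dots> \<le> r" using w1(2) finite_G by (metis card_image_le finite_imageI)
    finally show ?thesis using r[OF w] by (intro antisym) auto
  qed
  obtain p where p: "agree (k + m) (sh (int p) \<omega>0) \<omega>1" using forward_dense w1(1) unfolding dense_future_def by blast
  define M where "M = p + m"
  have rM: "card (cocycle h M \<omega>0 ` G) = r" using small_rank[OF w0 p, of 0] by (simp add: M_def)
  \<comment> \<open>Recurrence to \<open>\<omega>1\<close> itself would not bound the return time
    from below. Aiming \<open>m + M + 1\<close> places further right puts the block that far further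
    back and forces \<open>M \<le> n\<close> and \<open>1 \<le> n\<close>; the window is enlarged by
    the same amount so that it still contains the block.\<close>
  obtain q where q: "agree (k + 2 * m + M + 1) (sh (- int q) \<omega>0) (sh (int (m + M + 1)) \<omega>1)"
    using backward_dense sh_X[OF w1(1)] unfolding dense_past_def by blast
  define n where "n = m + (M + 1 + q)"
  have "agree (k + m) (sh (- int n) \<omega>0) \<omega>1"
    unfolding agree_def
  proof (intro allI impI)
    fix i assume "\<bar>i\<bar> \<le> int (k + m)"
    then show "sh (- int n) \<omega>0 i = \<omega>1 i"
      using agreeD[OF q, of "i - int (m + M + 1)"] by (simp add: sh_def n_def algebra_simps)
  qed
  then have rn: "card (cocycle h n (sh (- int n) \<omega>0) ` G) = r"
    using small_rank[of "sh (- int n) \<omega>0" 0 "M + 1 + q"] w0 by (simp add: n_def)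
  have comp: "cocycle h (n + M) (sh (- int n) \<omega>0) y = cocycle h M \<omega>0 (cocycle h n (sh (- int n) \<omega>0) y)" for y
    by (simp add: cocycle_add)
  \<comment> \<open>The composition has at least \<open>r\<close> values and the target exactly
    \<open>r\<close>, so the inclusion of images is an equality.\<close>
  have "cocycle h M \<omega>0 ` (cocycle h n (sh (- int n) \<omega>0) ` G) = cocycle h M \<omega>0 ` G"
  proof (rule card_subset_eq)
    show "finite (cocycle h M \<omega>0 ` G)" using finite_G by simp
    show sub: "cocycle h M \<omega>0 ` (cocycle h n (sh (- int n) \<omega>0) ` G) \<subseteq> cocycle h M \<omega>0 ` G"
      using w0 cocycle_in by auto
    have "r \<le> card (cocycle h (n + M) (sh (- int n) \<omega>0) ` G)" using r w0 by simp
    then have "r \<le> card (cocycle h M \<omega>0 ` (cocycle h n (sh (- int n) \<omega>0) ` G))"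
      by (simp add: comp image_image)
    then show "card (cocycle h M \<omega>0 ` (cocycle h n (sh (- int n) \<omega>0) ` G)) = card (cocycle h M \<omega>0 ` G)"
      using card_mono[OF _ sub] finite_G rM by simp
  qed
  then have "cocycle h M \<omega>0 x0 \<in> cocycle h M \<omega>0 ` (cocycle h n (sh (- int n) \<omega>0) ` G)"
    using x0 by simp
  then obtain a where "a \<in> cocycle h n (sh (- int n) \<omega>0) ` G" "cocycle h M \<omega>0 a = cocycle h M \<omega>0 x0"
    by (metis (no_types, lifting) imageE)
  then show thesis using r rn by (intro that[of r n M a]) (auto simp: n_def minimal_rank_def)
qed

end


section \<open>The drift dichotomy\<close>

text \<open>Of the smooth structure only order, uniform continuity in the base and one Lipschitz
  constant are kept. This class is closed under the flip of the interval, so it treats both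
  directions of drift at once.\<close>

definition interval_cocycle :: "(int \<Rightarrow> nat) set \<Rightarrow> ((int \<Rightarrow> nat) \<Rightarrow> real \<Rightarrow> real) \<Rightarrow> bool" where
  "interval_cocycle X f \<longleftrightarrow>
     (\<forall>\<omega>\<in>X. \<forall>x\<in>unit_interval. f \<omega> x \<in> unit_interval) \<and>
     (\<forall>\<omega>\<in>X. \<forall>x\<in>unit_interval. \<forall>y\<in>unit_interval. x < y \<longrightarrow> f \<omega> x < f \<omega> y) \<and>
     (\<forall>\<omega>\<in>X. \<forall>e>0. \<exists>k. \<forall>\<eta>\<in>X. agree k \<eta> \<omega> \<longrightarrow> (\<forall>x\<in>unit_interval. \<bar>f \<eta> x - f \<omega> x\<bar> < e)) \<and>
     (\<exists>B>0. \<forall>\<omega>\<in>X. \<forall>x\<in>unit_interval. \<forall>y\<in>unit_interval. \<bar>f \<omega> x - f \<omega> y\<bar> \<le> B * \<bar>x - y\<bar>)"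

definition image_graph ::
  "((int \<Rightarrow> nat) \<Rightarrow> real \<Rightarrow> real) \<Rightarrow> ((int \<Rightarrow> nat) \<Rightarrow> real) \<Rightarrow> (int \<Rightarrow> nat) \<Rightarrow> real" where
  "image_graph f \<gamma> \<omega> = f (sh (-1) \<omega>) (\<gamma> (sh (-1) \<omega>))"

definition drifts_up ::
  "(int \<Rightarrow> nat) set \<Rightarrow> ((int \<Rightarrow> nat) \<Rightarrow> real \<Rightarrow> real) \<Rightarrow> (int \<Rightarrow> nat) \<Rightarrow> real \<Rightarrow> bool" where
  "drifts_up X f \<omega> x \<longleftrightarrow> (\<exists>\<gamma>. continuous_graph X \<gamma> \<and> (\<forall>\<eta>\<in>X. \<gamma> \<eta> < image_graph f \<gamma> \<eta>) \<and>
     \<gamma> \<omega> < x \<and> x < image_graph f \<gamma> \<omega>)"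

text \<open>Conjugation by the flip, which exchanges the two directions of drift.\<close>

definition reflect :: "((int \<Rightarrow> nat) \<Rightarrow> real \<Rightarrow> real) \<Rightarrow> (int \<Rightarrow> nat) \<Rightarrow> real \<Rightarrow> real" where
  "reflect f \<omega> x = 1 - f \<omega> (1 - x)"

lemma interval_cocycle_in:
  "interval_cocycle X f \<Longrightarrow> \<omega> \<in> X \<Longrightarrow> x \<in> unit_interval \<Longrightarrow> f \<omega> x \<in> unit_interval"
  unfolding interval_cocycle_def by blast

lemma interval_cocycle_less:
  "interval_cocycle X f \<Longrightarrow> \<omega> \<in> X \<Longrightarrow> x \<in> unit_interval \<Longrightarrow> y \<in> unit_interval \<Longrightarrow> x < y \<Longrightarrow> f \<omega> x < f \<omega> y"
  unfolding interval_cocycle_def by blast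

lemma interval_cocycle_le:
  "interval_cocycle X f \<Longrightarrow> \<omega> \<in> X \<Longrightarrow> x \<in> unit_interval \<Longrightarrow> y \<in> unit_interval \<Longrightarrow> x \<le> y \<Longrightarrow> f \<omega> x \<le> f \<omega> y"
  using interval_cocycle_less[of X f \<omega> x y] by (cases "x = y") auto

lemma interval_cocycle_cont:
  "interval_cocycle X f \<Longrightarrow> \<omega> \<in> X \<Longrightarrow> e > 0 \<Longrightarrow>
     \<exists>k. \<forall>\<eta>\<in>X. agree k \<eta> \<omega> \<longrightarrow> (\<forall>x\<in>unit_interval. \<bar>f \<eta> x - f \<omega> x\<bar> < e)"
  unfolding interval_cocycle_def by blast

lemma interval_cocycle_lipschitz:
  assumes "interval_cocycle X f"
  obtains B where "B > 0"
    "\<And>\<omega> x y. \<omega> \<in> X \<Longrightarrow> x \<in> unit_interval \<Longrightarrow> y \<in> unit_interval \<Longrightarrow> \<bar>f \<omega> x - f \<omega> y\<bar> \<le> B * \<bar>x - y\<bar>"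
  using assms unfolding interval_cocycle_def by blast

lemma interval_cocycle_reflect:
  assumes "interval_cocycle X f" shows "interval_cocycle X (reflect f)"
proof -
  have r: "1 - x \<in> unit_interval \<longleftrightarrow> x \<in> unit_interval" for x :: real by auto
  show ?thesis
    unfolding interval_cocycle_def[of X "reflect f"]
  proof (intro conjI ballI allI impI)
    fix \<omega> x assume w: "\<omega> \<in> X" and x: "x \<in> unit_interval"
    show "reflect f \<omega> x \<in> unit_interval"
      using interval_cocycle_in[OF assms w] x unfolding reflect_def r by simp
    fix y assume y: "y \<in> unit_interval" "x < y"
    then show "reflect f \<omega> x < reflect f \<omega> y"
      using interval_cocycle_less[OF assms w, of "1 - y" "1 - x"] x unfolding reflect_def r by simp
  next
    fix \<omega> and e :: real assume w: "\<omega> \<in> X" and e: "e > 0"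
    obtain k where "\<And>\<eta> x. \<eta> \<in> X \<Longrightarrow> agree k \<eta> \<omega> \<Longrightarrow> x \<in> unit_interval \<Longrightarrow> \<bar>f \<eta> x - f \<omega> x\<bar> < e"
      using interval_cocycle_cont[OF assms w e] by blast
    then have "\<bar>reflect f \<eta> x - reflect f \<omega> x\<bar> < e"
      if "\<eta> \<in> X" "agree k \<eta> \<omega>" "x \<in> unit_interval" for \<eta> x
      using that r[of x] by (simp add: reflect_def abs_minus_commute)
    then show "\<exists>k. \<forall>\<eta>\<in>X. agree k \<eta> \<omega> \<longrightarrow> (\<forall>x\<in>unit_interval. \<bar>reflect f \<eta> x - reflect f \<omega> x\<bar> < e)"
      by blast
  next
    obtain B where B: "B > 0"
      "\<And>\<omega> x y. \<omega> \<in> X \<Longrightarrow> x \<in> unit_interval \<Longrightarrow> y \<in> unit_interval \<Longrightarrow> \<bar>f \<omega> x - f \<omega> y\<bar> \<le> B * \<bar>x - y\<bar>"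
      using interval_cocycle_lipschitz[OF assms] by blast
    have "\<bar>reflect f \<omega> x - reflect f \<omega> y\<bar> \<le> B * \<bar>x - y\<bar>"
      if "\<omega> \<in> X" "x \<in> unit_interval" "y \<in> unit_interval" for \<omega> x y
      using B(2)[OF that(1), of "1 - x" "1 - y"] that(2,3) unfolding r
      by (simp add: reflect_def abs_minus_commute)
    then show "\<exists>B>0. \<forall>\<omega>\<in>X. \<forall>x\<in>unit_interval. \<forall>y\<in>unit_interval. \<bar>reflect f \<omega> x - reflect f \<omega> y\<bar> \<le> B * \<bar>x - y\<bar>"
      using B(1) by blast
  qed
qed

lemma graph_image_eq: "graph_image F = image_graph (fiber F)"
  by (simp add: fun_eq_iff graph_image_def image_graph_def right_shift_eq)

lemma Up_eq: "Up X F = {(\<omega>, x) \<in> X \<times> unit_interval. drifts_up X (fiber F) \<omega> x}"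
  unfolding Up_def drifts_up_def graph_less_def graph_image_eq by simp

lemma image_graph_reflect:
  "image_graph (reflect f) (\<lambda>\<omega>. 1 - \<gamma> \<omega>) \<omega> = 1 - image_graph f \<gamma> \<omega>"
  by (simp add: image_graph_def reflect_def)

lemma continuous_graph_reflect: "continuous_graph X (\<lambda>\<omega>. 1 - \<gamma> \<omega>) \<longleftrightarrow> continuous_graph X \<gamma>"
  unfolding continuous_graph_iff by (auto simp: abs_minus_commute)

lemma Down_eq: "Down X F = {(\<omega>, x) \<in> X \<times> unit_interval. drifts_up X (reflect (fiber F)) \<omega> (1 - x)}"
proof -
  have "(\<exists>\<gamma>. continuous_graph X \<gamma> \<and> (\<forall>\<eta>\<in>X. image_graph (fiber F) \<gamma> \<eta> < \<gamma> \<eta>) \<and>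
      image_graph (fiber F) \<gamma> \<omega> < x \<and> x < \<gamma> \<omega>) \<longleftrightarrow> drifts_up X (reflect (fiber F)) \<omega> (1 - x)" for \<omega> x
  proof
    assume "\<exists>\<gamma>. continuous_graph X \<gamma> \<and> (\<forall>\<eta>\<in>X. image_graph (fiber F) \<gamma> \<eta> < \<gamma> \<eta>) \<and>
      image_graph (fiber F) \<gamma> \<omega> < x \<and> x < \<gamma> \<omega>"
    then obtain \<gamma> where "continuous_graph X \<gamma>" "\<forall>\<eta>\<in>X. image_graph (fiber F) \<gamma> \<eta> < \<gamma> \<eta>"
      "image_graph (fiber F) \<gamma> \<omega> < x" "x < \<gamma> \<omega>" by blast
    then show "drifts_up X (reflect (fiber F)) \<omega> (1 - x)" unfolding drifts_up_def
      by (intro exI[of _ "\<lambda>\<omega>. 1 - \<gamma> \<omega>"]) (simp add: image_graph_reflect continuous_graph_reflect)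
  next
    assume "drifts_up X (reflect (fiber F)) \<omega> (1 - x)"
    then obtain \<gamma> where g: "continuous_graph X \<gamma>" "\<forall>\<eta>\<in>X. \<gamma> \<eta> < image_graph (reflect (fiber F)) \<gamma> \<eta>"
      "\<gamma> \<omega> < 1 - x" "1 - x < image_graph (reflect (fiber F)) \<gamma> \<omega>" unfolding drifts_up_def by blast
    have "image_graph (reflect (fiber F)) \<gamma> \<eta> = 1 - image_graph (fiber F) (\<lambda>\<omega>. 1 - \<gamma> \<omega>) \<eta>" for \<eta>
      by (simp add: image_graph_def reflect_def)
    with g show "\<exists>\<gamma>. continuous_graph X \<gamma> \<and> (\<forall>\<eta>\<in>X. image_graph (fiber F) \<gamma> \<eta> < \<gamma> \<eta>) \<and>
      image_graph (fiber F) \<gamma> \<omega> < x \<and> x < \<gamma> \<omega>"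
      by (intro exI[of _ "\<lambda>\<omega>. 1 - \<gamma> \<omega>"]) (force simp: continuous_graph_reflect)
  qed
  then show ?thesis unfolding Down_def graph_less_def graph_image_eq by simp
qed

context topological_markov_chain
begin

lemma continuous_image_graph:
  assumes f: "interval_cocycle X f" and g: "continuous_graph X \<gamma>"
  shows "continuous_graph X (image_graph f \<gamma>)"
  unfolding continuous_graph_iff[of X "image_graph f \<gamma>"]
proof (intro conjI ballI allI impI)
  have gI: "\<gamma> \<omega> \<in> unit_interval" if "\<omega> \<in> X" for \<omega>
    using g that unfolding continuous_graph_iff by blast
  show "image_graph f \<gamma> \<omega> \<in> unit_interval" if "\<omega> \<in> X" for \<omega>
    using that unfolding image_graph_def by (intro interval_cocycle_in[OF f] gI) simp_all
  fix \<omega> and e :: real assume w: "\<omega> \<in> X" and e: "e > 0"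
  obtain B where B: "B > 0"
    "\<And>\<omega> x y. \<omega> \<in> X \<Longrightarrow> x \<in> unit_interval \<Longrightarrow> y \<in> unit_interval \<Longrightarrow> \<bar>f \<omega> x - f \<omega> y\<bar> \<le> B * \<bar>x - y\<bar>"
    using interval_cocycle_lipschitz[OF f] by blast
  let ?v = "sh (-1) \<omega>"
  have v: "?v \<in> X" using w by simp
  obtain k1 where k1: "\<And>\<eta> x. \<eta> \<in> X \<Longrightarrow> agree k1 \<eta> ?v \<Longrightarrow> x \<in> unit_interval \<Longrightarrow> \<bar>f \<eta> x - f ?v x\<bar> < e / 2"
    using interval_cocycle_cont[OF f v half_gt_zero[OF e]] by blast
  obtain k2 where k2: "\<And>\<eta>. \<eta> \<in> X \<Longrightarrow> agree k2 \<eta> ?v \<Longrightarrow> \<bar>\<gamma> \<eta> - \<gamma> ?v\<bar> < e / (2 * B)"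
    using g v e B(1) unfolding continuous_graph_iff by (metis divide_pos_pos mult_pos_pos zero_less_numeral)
  show "\<exists>k. \<forall>\<eta>\<in>X. agree k \<eta> \<omega> \<longrightarrow> \<bar>image_graph f \<gamma> \<eta> - image_graph f \<gamma> \<omega>\<bar> < e"
  proof (intro exI[of _ "max k1 k2 + 1"] ballI impI)
    fix \<eta> assume n: "\<eta> \<in> X" "agree (max k1 k2 + 1) \<eta> \<omega>"
    let ?u = "sh (-1) \<eta>"
    have "agree (max k1 k2) ?u ?v" using n(2) agree_sh[of "max k1 k2" "-1" \<eta> \<omega>] by simp
    then have a: "agree k1 ?u ?v" "agree k2 ?u ?v" by (auto elim: agree_mono)
    have u: "?u \<in> X" using n by simp
    have "\<bar>f ?u (\<gamma> ?u) - f ?u (\<gamma> ?v)\<bar> \<le> B * \<bar>\<gamma> ?u - \<gamma> ?v\<bar>"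
      using B(2)[OF u] gI[OF u] gI[OF v] by simp
    also have "\<dots> < B * (e / (2 * B))" using k2[OF u a(2)] B(1) by (intro mult_strict_left_mono)
    also have "\<dots> = e / 2" using B(1) by simp
    finally show "\<bar>image_graph f \<gamma> \<eta> - image_graph f \<gamma> \<omega>\<bar> < e"
      using k1[OF u a(1) gI[OF v]] unfolding image_graph_def by linarith
  qed
qed

text \<open>Only the upper boundary point is new. The midpoint of the graph and its image is again a
  drifting graph, since by monotonicity its image lies above the image of the original one, and its
  strip contains that boundary point.\<close>

lemma drifts_up_image_graph:
  assumes f: "interval_cocycle X f" and g: "continuous_graph X \<gamma>"
    and drift: "\<And>\<eta>. \<eta> \<in> X \<Longrightarrow> \<gamma> \<eta> < image_graph f \<gamma> \<eta>"
    and x: "\<gamma> \<omega> < x" "x \<le> image_graph f \<gamma> \<omega>" and w: "\<omega> \<in> X"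
  shows "drifts_up X f \<omega> x"
proof (cases "x = image_graph f \<gamma> \<omega>")
  case False
  with x g drift show ?thesis unfolding drifts_up_def by (intro exI[of _ \<gamma>]) auto
next
  case True
  let ?m = "\<lambda>\<eta>. (\<gamma> \<eta> + image_graph f \<gamma> \<eta>) / 2"
  have g': "continuous_graph X (image_graph f \<gamma>)" by (rule continuous_image_graph[OF f g])
  have gI: "\<gamma> \<eta> \<in> unit_interval" "image_graph f \<gamma> \<eta> \<in> unit_interval" if "\<eta> \<in> X" for \<eta>
    using g g' that unfolding continuous_graph_iff by blast+
  have mI: "?m \<eta> \<in> unit_interval" if "\<eta> \<in> X" for \<eta> using gI[OF that] by auto
  have "continuous_graph X ?m" unfolding continuous_graph_iff[of X ?m]
  proof (intro conjI ballI allI impI)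
    fix \<eta> and e :: real assume n: "\<eta> \<in> X" and e: "e > 0"
    obtain k1 where k1: "\<forall>\<zeta>\<in>X. agree k1 \<zeta> \<eta> \<longrightarrow> \<bar>\<gamma> \<zeta> - \<gamma> \<eta>\<bar> < e"
      using g n e unfolding continuous_graph_iff by blast
    obtain k2 where k2: "\<forall>\<zeta>\<in>X. agree k2 \<zeta> \<eta> \<longrightarrow> \<bar>image_graph f \<gamma> \<zeta> - image_graph f \<gamma> \<eta>\<bar> < e"
      using g' n e unfolding continuous_graph_iff by blast
    show "\<exists>k. \<forall>\<zeta>\<in>X. agree k \<zeta> \<eta> \<longrightarrow> \<bar>?m \<zeta> - ?m \<eta>\<bar> < e"
    proof (intro exI[of _ "max k1 k2"] ballI impI)
      fix \<zeta> assume z: "\<zeta> \<in> X" "agree (max k1 k2) \<zeta> \<eta>"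
      then have "agree k1 \<zeta> \<eta>" "agree k2 \<zeta> \<eta>" by (auto elim: agree_mono)
      then have "\<bar>\<gamma> \<zeta> - \<gamma> \<eta>\<bar> < e" "\<bar>image_graph f \<gamma> \<zeta> - image_graph f \<gamma> \<eta>\<bar> < e"
        using k1 k2 z by blast+
      then show "\<bar>?m \<zeta> - ?m \<eta>\<bar> < e" by (simp add: abs_if field_simps split: if_splits)
    qed
  qed (use mI in auto)
  moreover have less: "image_graph f \<gamma> \<eta> < image_graph f ?m \<eta>" if "\<eta> \<in> X" for \<eta>
  proof -
    have "sh (-1) \<eta> \<in> X" using that by simp
    with drift[OF this] show ?thesis unfolding image_graph_def[of f _ \<eta>]
      by (intro interval_cocycle_less[OF f _ gI(1) mI]) simp_all
  qed
  moreover have "?m \<eta> < image_graph f ?m \<eta>" if "\<eta> \<in> X" for \<eta>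
    using less[OF that] drift[OF that] by simp
  moreover have "?m \<omega> < x" "x < image_graph f ?m \<omega>"
    using drift[OF w] less[OF w] True by simp_all
  ultimately show ?thesis unfolding drifts_up_def by blast
qed

text \<open>Images of a drifting graph drift again by monotonicity, so the strips between
  consecutive images are stacked without gaps, shared boundaries included.\<close>

lemma drifts_up_iterate:
  assumes f: "interval_cocycle X f" and w: "\<omega> \<in> X"
  shows "continuous_graph X \<gamma> \<Longrightarrow> (\<And>\<eta>. \<eta> \<in> X \<Longrightarrow> \<gamma> \<eta> < image_graph f \<gamma> \<eta>) \<Longrightarrow>
    \<gamma> \<omega> < x \<Longrightarrow> x \<le> (image_graph f ^^ n) \<gamma> \<omega> \<Longrightarrow> drifts_up X f \<omega> x"
proof (induction n arbitrary: \<gamma>)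
  case (Suc n)
  show ?case
  proof (cases "x \<le> image_graph f \<gamma> \<omega>")
    case True
    then show ?thesis using drifts_up_image_graph[OF f Suc.prems(1,2,3) _ w] by blast
  next
    case False
    have c: "continuous_graph X (image_graph f \<gamma>)" by (rule continuous_image_graph[OF f Suc.prems(1)])
    have gI: "\<gamma> \<eta> \<in> unit_interval" "image_graph f \<gamma> \<eta> \<in> unit_interval" if "\<eta> \<in> X" for \<eta>
      using Suc.prems(1) c that unfolding continuous_graph_iff by blast+
    have "image_graph f \<gamma> \<eta> < image_graph f (image_graph f \<gamma>) \<eta>" if "\<eta> \<in> X" for \<eta>
    proof -
      have v: "sh (-1) \<eta> \<in> X" using that by simp
      show ?thesis unfolding image_graph_def[of f _ \<eta>]
        by (rule interval_cocycle_less[OF f v gI(1)[OF v] gI(2)[OF v] Suc.prems(2)[OF v]])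
    qed
    then show ?thesis
      using Suc.IH[OF c] False Suc.prems(4) by (simp add: funpow_swap1)
  qed
qed simp

text \<open>Converts the weakly drifting graph of the finite cocycle into a strictly drifting one
  for \<open>f\<close>; the height gained by \<open>h\<close> along the past is a lower bound for
  what \<open>f\<close> gains.\<close>

lemma drifts_up_if_finite_cocycle:
  assumes f: "interval_cocycle X f" and fin: "finite_cocycle N A X k G h"
    and G: "G \<subseteq> unit_interval" and \<delta>: "\<delta> > 0"
    and less: "\<And>\<omega> y. \<omega> \<in> X \<Longrightarrow> y \<in> G \<Longrightarrow> h \<omega> y < f \<omega> (max 0 (y - \<delta>))"
    and w0: "\<omega>0 \<in> X" and x0: "x0 > 0"
    and g: "\<And>\<omega>. \<omega> \<in> X \<Longrightarrow> \<gamma> \<omega> \<in> G" "\<And>\<omega>. \<omega> \<in> X \<Longrightarrow> \<gamma> (sh 1 \<omega>) \<le> h \<omega> (\<gamma> \<omega>)"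
      "\<And>\<omega> \<eta>. \<omega> \<in> X \<Longrightarrow> \<eta> \<in> X \<Longrightarrow> agree L \<omega> \<eta> \<Longrightarrow> \<gamma> \<omega> = \<gamma> \<eta>"
    and gx: "\<gamma> \<omega>0 \<le> x0" "x0 \<le> cocycle h n (sh (- int n) \<omega>0) (\<gamma> (sh (- int n) \<omega>0))" and n: "n \<ge> 1"
  shows "drifts_up X f \<omega>0 x0"
proof -
  interpret finite_cocycle N A X k G h by (rule fin)
  \<comment> \<open>Lowering by \<open>\<delta>\<close> puts the graph strictly below
    \<open>x0\<close>; where the cut-off at 0 takes effect, \<open>x0 > 0\<close> does so. The
    cut-off keeps the graph in the unit interval.\<close>
  let ?g = "\<lambda>\<omega>. max 0 (\<gamma> \<omega> - \<delta>)"
  have gI: "?g \<omega> \<in> unit_interval" if "\<omega> \<in> X" for \<omega> using g(1)[OF that] G \<delta> by auto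
  have c: "continuous_graph X ?g"
    unfolding continuous_graph_iff[of X ?g]
  proof (intro conjI ballI allI impI)
    fix \<omega> and e :: real assume w: "\<omega> \<in> X" and e: "e > 0"
    show "\<exists>k. \<forall>\<eta>\<in>X. agree k \<eta> \<omega> \<longrightarrow> \<bar>?g \<eta> - ?g \<omega>\<bar> < e"
      using e by (intro exI[of _ L]) (auto dest: g(3)[OF _ w])
  qed (use gI in auto)
  \<comment> \<open>A single application of \<open>f\<close> regains the loss of
    \<open>\<delta>\<close>, so each image lies strictly above the orbit under \<open>h\<close> and
    the errors do not add up.\<close>
  have step: "cocycle h (Suc m) (sh (- int (Suc m)) \<omega>) (\<gamma> (sh (- int (Suc m)) \<omega>)) <
      (image_graph f ^^ Suc m) ?g \<omega>" if "\<omega> \<in> X" for m \<omega>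
    using that
  proof (induction m arbitrary: \<omega>)
    case 0
    then show ?case using less[of "sh (-1) \<omega>" "\<gamma> (sh (-1) \<omega>)"] g(1) by (simp add: image_graph_def)
  next
    case (Suc m)
    let ?v = "sh (-1) \<omega>"
    let ?y = "cocycle h (Suc m) (sh (- int (Suc m)) ?v) (\<gamma> (sh (- int (Suc m)) ?v))"
    let ?i = "(image_graph f ^^ Suc m) ?g"
    have v: "?v \<in> X" using Suc.prems by simp
    have yG: "?y \<in> G" using Suc.prems by (intro cocycle_in g(1)) simp_all
    have "continuous_graph X ((image_graph f ^^ j) ?g)" for j
      using c continuous_image_graph[OF f] by (induction j) simp_all
    then have iI: "?i ?v \<in> unit_interval" using v unfolding continuous_graph_iff by blast
    have "h ?v ?y < f ?v (max 0 (?y - \<delta>))" by (rule less[OF v yG])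
    also have "\<dots> \<le> f ?v (?i ?v)"
    proof (rule interval_cocycle_le[OF f v _ iI])
      show "max 0 (?y - \<delta>) \<in> unit_interval" using yG G \<delta> by auto
      show "max 0 (?y - \<delta>) \<le> ?i ?v" using Suc.IH[OF v] iI \<delta> by auto
    qed
    also have "\<dots> = (image_graph f ^^ Suc (Suc m)) ?g \<omega>" by (simp add: image_graph_def)
    finally show ?case by (simp add: add_ac)
  qed
  have drift: "?g \<omega> < image_graph f ?g \<omega>" if "\<omega> \<in> X" for \<omega>
  proof -
    have v: "sh (-1) \<omega> \<in> X" using that by simp
    have "?g \<omega> \<le> \<gamma> \<omega>" using g(1)[OF that] G \<delta> by auto
    also have "\<dots> \<le> h (sh (-1) \<omega>) (\<gamma> (sh (-1) \<omega>))" using g(2)[OF v] by simp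
    also have "\<dots> < image_graph f ?g \<omega>" using less[OF v g(1)[OF v]] by (simp add: image_graph_def)
    finally show ?thesis .
  qed
  obtain m where m: "n = Suc m" using n by (cases n) auto
  have "?g \<omega>0 < x0" using gx(1) x0 \<delta> by auto
  moreover have "x0 \<le> (image_graph f ^^ n) ?g \<omega>0" using gx(2) step[OF w0, of m] m by simp
  ultimately show ?thesis using drifts_up_iterate[OF f w0 c] drift by blast
qed

text \<open>The fiber maps depend on infinitely many symbols. Freezing \<open>f\<close> at one
  representative for each of finitely many cylinders and raising it into the gap gives a monotone
  map that reads only a window and keeps a uniform distance from both sides.\<close>

lemma locally_constant_between:
  assumes f: "interval_cocycle X f" and g: "interval_cocycle X g"
    and less: "\<And>\<omega> x. \<omega> \<in> X \<Longrightarrow> x \<in> unit_interval \<Longrightarrow> f \<omega> x < g \<omega> x"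
  obtains e m k where "e > 0"
    "\<And>\<omega> x. \<omega> \<in> X \<Longrightarrow> x \<in> unit_interval \<Longrightarrow> f \<omega> x + e \<le> m \<omega> x"
    "\<And>\<omega> x. \<omega> \<in> X \<Longrightarrow> x \<in> unit_interval \<Longrightarrow> m \<omega> x + e \<le> g \<omega> x"
    "\<And>\<omega> x y. \<omega> \<in> X \<Longrightarrow> x \<in> unit_interval \<Longrightarrow> y \<in> unit_interval \<Longrightarrow> x \<le> y \<Longrightarrow> m \<omega> x \<le> m \<omega> y"
    "\<And>\<omega> \<eta>. \<omega> \<in> X \<Longrightarrow> \<eta> \<in> X \<Longrightarrow> agree k \<omega> \<eta> \<Longrightarrow> m \<omega> = m \<eta>"
proof -
  have "\<exists>k e. 0 < e \<and> (\<forall>\<eta>\<in>X. agree k \<eta> \<omega> \<longrightarrow>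
      (\<forall>x\<in>unit_interval. f \<eta> x + e \<le> f \<omega> x + 2 * e \<and> f \<omega> x + 3 * e \<le> g \<eta> x))" if w: "\<omega> \<in> X" for \<omega>
  proof -
    obtain Bf Bg where Bf: "Bf > 0" "\<And>x y. x \<in> unit_interval \<Longrightarrow> y \<in> unit_interval \<Longrightarrow> \<bar>f \<omega> x - f \<omega> y\<bar> \<le> Bf * \<bar>x - y\<bar>"
      and Bg: "Bg > 0" "\<And>x y. x \<in> unit_interval \<Longrightarrow> y \<in> unit_interval \<Longrightarrow> \<bar>g \<omega> x - g \<omega> y\<bar> \<le> Bg * \<bar>x - y\<bar>"
      using interval_cocycle_lipschitz[OF f] interval_cocycle_lipschitz[OF g] w by metis
    have "Bf-lipschitz_on unit_interval (f \<omega>)" "Bg-lipschitz_on unit_interval (g \<omega>)"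
      using Bf Bg by (auto intro!: lipschitz_onI simp: dist_real_def)
    then have "continuous_on unit_interval (\<lambda>x. g \<omega> x - f \<omega> x)"
      by (intro continuous_intros) (auto intro: lipschitz_on_continuous_on)
    then obtain z where z: "z \<in> unit_interval"
      "\<And>x. x \<in> unit_interval \<Longrightarrow> g \<omega> z - f \<omega> z \<le> g \<omega> x - f \<omega> x"
      using continuous_attains_inf[of unit_interval "\<lambda>x. g \<omega> x - f \<omega> x"] by auto
    \<comment> \<open>A quarter of the smallest gap: each cocycle varies by less than
      \<open>e\<close> on the cylinder, so \<open>f\<close> raised by \<open>2 * e\<close> keeps
      distance \<open>e\<close> from both.\<close>
    define e where "e = (g \<omega> z - f \<omega> z) / 4"
    have e: "e > 0" using less[OF w z(1)] by (simp add: e_def)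
    obtain k1 where k1: "\<And>\<eta> x. \<eta> \<in> X \<Longrightarrow> agree k1 \<eta> \<omega> \<Longrightarrow> x \<in> unit_interval \<Longrightarrow> \<bar>f \<eta> x - f \<omega> x\<bar> < e"
      using interval_cocycle_cont[OF f w e] by blast
    obtain k2 where k2: "\<And>\<eta> x. \<eta> \<in> X \<Longrightarrow> agree k2 \<eta> \<omega> \<Longrightarrow> x \<in> unit_interval \<Longrightarrow> \<bar>g \<eta> x - g \<omega> x\<bar> < e"
      using interval_cocycle_cont[OF g w e] by blast
    have "f \<eta> x + e \<le> f \<omega> x + 2 * e \<and> f \<omega> x + 3 * e \<le> g \<eta> x"
      if "\<eta> \<in> X" "agree (max k1 k2) \<eta> \<omega>" "x \<in> unit_interval" for \<eta> x
    proof -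
      have "agree k1 \<eta> \<omega>" "agree k2 \<eta> \<omega>" using that(2) by (auto elim: agree_mono)
      from k1[OF that(1) this(1) that(3)] k2[OF that(1) this(2) that(3)] z(2)[OF that(3)]
      show ?thesis by (simp add: e_def abs_if field_simps split: if_splits)
    qed
    with e show ?thesis by blast
  qed
  then obtain \<kappa> \<epsilon> where ke: "\<And>\<omega>. \<omega> \<in> X \<Longrightarrow> 0 < \<epsilon> \<omega>"
    "\<And>\<omega> \<eta> x. \<omega> \<in> X \<Longrightarrow> \<eta> \<in> X \<Longrightarrow> agree (\<kappa> \<omega>) \<eta> \<omega> \<Longrightarrow> x \<in> unit_interval \<Longrightarrow>
       f \<eta> x + \<epsilon> \<omega> \<le> f \<omega> x + 2 * \<epsilon> \<omega> \<and> f \<omega> x + 3 * \<epsilon> \<omega> \<le> g \<eta> x" by metis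
  obtain Y where Y: "finite Y" "Y \<subseteq> X" "\<And>\<eta>. \<eta> \<in> X \<Longrightarrow> \<exists>\<omega>\<in>Y. agree (\<kappa> \<omega>) \<eta> \<omega>"
    using finite_cylinder_cover[OF compact_X, of \<kappa>] by blast
  define k where "k = Max (insert 0 (\<kappa> ` Y))"
  define e where "e = Min (insert 1 (\<epsilon> ` Y))"
  have k: "\<kappa> \<omega> \<le> k" if "\<omega> \<in> Y" for \<omega> using that Y(1) by (simp add: k_def)
  have e: "e > 0" "\<And>\<omega>. \<omega> \<in> Y \<Longrightarrow> e \<le> \<epsilon> \<omega>" using Y(1,2) ke(1) by (auto simp: e_def)
  \<comment> \<open>All windows of the cover are at most \<open>k\<close>, so points agreeing on the
    window \<open>k\<close> satisfy the same predicate and get the same representative.\<close>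
  define rep where "rep \<eta> = (SOME \<omega>. \<omega> \<in> Y \<and> agree (\<kappa> \<omega>) \<eta> \<omega>)" for \<eta>
  have rep: "rep \<eta> \<in> Y" "agree (\<kappa> (rep \<eta>)) \<eta> (rep \<eta>)" if "\<eta> \<in> X" for \<eta>
    using Y(3)[OF that] someI_ex[of "\<lambda>\<omega>. \<omega> \<in> Y \<and> agree (\<kappa> \<omega>) \<eta> \<omega>"] unfolding rep_def by blast+
  define m where "m \<eta> x = f (rep \<eta>) x + 2 * \<epsilon> (rep \<eta>)" for \<eta> x
  show thesis
  proof (rule that[of e m k])
    show "f \<eta> x + e \<le> m \<eta> x" "m \<eta> x + e \<le> g \<eta> x" if "\<eta> \<in> X" "x \<in> unit_interval" for \<eta> x
      using ke(2)[of "rep \<eta>" \<eta> x] rep[OF that(1)] Y(2) that e(2)[of "rep \<eta>"] by (auto simp: m_def)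
    show "m \<eta> x \<le> m \<eta> y" if "\<eta> \<in> X" "x \<in> unit_interval" "y \<in> unit_interval" "x \<le> y" for \<eta> x y
      using interval_cocycle_le[OF f, of "rep \<eta>" x y] rep[OF that(1)] Y(2) that by (auto simp: m_def)
    show "m \<omega> = m \<eta>" if "agree k \<omega> \<eta>" for \<omega> \<eta>
    proof -
      have "\<zeta> \<in> Y \<and> agree (\<kappa> \<zeta>) \<omega> \<zeta> \<longleftrightarrow> \<zeta> \<in> Y \<and> agree (\<kappa> \<zeta>) \<eta> \<zeta>" for \<zeta>
        using that k agree_mono agree_trans agree_sym by meson
      then have "rep \<omega> = rep \<eta>" unfolding rep_def by presburger
      then show ?thesis by (intro ext) (simp add: m_def)
    qed
  qed (rule e(1))
qed

lemma cocycle_reflect: "cocycle (reflect h) n \<omega> y = 1 - cocycle h n \<omega> (1 - y)"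
  by (induction n) (simp_all add: reflect_def)

lemma finite_cocycle_reflect:
  assumes "finite_cocycle N A X k G h"
  shows "finite_cocycle N A X k ((\<lambda>y. 1 - y) ` G) (reflect h)"
proof -
  interpret finite_cocycle N A X k G h by (rule assms)
  show ?thesis
    by unfold_locales
      (use finite_G in \<open>auto simp: reflect_def h_in h_mono intro: h_local\<close>)
qed

text \<open>The point must be interior: graphs and their images stay in the unit interval, so
  heights 0 and 1 never lie strictly inside a drifting strip.\<close>

theorem drift_dichotomy:
  assumes f: "interval_cocycle X f" and g: "interval_cocycle X g"
    and less: "\<And>\<omega> x. \<omega> \<in> X \<Longrightarrow> x \<in> unit_interval \<Longrightarrow> f \<omega> x < g \<omega> x"
    and w0: "\<omega>0 \<in> X" and x0: "0 < x0" "x0 < 1"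
    and forward_dense: "dense_future \<omega>0"
    and backward_dense: "dense_past \<omega>0"
  shows "drifts_up X g \<omega>0 x0 \<or> drifts_up X (reflect f) \<omega>0 (1 - x0)"
proof -
  obtain e m k where e: "e > 0"
    and m: "\<And>\<omega> x. \<omega> \<in> X \<Longrightarrow> x \<in> unit_interval \<Longrightarrow> f \<omega> x + e \<le> m \<omega> x"
      "\<And>\<omega> x. \<omega> \<in> X \<Longrightarrow> x \<in> unit_interval \<Longrightarrow> m \<omega> x + e \<le> g \<omega> x"
      "\<And>\<omega> x y. \<omega> \<in> X \<Longrightarrow> x \<in> unit_interval \<Longrightarrow> y \<in> unit_interval \<Longrightarrow> x \<le> y \<Longrightarrow> m \<omega> x \<le> m \<omega> y"
      "\<And>\<omega> \<eta>. \<omega> \<in> X \<Longrightarrow> \<eta> \<in> X \<Longrightarrow> agree k \<omega> \<eta> \<Longrightarrow> m \<omega> = m \<eta>"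
  proof (rule locally_constant_between[OF f g])
    show "f \<omega> x < g \<omega> x" if "\<omega> \<in> X" "x \<in> unit_interval" for \<omega> x by (rule less[OF that])
  qed (rule that)
  obtain Bf where Bf: "Bf > 0"
    "\<And>\<omega> x y. \<omega> \<in> X \<Longrightarrow> x \<in> unit_interval \<Longrightarrow> y \<in> unit_interval \<Longrightarrow> \<bar>f \<omega> x - f \<omega> y\<bar> \<le> Bf * \<bar>x - y\<bar>"
    using interval_cocycle_lipschitz[OF f] by blast
  obtain Bg where Bg: "Bg > 0"
    "\<And>\<omega> x y. \<omega> \<in> X \<Longrightarrow> x \<in> unit_interval \<Longrightarrow> y \<in> unit_interval \<Longrightarrow> \<bar>g \<omega> x - g \<omega> y\<bar> \<le> Bg * \<bar>x - y\<bar>"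
    using interval_cocycle_lipschitz[OF g] by blast
  \<comment> \<open>A displacement by \<open>\<delta>\<close> changes the values of \<open>f\<close>
    and \<open>g\<close> by at most \<open>e / 2\<close>; the other half of the gap is left for
    rounding.\<close>
  define \<delta> where "\<delta> = e / (2 * max Bf Bg)"
  have \<delta>: "\<delta> > 0" using e Bf(1) by (simp add: \<delta>_def)
  have "max Bf Bg * \<delta> = e / 2" using Bf(1) by (simp add: \<delta>_def)
  moreover have "Bf * \<delta> \<le> max Bf Bg * \<delta>" "Bg * \<delta> \<le> max Bf Bg * \<delta>"
    using \<delta> by (intro mult_right_mono; simp)+
  ultimately have B\<delta>: "Bf * \<delta> \<le> e / 2" "Bg * \<delta> \<le> e / 2" by linarith+
  obtain q :: nat where q: "2 / e < real q" using reals_Archimedean2 by blast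
  have "0 < 2 / e" using e by simp
  with q have q0: "0 < real q" by linarith
  have q1: "1 / real q < e / 2" using q q0 e by (simp add: field_simps)
  \<comment> \<open>The reachability argument starts exactly at \<open>x0\<close>, which is why it
    joins the grid; the grid point 1 makes rounding upward always possible.\<close>
  define G where "G = insert x0 ((\<lambda>i. real i / real q) ` {..q})"
  have G: "finite G" "G \<subseteq> unit_interval" "x0 \<in> G" "1 \<in> G"
    using x0 q0 by (auto simp: G_def image_iff intro!: bexI[of _ q])
  define h where "h \<omega> y = Min {z \<in> G. m \<omega> y \<le> z}" for \<omega> y
  have mI: "0 \<le> m \<omega> y" "m \<omega> y \<le> 1" if "\<omega> \<in> X" "y \<in> unit_interval" for \<omega> y
    using m(1,2)[OF that] interval_cocycle_in[OF f that] interval_cocycle_in[OF g that] e by auto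
  have ne: "{z \<in> G. m \<omega> y \<le> z} \<noteq> {}" if "\<omega> \<in> X" "y \<in> unit_interval" for \<omega> y
    using mI[OF that] G(4) by auto
  have h: "h \<omega> y \<in> G" "m \<omega> y \<le> h \<omega> y" if "\<omega> \<in> X" "y \<in> unit_interval" for \<omega> y
    using Min_in[OF _ ne[OF that]] G(1) unfolding h_def by auto
  have h_upper: "h \<omega> y \<le> m \<omega> y + 1 / real q" if w: "\<omega> \<in> X" "y \<in> unit_interval" for \<omega> y
  proof -
    define i where "i = nat \<lceil>m \<omega> y * real q\<rceil>"
    have i: "m \<omega> y * real q \<le> real i" "real i < m \<omega> y * real q + 1"
      using mI[OF w] q0 unfolding i_def by (auto simp: of_nat_nat of_int_ceiling_le_add_one) linarith+
    have "m \<omega> y * real q \<le> real q" using mI[OF w] q0 by (simp add: mult_left_le_one_le)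
    then have "i \<le> q" unfolding i_def by (simp add: nat_le_iff ceiling_le_iff)
    then have "real i / real q \<in> {z \<in> G. m \<omega> y \<le> z}"
      using i q0 by (auto simp: G_def field_simps)
    then have "h \<omega> y \<le> real i / real q" unfolding h_def using G(1) by (intro Min_le) auto
    also have "\<dots> \<le> m \<omega> y + 1 / real q" using i q0 by (simp add: field_simps)
    finally show ?thesis .
  qed
  have fin: "finite_cocycle N A X k G h"
  proof
    show "h \<omega> y \<in> G" if "\<omega> \<in> X" "y \<in> G" for \<omega> y using h that G(2) by blast
    show "h \<omega> x \<le> h \<omega> y" if "\<omega> \<in> X" "x \<in> G" "y \<in> G" "x \<le> y" for \<omega> x y
    proof -
      have I: "x \<in> unit_interval" "y \<in> unit_interval" using that G(2) by blast+
      have "m \<omega> x \<le> m \<omega> y" by (rule m(3)[OF that(1) I that(4)])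
      then show ?thesis unfolding h_def using ne[OF that(1) I(2)] G(1) by (intro Min_antimono) auto
    qed
    show "h \<omega> y = h \<eta> y" if "\<omega> \<in> X" "\<eta> \<in> X" "agree k \<omega> \<eta>" for \<omega> \<eta> y
      using m(4)[OF that] by (simp add: h_def)
  qed (rule G(1))
  interpret H: finite_cocycle N A X k G h by (rule fin)
  have hg: "h \<omega> y < g \<omega> (max 0 (y - \<delta>))" if w: "\<omega> \<in> X" and y: "y \<in> G" for \<omega> y
  proof -
    have I: "y \<in> unit_interval" "max 0 (y - \<delta>) \<in> unit_interval" using y G(2) \<delta> by auto
    have "\<bar>y - max 0 (y - \<delta>)\<bar> \<le> \<delta>" using I(1) \<delta> by auto
    then have "Bg * \<bar>y - max 0 (y - \<delta>)\<bar> \<le> Bg * \<delta>" using Bg(1) by simp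
    then show ?thesis
      using Bg(2)[OF w I] B\<delta>(2) h_upper[OF w I(1)] m(2)[OF w I(1)] q1 by linarith
  qed
  \<comment> \<open>Rounding upward is free on this side: the values of \<open>h\<close> dominate
    \<open>m\<close>, and the displacement uses up only half of the gap.\<close>
  have hf: "f \<omega> (min 1 (y + \<delta>)) < h \<omega> y" if w: "\<omega> \<in> X" and y: "y \<in> G" for \<omega> y
  proof -
    have I: "min 1 (y + \<delta>) \<in> unit_interval" "y \<in> unit_interval" using y G(2) \<delta> by auto
    have "\<bar>min 1 (y + \<delta>) - y\<bar> \<le> \<delta>" using I(2) \<delta> by auto
    then have "Bf * \<bar>min 1 (y + \<delta>) - y\<bar> \<le> Bf * \<delta>" using Bf(1) by simp
    then show ?thesis
      using Bf(2)[OF w I] B\<delta>(1) h(2)[OF w I(2)] m(1)[OF w I(2)] e by linarith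
  qed
  obtain r n M a where r: "H.minimal_rank r"
    and rn: "card (cocycle h n (sh (- int n) \<omega>0) ` G) = r" and n: "1 \<le> n" and M: "M \<le> n"
    and a: "a \<in> cocycle h n (sh (- int n) \<omega>0) ` G" "cocycle h M \<omega>0 a = cocycle h M \<omega>0 x0"
    by (rule H.minimal_rank_along_orbit[OF w0 G(3) forward_dense backward_dense])
  show ?thesis
  proof (cases "x0 \<le> a")
    \<comment> \<open>The graph starts at or below \<open>x0\<close> and its orbit along the past
      arrives at \<open>a\<close>, so some strip contains \<open>x0\<close>.\<close>
    case True
    obtain \<gamma> L where g': "\<forall>\<omega>\<in>X. \<gamma> \<omega> \<in> G \<and> \<gamma> (sh 1 \<omega>) \<le> h \<omega> (\<gamma> \<omega>)"
      "\<forall>\<omega>\<in>X. \<forall>\<eta>\<in>X. agree L \<omega> \<eta> \<longrightarrow> \<gamma> \<omega> = \<gamma> \<eta>" "\<gamma> \<omega>0 \<le> x0"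
      "cocycle h n (sh (- int n) \<omega>0) (\<gamma> (sh (- int n) \<omega>0)) = a"
      using H.drifting_graph[OF w0 G(3) a(1) forward_dense r rn M a(2)] by blast
    have "drifts_up X g \<omega>0 x0"
    proof (rule drifts_up_if_finite_cocycle[OF g fin G(2) \<delta> _ w0 x0(1), where \<gamma> = \<gamma> and L = L and n = n])
      show "h \<omega> y < g \<omega> (max 0 (y - \<delta>))" if "\<omega> \<in> X" "y \<in> G" for \<omega> y by (rule hg[OF that])
      show "\<gamma> \<omega> \<in> G" "\<gamma> (sh 1 \<omega>) \<le> h \<omega> (\<gamma> \<omega>)" if "\<omega> \<in> X" for \<omega> using g'(1) that by blast+
      show "\<gamma> \<omega> = \<gamma> \<eta>" if "\<omega> \<in> X" "\<eta> \<in> X" "agree L \<omega> \<eta>" for \<omega> \<eta> using g'(2) that by blast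
      show "x0 \<le> cocycle h n (sh (- int n) \<omega>0) (\<gamma> (sh (- int n) \<omega>0))" using g'(4) True by simp
    qed (fact g'(3) n)+
    then show ?thesis ..
  next
    case False
    \<comment> \<open>The flip preserves cardinalities of images, so minimality of \<open>r\<close>
      carries over, while \<open>1 - a\<close> now lies above \<open>1 - x0\<close>.\<close>
    let ?G = "(\<lambda>y. 1 - y) ` G" and ?h = "reflect h"
    have fin': "finite_cocycle N A X k ?G ?h" by (rule finite_cocycle_reflect[OF fin])
    interpret R: finite_cocycle N A X k ?G ?h by (rule fin')
    have im: "cocycle ?h j \<omega> ` ?G = (\<lambda>y. 1 - y) ` (cocycle h j \<omega> ` G)" for j \<omega>
      by (simp add: cocycle_reflect image_image)
    have inj: "inj_on (\<lambda>y. 1 - y) S" for S :: "real set" by (simp add: inj_on_def)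
    have cd: "card (cocycle ?h j \<omega> ` ?G) = card (cocycle h j \<omega> ` G)" for j \<omega>
      unfolding im by (rule card_image[OF inj])
    obtain \<gamma> L where g': "\<forall>\<omega>\<in>X. \<gamma> \<omega> \<in> ?G \<and> \<gamma> (sh 1 \<omega>) \<le> ?h \<omega> (\<gamma> \<omega>)"
      "\<forall>\<omega>\<in>X. \<forall>\<eta>\<in>X. agree L \<omega> \<eta> \<longrightarrow> \<gamma> \<omega> = \<gamma> \<eta>" "\<gamma> \<omega>0 \<le> 1 - x0"
      "cocycle ?h n (sh (- int n) \<omega>0) (\<gamma> (sh (- int n) \<omega>0)) = 1 - a"
    proof -
      have "1 - x0 \<in> ?G" "1 - a \<in> cocycle ?h n (sh (- int n) \<omega>0) ` ?G" using G(3) a(1) im by auto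
      moreover have "cocycle ?h M \<omega>0 (1 - a) = cocycle ?h M \<omega>0 (1 - x0)" using a(2) by (simp add: cocycle_reflect)
      moreover have "R.minimal_rank r"
        using r unfolding R.minimal_rank_def H.minimal_rank_def cd .
      ultimately show thesis
        using R.drifting_graph[OF w0 _ _ forward_dense, of "1 - x0" "1 - a" n r M] rn[folded cd] M that by blast
    qed
    have "drifts_up X (reflect f) \<omega>0 (1 - x0)"
    proof (rule drifts_up_if_finite_cocycle[OF interval_cocycle_reflect[OF f] fin' _ \<delta> _ w0, where \<gamma> = \<gamma> and L = L and n = n])
      show "?G \<subseteq> unit_interval" using G(2) by auto
      show "?h \<omega> y < reflect f \<omega> (max 0 (y - \<delta>))" if "\<omega> \<in> X" "y \<in> ?G" for \<omega> y
      proof -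
        have "1 - max 0 (y - \<delta>) = min 1 (1 - y + \<delta>)" by auto
        then show ?thesis using hf[OF that(1), of "1 - y"] that(2) by (auto simp: reflect_def)
      qed
      show "\<gamma> \<omega> \<in> ?G" "\<gamma> (sh 1 \<omega>) \<le> ?h \<omega> (\<gamma> \<omega>)" if "\<omega> \<in> X" for \<omega> using g'(1) that by blast+
      show "\<gamma> \<omega> = \<gamma> \<eta>" if "\<omega> \<in> X" "\<eta> \<in> X" "agree L \<omega> \<eta>" for \<omega> \<eta> using g'(2) that by blast
      show "1 - x0 \<le> cocycle ?h n (sh (- int n) \<omega>0) (\<gamma> (sh (- int n) \<omega>0))" using g'(4) False by simp
      show "0 < 1 - x0" using x0 by simp
    qed (fact g'(3) n)+
    then show ?thesis ..
  qed
qed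

end


section \<open>Density of almost every orbit\<close>

lemma agree_iff_map: "agree k \<omega> \<eta> \<longleftrightarrow> map \<omega> [- int k..int k] = map \<eta> [- int k..int k]"
  by (auto simp: agree_def abs_le_iff)

text \<open>Indexed by words rather than by centres, so that there are only countably many.\<close>

definition cylinder :: "(int \<Rightarrow> nat) set \<Rightarrow> nat \<Rightarrow> nat list \<Rightarrow> (int \<Rightarrow> nat) set" where
  "cylinder X k w = {\<omega> \<in> X. map \<omega> [- int k..int k] = w}"

lemma openin_cylinder: "openin (shift_topology X) (cylinder X k w)"
  unfolding openin_shift_iff cylinder_def
  by (auto simp: agree_def abs_le_iff intro!: exI[of _ k])

lemma openin_coordinate: "openin (shift_topology X) {\<omega> \<in> X. \<omega> n = c}"
  unfolding openin_shift_iff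
  by (auto intro!: exI[of _ "nat \<bar>n\<bar>"] dest!: agreeD[where n = n])

section \<open>Positivity of cylinders and ergodicity\<close>

locale markov_shift = topological_markov_chain N A X for N A X +
  fixes \<mu> :: "(int \<Rightarrow> nat) measure"
  assumes transitive: "topologically_transitive X"
    and markov: "markov_measure N A \<mu>"
    and invariant: "shift_invariant \<mu>"
    and ergodic: "shift_ergodic \<mu>"
begin

lemma space_\<mu>: "space \<mu> = X"
  using markov unfolding markov_measure_def X_def by blast

lemma prob_\<mu>: "prob_space \<mu>"
  using markov unfolding markov_measure_def by blast

sublocale prob_space \<mu> by (rule prob_\<mu>)

lemma sets_openin: "openin (shift_topology X) U \<Longrightarrow> U \<in> sets \<mu>"
  using markov unfolding markov_measure_def X_def by (auto intro: sigma_sets.Basic)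

lemma X_nonempty: "X \<noteq> {}"
  using not_empty space_\<mu> by simp

text \<open>Transition probabilities along an admissible word are positive, so only the initial
  weight could vanish. Transitivity rules this out: an admissible word leads from a symbol of
  positive weight to any symbol occurring in \<open>X\<close>, and its positive measure bounds the
  weight of its last symbol from below.\<close>

lemma cylinder_pos:
  assumes n: "\<eta> \<in> X" shows "0 < measure \<mu> {\<omega> \<in> X. agree k \<omega> \<eta>}"
proof -
  obtain p :: "nat \<Rightarrow> real" and P :: "nat \<Rightarrow> nat \<Rightarrow> real"
    where p: "\<forall>i\<in>{1..N}. 0 \<le> p i" "(\<Sum>i\<in>{1..N}. p i) = 1"
      and P: "\<forall>i\<in>{1..N}. \<forall>j\<in>{1..N}. 0 \<le> P i j \<and> (0 < P i j \<longleftrightarrow> A i j)"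
      and cyl: "\<forall>(m :: int) w. w \<noteq> [] \<and> set w \<subseteq> {1..N} \<longrightarrow>
           measure \<mu> {\<omega> \<in> X. \<forall>k<length w. \<omega> (m + int k) = w ! k} =
           p (w ! 0) * (\<Prod>k<length w - 1. P (w ! k) (w ! (k + 1)))"
    using markov unfolding markov_measure_def X_def by blast
  have XN: "\<omega> n \<in> {1..N}" "A (\<omega> n) (\<omega> (n + 1))" if "\<omega> \<in> X" for \<omega> n
    using that unfolding X_def markov_chain_space_def by auto
  have pos: "0 < measure \<mu> {\<xi> \<in> X. \<forall>i<Suc l. \<xi> (m + int i) = \<omega> (m + int i)}"
    if w: "\<omega> \<in> X" and p0: "0 < p (\<omega> m)" for \<omega> m l
  proof -
    let ?w = "map (\<lambda>i. \<omega> (m + int i)) [0..<Suc l]"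
    have wi: "?w ! i = \<omega> (m + int i)" if "i < Suc l" for i
      using that by (metis add_0 diff_zero length_upt nth_map nth_upt)
    have len: "length ?w = Suc l" by simp
    have "measure \<mu> {\<xi> \<in> X. \<forall>i<length ?w. \<xi> (m + int i) = ?w ! i} =
        p (?w ! 0) * (\<Prod>i<length ?w - 1. P (?w ! i) (?w ! (i + 1)))"
      using cyl XN(1)[OF w] by (intro cyl[rule_format]) auto
    moreover have "{\<xi> \<in> X. \<forall>i<length ?w. \<xi> (m + int i) = ?w ! i} =
        {\<xi> \<in> X. \<forall>i<Suc l. \<xi> (m + int i) = \<omega> (m + int i)}"
      unfolding len using wi by auto
    moreover have "0 < (\<Prod>i<length ?w - 1. P (?w ! i) (?w ! (i + 1)))"
    proof (rule prod_pos)
      fix i assume "i \<in> {..<length ?w - 1}"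
      then have "?w ! i = \<omega> (m + int i)" "?w ! (i + 1) = \<omega> (m + int i + 1)"
        using wi[of i] wi[of "i + 1"] by (simp_all add: add_ac)
      then show "0 < P (?w ! i) (?w ! (i + 1))" using P XN[OF w] by metis
    qed
    moreover have "?w ! 0 = \<omega> m" using wi[of 0] by simp
    ultimately show ?thesis using p0 by simp
  qed
  have single: "measure \<mu> {\<omega> \<in> X. \<omega> m = c} = p c" if "c \<in> {1..N}" for m c
    using cyl[rule_format, of "[c]" m] that by simp
  obtain i where i: "i \<in> {1..N}" "0 < p i"
    using p sum_nonpos[of "{1..N}" p] by (metis less_eq_real_def not_le not_one_le_zero order_refl)
  have "{\<omega> \<in> X. \<omega> 0 = i} \<noteq> {}" using single[OF i(1), of 0] i(2) by (metis less_irrefl measure_empty)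
  moreover have p_pos: "0 < p (\<eta>' 0)" if "\<eta>' \<in> X" for \<eta>'
  proof -
    have "{\<omega> \<in> X. \<omega> 0 = \<eta>' 0} \<noteq> {}" using that by blast
    with calculation obtain n where "(left_shift ^^ n) ` {\<omega> \<in> X. \<omega> 0 = i} \<inter> {\<omega> \<in> X. \<omega> 0 = \<eta>' 0} \<noteq> {}"
      using transitive openin_coordinate unfolding topologically_transitive_def by meson
    then have "\<exists>\<omega>. \<omega> \<in> X \<and> \<omega> 0 = i \<and> \<omega> (int n) = \<eta>' 0"
      by (auto simp: left_shift_funpow sh_def)
    then obtain \<omega> where w: "\<omega> \<in> X" "\<omega> 0 = i" "\<omega> (int n) = \<eta>' 0" by blast
    have "0 < measure \<mu> {\<xi> \<in> X. \<forall>i<Suc n. \<xi> (0 + int i) = \<omega> (0 + int i)}"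
      using pos[OF w(1), of 0 n] w(2) i(2) by simp
    also have "\<dots> \<le> measure \<mu> {\<omega> \<in> X. \<omega> (int n) = \<eta>' 0}"
      by (rule finite_measure_mono) (use w(3) in \<open>auto intro: sets_openin openin_coordinate\<close>)
    also have "\<dots> = p (\<eta>' 0)" using XN(1)[OF that] by (intro single)
    finally show ?thesis .
  qed
  have "0 < p (\<eta> (- int k))" using p_pos[OF sh_X[OF n, of "- int k"]] by (simp add: sh_def)
  from pos[OF n this, of "2 * k"]
  have "0 < measure \<mu> {\<xi> \<in> X. \<forall>i<Suc (2 * k). \<xi> (- int k + int i) = \<eta> (- int k + int i)}" .
  moreover have "(\<forall>i<Suc (2 * k). \<xi> (- int k + int i) = \<eta> (- int k + int i)) \<longleftrightarrow> agree k \<xi> \<eta>" for \<xi>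
  proof
    assume a: "\<forall>i<Suc (2 * k). \<xi> (- int k + int i) = \<eta> (- int k + int i)"
    show "agree k \<xi> \<eta>" unfolding agree_def
    proof (intro allI impI)
      fix n :: int assume "\<bar>n\<bar> \<le> int k"
      then have "nat (n + int k) < Suc (2 * k)" "- int k + int (nat (n + int k)) = n" by linarith+
      then show "\<xi> n = \<eta> n" using a by metis
    qed
  qed (auto simp: agree_def)
  ultimately show ?thesis by simp
qed

lemma measure_left_shift:
  assumes "B \<in> sets \<mu>" shows "measure \<mu> {\<omega> \<in> X. sh 1 \<omega> \<in> B} = measure \<mu> B"
proof -
  have "measure \<mu> B = measure (distr \<mu> \<mu> left_shift) B"
    using invariant unfolding shift_invariant_def by simp
  also have "\<dots> = measure \<mu> (left_shift -` B \<inter> space \<mu>)"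
    using invariant assms unfolding shift_invariant_def by (intro measure_distr) auto
  also have "left_shift -` B \<inter> space \<mu> = {\<omega> \<in> X. sh 1 \<omega> \<in> B}"
    by (auto simp: space_\<mu> left_shift_eq)
  finally show ?thesis by simp
qed

text \<open>
  The sets \<^term>\<open>E j\<close> all have the same measure, so that the first one already has the measure
  of their union, which is invariant.
\<close>

lemma increasing_orbit_sets_full:
  fixes E :: "nat \<Rightarrow> (int \<Rightarrow> nat) set"
  assumes E: "\<And>j. E j \<in> sets \<mu>" and inc: "incseq E"
    and shift: "(\<forall>j. {\<omega> \<in> X. sh 1 \<omega> \<in> E j} = E (Suc j)) \<or> (\<forall>j. {\<omega> \<in> X. sh 1 \<omega> \<in> E (Suc j)} = E j)"
    and pos: "0 < measure \<mu> (E 0)"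
  shows "measure \<mu> (E 0) = 1"
proof -
  have "measure \<mu> (E (Suc j)) = measure \<mu> (E j)" for j
    using shift measure_left_shift[OF E[of j]] measure_left_shift[OF E[of "Suc j"]]
    by (elim disjE) (drule spec[of _ j], simp)+
  then have const: "measure \<mu> (E j) = measure \<mu> (E 0)" for j
    by (induction j) simp_all
  have "(\<lambda>j. measure \<mu> (E j)) \<longlonglongrightarrow> measure \<mu> (\<Union>j. E j)"
    by (rule finite_Lim_measure_incseq) (use E inc in auto)
  then have eq: "measure \<mu> (\<Union>j. E j) = measure \<mu> (E 0)"
    by (rule LIMSEQ_unique) (use const in \<open>subst ext[OF const], simp\<close>)
  have E_Suc: "E j \<subseteq> E (Suc j)" for j using inc by (simp add: incseq_SucD)
  have "left_shift -` (\<Union>j. E j) \<inter> space \<mu> = (\<Union>j. {\<omega> \<in> X. sh 1 \<omega> \<in> E j})"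
    by (auto simp: space_\<mu> left_shift_eq)
  \<comment> \<open>The preimage under the shift moves the index by one, up or down depending on the
    alternative; the union of an increasing sequence absorbs either.\<close>
  also have "\<dots> = (\<Union>j. E j)"
    using shift
  proof
    assume s: "\<forall>j. {\<omega> \<in> X. sh 1 \<omega> \<in> E j} = E (Suc j)"
    show ?thesis unfolding s[rule_format] using E_Suc by blast
  next
    assume s': "\<forall>j. {\<omega> \<in> X. sh 1 \<omega> \<in> E (Suc j)} = E j"
    note s = s'[rule_format]
    have "{\<omega> \<in> X. sh 1 \<omega> \<in> E j} \<subseteq> E j" for j
      using s[of j] E_Suc[of j] by blast
    moreover have "E j \<subseteq> {\<omega> \<in> X. sh 1 \<omega> \<in> E (Suc j)}" for j using s[of j] by simp
    ultimately show ?thesis by blast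
  qed
  finally have inv: "left_shift -` (\<Union>j. E j) \<inter> space \<mu> = (\<Union>j. E j)" .
  have "(\<Union>j. E j) \<in> sets \<mu>" using E by (intro sets.countable_UN) auto
  then have "measure \<mu> (\<Union>j. E j) = 0 \<or> measure \<mu> (\<Union>j. E j) = 1"
    using ergodic inv unfolding shift_ergodic_def by blast
  with eq pos show ?thesis by simp
qed

lemma openin_shifted:
  assumes "openin (shift_topology X) U" shows "openin (shift_topology X) {\<omega> \<in> X. sh n \<omega> \<in> U}"
  unfolding openin_shift_iff
proof (intro conjI ballI)
  fix \<omega> assume "\<omega> \<in> {\<omega> \<in> X. sh n \<omega> \<in> U}"
  then obtain k where "\<forall>\<eta>\<in>X. agree k \<eta> (sh n \<omega>) \<longrightarrow> \<eta> \<in> U"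
    using assms unfolding openin_shift_iff by blast
  then show "\<exists>k. \<forall>\<eta>\<in>X. agree k \<eta> \<omega> \<longrightarrow> \<eta> \<in> {\<omega> \<in> X. sh n \<omega> \<in> U}"
    by (intro exI[of _ "k + nat \<bar>n\<bar>"]) (auto intro: agree_sh)
qed auto

lemma openin_orbit_meets:
  assumes "openin (shift_topology X) U"
  shows "openin (shift_topology X) {\<omega> \<in> X. \<exists>n\<in>T. sh n \<omega> \<in> U}"
proof -
  have "{\<omega> \<in> X. \<exists>n\<in>T. sh n \<omega> \<in> U} = (\<Union>n\<in>T. {\<omega> \<in> X. sh n \<omega> \<in> U})" by auto
  then show ?thesis using openin_shifted[OF assms] by (auto intro!: openin_Union)
qed

text \<open>The points visiting \<open>U\<close> in the future need not form an invariant set.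
  Allowing visits from time \<open>- j\<close> on, or up to time \<open>j\<close> for the past,
  gives increasing sets whose indices the shift moves by one; the first contains \<open>U\<close>
  and so has positive measure.\<close>

lemma AE_orbit_meets:
  assumes U: "openin (shift_topology X) U" and pos: "0 < measure \<mu> U"
  shows "AE \<omega> in \<mu>. \<exists>n::nat. sh (int n) \<omega> \<in> U" "AE \<omega> in \<mu>. \<exists>n::nat. sh (- int n) \<omega> \<in> U"
proof -
  let ?E = "\<lambda>T. {\<omega> \<in> X. \<exists>n\<in>T. sh n \<omega> \<in> U}"
  have meas: "?E T \<in> sets \<mu>" for T by (rule sets_openin[OF openin_orbit_meets[OF U]])
  have UX: "U \<subseteq> X" using U unfolding openin_shift_iff by blast
  have pos': "0 < measure \<mu> (?E T)" if "0 \<in> T" for T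
  proof -
    have "measure \<mu> U \<le> measure \<mu> (?E T)"
      using that UX meas by (intro finite_measure_mono) (auto intro: bexI[of _ 0])
    with pos show ?thesis by simp
  qed
  have "measure \<mu> (?E {- int 0..}) = 1"
  proof (rule increasing_orbit_sets_full[of "\<lambda>j. ?E {- int j..}"])
    show "incseq (\<lambda>j. ?E {- int j..})" unfolding incseq_def by force
    have "{\<omega> \<in> X. sh 1 \<omega> \<in> ?E {- int (Suc j)..}} = ?E {- int j..}" for j
    proof (intro equalityI subsetI)
      fix \<omega> assume "\<omega> \<in> {\<omega> \<in> X. sh 1 \<omega> \<in> ?E {- int (Suc j)..}}"
      then obtain n where "\<omega> \<in> X" "- int (Suc j) \<le> n" "sh (n + 1) \<omega> \<in> U" by auto
      then show "\<omega> \<in> ?E {- int j..}" by (intro CollectI conjI bexI[of _ "n + 1"]) auto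
    next
      fix \<omega> assume "\<omega> \<in> ?E {- int j..}"
      then obtain n where "\<omega> \<in> X" "- int j \<le> n" "sh n \<omega> \<in> U" by auto
      then show "\<omega> \<in> {\<omega> \<in> X. sh 1 \<omega> \<in> ?E {- int (Suc j)..}}"
        by (intro CollectI conjI bexI[of _ "n - 1"]) auto
    qed
    then show "(\<forall>j. {\<omega> \<in> X. sh 1 \<omega> \<in> ?E {- int j..}} = ?E {- int (Suc j)..}) \<or>
        (\<forall>j. {\<omega> \<in> X. sh 1 \<omega> \<in> ?E {- int (Suc j)..}} = ?E {- int j..})" by blast
  qed (use meas pos'[of "{- int 0..}"] in auto)
  then have "AE \<omega> in \<mu>. \<omega> \<in> ?E {- int 0..}" by (rule AE_in_set_eq_1[OF meas, THEN iffD2])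
  then show "AE \<omega> in \<mu>. \<exists>n::nat. sh (int n) \<omega> \<in> U"
  proof (rule AE_mp, intro AE_I2 impI)
    fix \<omega> assume "\<omega> \<in> ?E {- int 0..}"
    then obtain n where "0 \<le> n" "sh n \<omega> \<in> U" by auto
    then show "\<exists>n::nat. sh (int n) \<omega> \<in> U" by (intro exI[of _ "nat n"]) simp
  qed
  have "measure \<mu> (?E {..int 0}) = 1"
  proof (rule increasing_orbit_sets_full[of "\<lambda>j. ?E {..int j}"])
    show "incseq (\<lambda>j. ?E {..int j})" unfolding incseq_def by force
    have "{\<omega> \<in> X. sh 1 \<omega> \<in> ?E {..int j}} = ?E {..int (Suc j)}" for j
    proof (intro equalityI subsetI)
      fix \<omega> assume "\<omega> \<in> {\<omega> \<in> X. sh 1 \<omega> \<in> ?E {..int j}}"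
      then obtain n where "\<omega> \<in> X" "n \<le> int j" "sh (n + 1) \<omega> \<in> U" by auto
      then show "\<omega> \<in> ?E {..int (Suc j)}" by (intro CollectI conjI bexI[of _ "n + 1"]) auto
    next
      fix \<omega> assume "\<omega> \<in> ?E {..int (Suc j)}"
      then obtain n where "\<omega> \<in> X" "n \<le> int (Suc j)" "sh n \<omega> \<in> U" by auto
      then show "\<omega> \<in> {\<omega> \<in> X. sh 1 \<omega> \<in> ?E {..int j}}"
        by (intro CollectI conjI bexI[of _ "n - 1"]) auto
    qed
    then show "(\<forall>j. {\<omega> \<in> X. sh 1 \<omega> \<in> ?E {..int j}} = ?E {..int (Suc j)}) \<or>
        (\<forall>j. {\<omega> \<in> X. sh 1 \<omega> \<in> ?E {..int (Suc j)}} = ?E {..int j})" by blast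
  qed (use meas pos'[of "{..int 0}"] in auto)
  then have "AE \<omega> in \<mu>. \<omega> \<in> ?E {..int 0}" by (rule AE_in_set_eq_1[OF meas, THEN iffD2])
  then show "AE \<omega> in \<mu>. \<exists>n::nat. sh (- int n) \<omega> \<in> U"
  proof (rule AE_mp, intro AE_I2 impI)
    fix \<omega> assume "\<omega> \<in> ?E {..int 0}"
    then obtain n where "n \<le> 0" "sh n \<omega> \<in> U" by auto
    then show "\<exists>n::nat. sh (- int n) \<omega> \<in> U" by (intro exI[of _ "nat (- n)"]) simp
  qed
qed

lemma AE_dense_orbits: "AE \<omega> in \<mu>. dense_future \<omega> \<and> dense_past \<omega>"
proof -
  let ?C = "\<lambda>(k, w). cylinder X k w"
  let ?I = "{(k, w). cylinder X k w \<noteq> {}}"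
  have "AE \<omega> in \<mu>. \<forall>c\<in>?I. (\<exists>n::nat. sh (int n) \<omega> \<in> ?C c) \<and> (\<exists>n::nat. sh (- int n) \<omega> \<in> ?C c)"
  proof (subst AE_ball_countable)
    show "countable ?I" by (rule countableI_type)
    show "\<forall>c\<in>?I. AE \<omega> in \<mu>. (\<exists>n::nat. sh (int n) \<omega> \<in> ?C c) \<and> (\<exists>n::nat. sh (- int n) \<omega> \<in> ?C c)"
    proof
      fix c assume "c \<in> ?I"
      then obtain k w \<eta> where c: "c = (k, w)" "\<eta> \<in> cylinder X k w" by auto
      then have "cylinder X k w = {\<omega> \<in> X. agree k \<omega> \<eta>}" "\<eta> \<in> X"
        by (auto simp: cylinder_def agree_iff_map)
      then have "0 < measure \<mu> (cylinder X k w)" using cylinder_pos by simp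
      from AE_orbit_meets[OF openin_cylinder this]
      show "AE \<omega> in \<mu>. (\<exists>n::nat. sh (int n) \<omega> \<in> ?C c) \<and> (\<exists>n::nat. sh (- int n) \<omega> \<in> ?C c)"
        unfolding c(1) by (auto intro: AE_conjI)
    qed
  qed
  then show ?thesis
  proof (rule AE_mp, intro AE_I2 impI)
    fix \<omega> assume a: "\<forall>c\<in>?I. (\<exists>n::nat. sh (int n) \<omega> \<in> ?C c) \<and> (\<exists>n::nat. sh (- int n) \<omega> \<in> ?C c)"
    have "(\<exists>n. agree L (sh (int n) \<omega>) \<eta>) \<and> (\<exists>n. agree L (sh (- int n) \<omega>) \<eta>)" if "\<eta> \<in> X" for \<eta> L
    proof -
      let ?c = "(L, map \<eta> [- int L..int L])"
      have "?c \<in> ?I" using that by (auto simp: cylinder_def)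
      from bspec[OF a this] show ?thesis by (auto simp: cylinder_def agree_iff_map)
    qed
    then show "dense_future \<omega> \<and> dense_past \<omega>" unfolding dense_future_def dense_past_def by blast
  qed
qed

end


section \<open>Skew products with a thick anchored set\<close>

abbreviation uniform_interval :: "real measure" where
  "uniform_interval \<equiv> restrict_space lborel unit_interval"

lemma prob_space_uniform_interval: "prob_space uniform_interval"
  by (rule prob_spaceI) (simp add: emeasure_restrict_space space_restrict_space)

lemma skew_productsD:
  assumes "F \<in> skew_products X" "\<omega> \<in> X"
  shows "fiber F \<omega> ` unit_interval \<subseteq> unit_interval" "C1_diffeo_onto_image (fiber F \<omega>)"
    "strict_mono_on unit_interval (fiber F \<omega>)" "C1_on unit_interval (fiber F \<omega>)"
    "\<epsilon> > 0 \<Longrightarrow> \<exists>\<delta>>0. \<forall>\<eta>\<in>X. shift_dist \<eta> \<omega> < \<delta> \<longrightarrow> C1_dist (fiber F \<eta>) (fiber F \<omega>) < \<epsilon>"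
  using assms unfolding skew_products_def C1_diffeo_onto_image_def by blast+

lemma skew_products_C1_cont:
  assumes F: "F \<in> skew_products X" and w: "\<omega> \<in> X" and e: "e > 0"
  shows "\<exists>k. \<forall>\<eta>\<in>X. agree k \<eta> \<omega> \<longrightarrow> (\<forall>x\<in>unit_interval.
    \<bar>fiber F \<eta> x - fiber F \<omega> x\<bar> < e \<and> \<bar>unit_deriv (fiber F \<eta>) x - unit_deriv (fiber F \<omega>) x\<bar> < e)"
proof -
  obtain \<delta> where \<delta>: "\<delta> > 0" "\<And>\<eta>. \<eta> \<in> X \<Longrightarrow> shift_dist \<eta> \<omega> < \<delta> \<Longrightarrow> C1_dist (fiber F \<eta>) (fiber F \<omega>) < e"
    using skew_productsD(5)[OF F w e] by blast
  obtain k where k: "(1 / 2) ^ k < \<delta>" using real_arch_pow_inv[OF \<delta>(1), of "1 / 2"] by auto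
  show ?thesis
  proof (intro exI[of _ k] ballI impI)
    fix \<eta> x assume n: "\<eta> \<in> X" "agree k \<eta> \<omega>" and x: "x \<in> unit_interval"
    obtain B C where "C1_bounded B (fiber F \<eta>)" "C1_bounded C (fiber F \<omega>)"
      using C1_on_bounded skew_productsD(4)[OF F] w n(1) by meson
    moreover have "shift_dist \<eta> \<omega> < \<delta>"
      using n(2) k shift_dist_less_iff_agree[of \<eta> \<omega> k] by linarith
    ultimately show "\<bar>fiber F \<eta> x - fiber F \<omega> x\<bar> < e \<and> \<bar>unit_deriv (fiber F \<eta>) x - unit_deriv (fiber F \<omega>) x\<bar> < e"
      using C1_dist_pointwise[OF _ _ x] \<delta>(2)[OF n(1)] by fastforce
  qed
qed

text \<open>Compactness of \<open>X\<close> bounds all fiber derivatives at once, and the mean value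
  inequality turns the bound into a common Lipschitz constant.\<close>

lemma interval_cocycle_fiber:
  assumes X: "compact_space (shift_topology X)" and F: "F \<in> skew_products X"
  shows "interval_cocycle X (fiber F)"
proof -
  obtain B where B: "\<And>\<omega>. \<omega> \<in> X \<Longrightarrow> C1_bounded B (fiber F \<omega>)"
    using skew_products_uniform_bounds[OF X F] by blast
  have lip: "\<bar>fiber F \<omega> x - fiber F \<omega> y\<bar> \<le> max 1 B * \<bar>x - y\<bar>"
    if w: "\<omega> \<in> X" and x: "x \<in> unit_interval" and y: "y \<in> unit_interval" for \<omega> x y
  proof -
    have "norm (fiber F \<omega> x - fiber F \<omega> y) \<le> max 1 B * norm (x - y)"
    proof (rule field_differentiable_bound[of unit_interval _ "unit_deriv (fiber F \<omega>)"])
      show "(fiber F \<omega> has_field_derivative unit_deriv (fiber F \<omega>) z) (at z within unit_interval)"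
        if "z \<in> unit_interval" for z
        by (rule C1_on_unit_deriv(1)[OF skew_productsD(4)[OF F w] that])
      show "norm (unit_deriv (fiber F \<omega>) z) \<le> max 1 B" if "z \<in> unit_interval" for z
        using B[OF w] that unfolding C1_bounded_def by (auto simp: le_max_iff_disj)
    qed (use x y in auto)
    then show ?thesis by simp
  qed
  show ?thesis unfolding interval_cocycle_def
  proof (intro conjI ballI allI impI)
    show "fiber F \<omega> x \<in> unit_interval" if "\<omega> \<in> X" "x \<in> unit_interval" for \<omega> x
      using skew_productsD(1)[OF F that(1)] that(2) by blast
    show "fiber F \<omega> x < fiber F \<omega> y" if "\<omega> \<in> X" "x \<in> unit_interval" "y \<in> unit_interval" "x < y" for \<omega> x y
      using strict_mono_onD[OF skew_productsD(3)[OF F that(1)]] that by blast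
    show "\<exists>k. \<forall>\<eta>\<in>X. agree k \<eta> \<omega> \<longrightarrow> (\<forall>x\<in>unit_interval. \<bar>fiber F \<eta> x - fiber F \<omega> x\<bar> < e)"
      if "\<omega> \<in> X" "e > 0" for \<omega> e
      using skew_products_C1_cont[OF F that] by blast
    show "\<exists>B>0. \<forall>\<omega>\<in>X. \<forall>x\<in>unit_interval. \<forall>y\<in>unit_interval. \<bar>fiber F \<omega> x - fiber F \<omega> y\<bar> \<le> B * \<bar>x - y\<bar>"
      by (intro exI[of _ "max 1 B"] conjI ballI lip) auto
  qed
qed

text \<open>The uniform bounds on the fibers and on their inverses guarantee that the suprema in
  \<open>skew_dist\<close> are taken over bounded sets and hence are upper bounds.\<close>

lemma fiber_diff_le_skew_dist:
  assumes X: "compact_space (shift_topology X)"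
    and F: "F \<in> skew_products X" and G: "G \<in> skew_products X" and w: "\<omega> \<in> X" and x: "x \<in> unit_interval"
  shows "\<bar>fiber F \<omega> x - fiber G \<omega> x\<bar> \<le> skew_dist X F G"
proof -
  let ?d = "\<lambda>\<omega>. max (C1_dist (fiber F \<omega>) (fiber G \<omega>)) (C1_dist_inverse (fiber F \<omega>) (fiber G \<omega>))"
  obtain B where B: "\<And>\<omega>. \<omega> \<in> X \<Longrightarrow> C1_bounded B (fiber F \<omega>) \<and> C1_bounded B (inv (linear_extension (fiber F \<omega>)))"
    using skew_products_uniform_bounds[OF X F] by blast
  obtain C where C: "\<And>\<omega>. \<omega> \<in> X \<Longrightarrow> C1_bounded C (fiber G \<omega>) \<and> C1_bounded C (inv (linear_extension (fiber G \<omega>)))"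
    using skew_products_uniform_bounds[OF X G] by blast
  have "bdd_above (?d ` X)"
    by (rule bdd_aboveI2[where M = "B + C"])
      (use B C C1_dist_le_add in \<open>auto simp: C1_dist_inverse_def\<close>)
  then have "?d \<omega> \<le> skew_dist X F G" using w F G unfolding skew_dist_def by (auto intro: cSUP_upper2)
  moreover have "\<bar>fiber F \<omega> x - fiber G \<omega> x\<bar> \<le> C1_dist (fiber F \<omega>) (fiber G \<omega>)"
    using C1_dist_pointwise[of B "fiber F \<omega>" C "fiber G \<omega>" x] B C w x by auto
  ultimately show ?thesis by simp
qed

text \<open>The same graph serves all nearby points, since it and its image vary
  continuously.\<close>

lemma drifts_up_open:
  assumes f: "interval_cocycle X f" and X: "X = markov_chain_space N A"
    and w: "\<omega> \<in> X" and d: "drifts_up X f \<omega> x"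
  shows "\<exists>k a b. a < x \<and> x < b \<and> (\<forall>\<eta>\<in>X. \<forall>y. agree k \<eta> \<omega> \<longrightarrow> a < y \<longrightarrow> y < b \<longrightarrow> drifts_up X f \<eta> y)"
proof -
  interpret topological_markov_chain N A X by unfold_locales (rule X)
  obtain \<gamma> where g: "continuous_graph X \<gamma>" "\<forall>\<eta>\<in>X. \<gamma> \<eta> < image_graph f \<gamma> \<eta>"
     "\<gamma> \<omega> < x" "x < image_graph f \<gamma> \<omega>"
    using d unfolding drifts_up_def by blast
  have g': "continuous_graph X (image_graph f \<gamma>)" by (rule continuous_image_graph[OF f g(1)])
  define e where "e = min (x - \<gamma> \<omega>) (image_graph f \<gamma> \<omega> - x) / 2"
  have e: "e > 0" "x - \<gamma> \<omega> \<ge> 2 * e" "image_graph f \<gamma> \<omega> - x \<ge> 2 * e"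
    using g(3,4) by (auto simp: e_def)
  obtain k1 where k1: "\<forall>\<zeta>\<in>X. agree k1 \<zeta> \<omega> \<longrightarrow> \<bar>\<gamma> \<zeta> - \<gamma> \<omega>\<bar> < e"
    using g(1) w e(1) unfolding continuous_graph_iff by blast
  obtain k2 where k2: "\<forall>\<zeta>\<in>X. agree k2 \<zeta> \<omega> \<longrightarrow> \<bar>image_graph f \<gamma> \<zeta> - image_graph f \<gamma> \<omega>\<bar> < e"
    using g' w e(1) unfolding continuous_graph_iff by blast
  have "drifts_up X f \<eta> y" if n: "\<eta> \<in> X" "agree (max k1 k2) \<eta> \<omega>" and y: "x - e < y" "y < x + e" for \<eta> y
  proof -
    have "agree k1 \<eta> \<omega>" "agree k2 \<eta> \<omega>" using n(2) by (auto elim: agree_mono)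
    then have "\<bar>\<gamma> \<eta> - \<gamma> \<omega>\<bar> < e" "\<bar>image_graph f \<gamma> \<eta> - image_graph f \<gamma> \<omega>\<bar> < e" using k1 k2 n(1) by blast+
    then have "\<gamma> \<eta> < y" "y < image_graph f \<gamma> \<eta>" using y e by linarith+
    then show ?thesis unfolding drifts_up_def using g by blast
  qed
  moreover have "x - e < x" "x < x + e" using e by auto
  ultimately show ?thesis by blast
qed

section \<open>Measurability of anchored sets\<close>

context markov_shift
begin

abbreviation M :: "((int \<Rightarrow> nat) \<times> real) measure" where
  "M \<equiv> standard_measure \<mu>"

sublocale P: pair_prob_space \<mu> uniform_interval
proof -
  interpret U: prob_space uniform_interval by (rule prob_space_uniform_interval)
  show "pair_prob_space \<mu> uniform_interval" by unfold_locales
qed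

sublocale S: prob_space M
  unfolding standard_measure_def by unfold_locales

lemma space_M: "space M = X \<times> unit_interval"
  by (simp add: standard_measure_def space_pair_measure space_\<mu> space_restrict_space)

lemma sets_M_Times:
  "B \<in> sets \<mu> \<Longrightarrow> {a<..<b} \<inter> unit_interval \<in> sets uniform_interval \<and> B \<times> ({a<..<b} \<inter> unit_interval) \<in> sets M"
  unfolding standard_measure_def by (auto simp: sets_restrict_space_iff)

text \<open>The measurable sets form a product sigma-algebra, so an open set must be exhibited as a
  countable union of rectangles: a cylinder times an interval with rational ends.\<close>

lemma open_in_sets_M:
  assumes UX: "U \<subseteq> X \<times> unit_interval"
    and op: "\<And>\<omega> x. (\<omega>, x) \<in> U \<Longrightarrow>
      \<exists>k a b. a < x \<and> x < b \<and> (\<forall>\<eta>\<in>X. \<forall>y\<in>unit_interval. agree k \<eta> \<omega> \<longrightarrow> a < y \<longrightarrow> y < b \<longrightarrow> (\<eta>, y) \<in> U)"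
  shows "U \<in> sets M"
proof -
  let ?B = "\<lambda>(k, w, a, b). cylinder X k w \<times> ({real_of_rat a<..<real_of_rat b} \<inter> unit_interval)"
  let ?I = "{c. ?B c \<subseteq> U}"
  have "U \<subseteq> (\<Union>c\<in>?I. ?B c)"
  proof
    fix p assume p: "p \<in> U"
    obtain \<omega> x where px: "p = (\<omega>, x)" "\<omega> \<in> X" "x \<in> unit_interval" using UX p by blast
    obtain k a b where kab: "a < x" "x < b"
      "\<And>\<eta> y. \<eta> \<in> X \<Longrightarrow> y \<in> unit_interval \<Longrightarrow> agree k \<eta> \<omega> \<Longrightarrow> a < y \<Longrightarrow> y < b \<Longrightarrow> (\<eta>, y) \<in> U"
      using op[of \<omega> x] p px(1) by blast
    obtain a' b' where a': "a < real_of_rat a'" "real_of_rat a' < x" and b': "x < real_of_rat b'" "real_of_rat b' < b"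
      using of_rat_dense[OF kab(1)] of_rat_dense[OF kab(2)] by blast
    let ?c = "(k, map \<omega> [- int k..int k], a', b')"
    have "?B ?c \<subseteq> U" using kab(3) a' b' by (auto simp: cylinder_def agree_iff_map)
    moreover have "p \<in> ?B ?c" using px a' b' by (auto simp: cylinder_def)
    ultimately show "p \<in> (\<Union>c\<in>?I. ?B c)" by blast
  qed
  then have "U = (\<Union>c\<in>?I. ?B c)" by blast
  also have "\<dots> \<in> sets M"
    by (rule sets.countable_UN') (auto intro!: countableI_type sets_M_Times[THEN conjunct2] sets_openin openin_cylinder)
  finally show ?thesis .
qed

lemma interval_cocycle_skew: "F \<in> skew_products X \<Longrightarrow> interval_cocycle X (fiber F)"
  by (rule interval_cocycle_fiber[OF compact_X])

lemma Indiff_sets: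
  assumes F: "F \<in> skew_products X" shows "Indiff X F \<in> sets M"
proof -
  note f = interval_cocycle_skew[OF F]
  have "Up X F \<in> sets M"
  proof (rule open_in_sets_M)
    fix \<omega> x assume "(\<omega>, x) \<in> Up X F"
    then have "\<omega> \<in> X" "drifts_up X (fiber F) \<omega> x" unfolding Up_eq by auto
    from drifts_up_open[OF f X_def this]
    show "\<exists>k a b. a < x \<and> x < b \<and> (\<forall>\<eta>\<in>X. \<forall>y\<in>unit_interval. agree k \<eta> \<omega> \<longrightarrow> a < y \<longrightarrow> y < b \<longrightarrow> (\<eta>, y) \<in> Up X F)"
      unfolding Up_eq by blast
  qed (auto simp: Up_def)
  moreover have "Down X F \<in> sets M"
  proof (rule open_in_sets_M)
    fix \<omega> x assume "(\<omega>, x) \<in> Down X F"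
    then have "\<omega> \<in> X" "drifts_up X (reflect (fiber F)) \<omega> (1 - x)" unfolding Down_eq by auto
    from drifts_up_open[OF interval_cocycle_reflect[OF f] X_def this]
    obtain k a b where kab: "a < 1 - x" "1 - x < b"
      "\<And>\<eta> y. \<eta> \<in> X \<Longrightarrow> agree k \<eta> \<omega> \<Longrightarrow> a < y \<Longrightarrow> y < b \<Longrightarrow> drifts_up X (reflect (fiber F)) \<eta> y" by blast
    show "\<exists>k a b. a < x \<and> x < b \<and> (\<forall>\<eta>\<in>X. \<forall>y\<in>unit_interval. agree k \<eta> \<omega> \<longrightarrow> a < y \<longrightarrow> y < b \<longrightarrow> (\<eta>, y) \<in> Down X F)"
      unfolding Down_eq
      by (intro exI[of _ k] exI[of _ "1 - b"] exI[of _ "1 - a"]) (use kab in auto)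
  qed (auto simp: Down_def)
  ultimately show ?thesis unfolding Indiff_def space_M[symmetric] by auto
qed

lemma dense_full_set:
  obtains R where "R \<in> sets M" "measure M R = 1"
    "\<And>\<omega> x. (\<omega>, x) \<in> R \<Longrightarrow> \<omega> \<in> X \<and> dense_future \<omega> \<and> dense_past \<omega> \<and> 0 < x \<and> x < 1"
proof -
  obtain Z where Z: "{\<omega> \<in> space \<mu>. \<not> (dense_future \<omega> \<and> dense_past \<omega>)} \<subseteq> Z" "emeasure \<mu> Z = 0" "Z \<in> sets \<mu>"
    using AE_dense_orbits by (rule AE_E)
  let ?J = "{0<..<1} \<inter> unit_interval"
  have X: "X - Z \<in> sets \<mu>" using Z(3) sets.compl_sets space_\<mu> by metis
  have "emeasure \<mu> (X - Z) = 1"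
    using Z emeasure_compl[of Z \<mu>] emeasure_space_1 space_\<mu> by simp
  moreover have "emeasure uniform_interval ?J = 1"
    by (subst emeasure_restrict_space) (auto simp: Int_absorb2 subset_iff intro!: emeasure_lborel_Ioo[of 0 1, THEN trans])
  ultimately have "emeasure M ((X - Z) \<times> ?J) = 1"
    unfolding standard_measure_def
    using P.M2.emeasure_pair_measure_Times[OF X, of ?J] sets_M_Times[OF X, of 0 1] by simp
  then have "measure M ((X - Z) \<times> ?J) = 1" by (simp add: measure_def)
  moreover have "(X - Z) \<times> ?J \<in> sets M" using sets_M_Times[OF X] by blast
  ultimately show thesis using Z(1) space_\<mu> by (intro that[of "(X - Z) \<times> ?J"]) auto
qed

section \<open>Anchored sets of comparable skew products and of limits\<close>

definition thick :: "real \<Rightarrow> skew_map set" where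
  "thick c = {F \<in> skew_products X. c \<le> measure M (Indiff X F)}"

text \<open>Pairwise comparable members have anchored sets that are disjoint on a full set, and a
  probability space has no room for many disjoint sets of measure \<open>c\<close>. The index set is
  arbitrary, as monotone families and affine perturbations both use this.\<close>

lemma finite_thick_parameters:
  assumes c: "c > 0" and T: "\<And>t. t \<in> T \<Longrightarrow> \<Phi> t \<in> skew_products X"
    and comp: "\<And>s t. s \<in> T \<Longrightarrow> t \<in> T \<Longrightarrow> s \<noteq> t \<Longrightarrow> skew_less X (\<Phi> s) (\<Phi> t) \<or> skew_less X (\<Phi> t) (\<Phi> s)"
  shows "finite {t \<in> T. \<Phi> t \<in> thick c}"
proof (rule ccontr)
  assume inf: "infinite {t \<in> T. \<Phi> t \<in> thick c}"
  obtain R where R: "R \<in> sets M" "measure M R = 1"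
    "\<And>\<omega> x. (\<omega>, x) \<in> R \<Longrightarrow> \<omega> \<in> X \<and> dense_future \<omega> \<and> dense_past \<omega> \<and> 0 < x \<and> x < 1"
    by (rule dense_full_set) blast
  have disj: "Indiff X F \<inter> Indiff X G \<inter> R = {}"
    if F: "F \<in> skew_products X" and G: "G \<in> skew_products X" and less: "skew_less X F G" for F G
  proof (rule ccontr)
    assume "Indiff X F \<inter> Indiff X G \<inter> R \<noteq> {}"
    then obtain \<omega> x where p: "(\<omega>, x) \<in> Indiff X F" "(\<omega>, x) \<in> Indiff X G" "(\<omega>, x) \<in> R" by auto
    have "drifts_up X (fiber G) \<omega> x \<or> drifts_up X (reflect (fiber F)) \<omega> (1 - x)"
    proof (rule drift_dichotomy[OF interval_cocycle_skew[OF F] interval_cocycle_skew[OF G]])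
      show "fiber F \<omega> x < fiber G \<omega> x" if "\<omega> \<in> X" "x \<in> unit_interval" for \<omega> x
        using less that unfolding skew_less_def by blast
    qed (use R(3)[OF p(3)] in auto)
    then show False using p(1,2) unfolding Indiff_def Up_eq Down_eq by auto
  qed
  \<comment> \<open>So many disjoint sets of measure at least \<open>c\<close> would have total
    measure above 1.\<close>
  obtain n :: nat where n: "1 / c < real n" using reals_Archimedean2 by blast
  then have n1: "1 < real n * c" using c by (simp add: field_simps)
  obtain S where S: "finite S" "card S = n" "S \<subseteq> {t \<in> T. \<Phi> t \<in> thick c}"
    using infinite_arbitrarily_large[OF inf] by blast
  let ?I = "\<lambda>t. Indiff X (\<Phi> t) \<inter> R"
  have meas: "?I t \<in> sets M" if "t \<in> S" for t
    using that S(3) T R(1) Indiff_sets by blast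
  have AER: "AE p in M. p \<in> R" using R(1,2) S.AE_in_set_eq_1 by blast
  have "c \<le> measure M (?I t)" if "t \<in> S" for t
  proof -
    have "measure M (Indiff X (\<Phi> t)) = measure M (?I t)"
      by (rule S.finite_measure_eq_AE) (use AER that S(3) T Indiff_sets meas in auto)
    then show ?thesis using that S(3) unfolding thick_def by auto
  qed
  then have "real n * c \<le> (\<Sum>t\<in>S. measure M (?I t))"
    using sum_mono[of S "\<lambda>_. c" "\<lambda>t. measure M (?I t)"] S(2) by simp
  also have "\<dots> = measure M (\<Union>t\<in>S. ?I t)"
  proof (rule S.finite_measure_finite_Union[symmetric])
    show "disjoint_family_on ?I S" unfolding disjoint_family_on_def
    proof (intro ballI impI)
      fix s t assume "s \<in> S" "t \<in> S" "s \<noteq> t"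
      then show "?I s \<inter> ?I t = {}" using comp[of s t] T[of s] T[of t] S(3) disj by blast
    qed
  qed (use S(1) meas in auto)
  also have "\<dots> \<le> 1" by (rule S.prob_le_1)
  finally show False using n1 by simp
qed

text \<open>By compactness the graph and its image are a uniform distance apart, so the same graph
  still drifts under any uniformly close cocycle.\<close>

lemma drifts_up_persists:
  assumes f: "interval_cocycle X f" and h: "\<And>n. interval_cocycle X (h n)"
    and lim: "\<And>e. e > 0 \<Longrightarrow> \<forall>\<^sub>F n in sequentially. \<forall>\<omega>\<in>X. \<forall>x\<in>unit_interval. \<bar>h n \<omega> x - f \<omega> x\<bar> < e"
    and w: "\<omega> \<in> X" and d: "drifts_up X f \<omega> x"
  shows "\<forall>\<^sub>F n in sequentially. drifts_up X (h n) \<omega> x"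
proof -
  obtain \<gamma> where g: "continuous_graph X \<gamma>" "\<And>\<eta>. \<eta> \<in> X \<Longrightarrow> \<gamma> \<eta> < image_graph f \<gamma> \<eta>"
     "\<gamma> \<omega> < x" "x < image_graph f \<gamma> \<omega>"
    using d unfolding drifts_up_def by blast
  have g': "continuous_graph X (image_graph f \<gamma>)" by (rule continuous_image_graph[OF f g(1)])
  have "\<exists>t>0. \<forall>\<eta>\<in>X. \<gamma> \<eta> + t \<le> image_graph f \<gamma> \<eta>"
  proof (rule compact_uniform[OF compact_X])
    fix \<omega> assume w: "\<omega> \<in> X"
    define e where "e = (image_graph f \<gamma> \<omega> - \<gamma> \<omega>) / 3"
    have e: "e > 0" using g(2)[OF w] by (simp add: e_def)
    obtain k1 where k1: "\<forall>\<zeta>\<in>X. agree k1 \<zeta> \<omega> \<longrightarrow> \<bar>\<gamma> \<zeta> - \<gamma> \<omega>\<bar> < e"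
      using g(1) w e(1) unfolding continuous_graph_iff by blast
    obtain k2 where k2: "\<forall>\<zeta>\<in>X. agree k2 \<zeta> \<omega> \<longrightarrow> \<bar>image_graph f \<gamma> \<zeta> - image_graph f \<gamma> \<omega>\<bar> < e"
      using g' w e(1) unfolding continuous_graph_iff by blast
    have "\<gamma> \<eta> + e \<le> image_graph f \<gamma> \<eta>" if n: "\<eta> \<in> X" "agree (max k1 k2) \<eta> \<omega>" for \<eta>
    proof -
      have "agree k1 \<eta> \<omega>" "agree k2 \<eta> \<omega>" using n(2) by (auto elim: agree_mono)
      then have "\<bar>\<gamma> \<eta> - \<gamma> \<omega>\<bar> < e" "\<bar>image_graph f \<gamma> \<eta> - image_graph f \<gamma> \<omega>\<bar> < e" using k1 k2 n(1) by blast+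
      moreover have "image_graph f \<gamma> \<omega> - \<gamma> \<omega> = 3 * e" by (simp add: e_def)
      ultimately show ?thesis by linarith
    qed
    with e show "\<exists>k. \<exists>t>0. \<forall>\<eta>\<in>X. agree k \<eta> \<omega> \<longrightarrow> \<gamma> \<eta> + t \<le> image_graph f \<gamma> \<eta>" by blast
  qed simp
  then obtain t where t: "t > 0" "\<And>\<eta>. \<eta> \<in> X \<Longrightarrow> \<gamma> \<eta> + t \<le> image_graph f \<gamma> \<eta>" by blast
  \<comment> \<open>One tolerance for both demands: the graph keeps drifting everywhere, and its
    image over \<open>\<omega>\<close> stays above \<open>x\<close>.\<close>
  define e where "e = min t (image_graph f \<gamma> \<omega> - x)"
  have e: "e > 0" "e \<le> t" "e \<le> image_graph f \<gamma> \<omega> - x" using t(1) g(4) by (auto simp: e_def)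
  show ?thesis
  proof (rule eventually_mono[OF lim[OF e(1)]])
    fix n assume a: "\<forall>\<omega>\<in>X. \<forall>x\<in>unit_interval. \<bar>h n \<omega> x - f \<omega> x\<bar> < e"
    have close: "\<bar>image_graph (h n) \<gamma> \<eta> - image_graph f \<gamma> \<eta>\<bar> < e" if "\<eta> \<in> X" for \<eta>
    proof -
      have v: "sh (-1) \<eta> \<in> X" using that by simp
      then have "\<gamma> (sh (-1) \<eta>) \<in> unit_interval" using g(1) unfolding continuous_graph_iff by blast
      with a v show ?thesis unfolding image_graph_def by blast
    qed
    have "\<gamma> \<eta> < image_graph (h n) \<gamma> \<eta>" if "\<eta> \<in> X" for \<eta>
      using close[OF that] t(2)[OF that] e(2) by linarith
    moreover have "x < image_graph (h n) \<gamma> \<omega>" using close[OF w] e(3) by linarith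
    ultimately show "drifts_up X (h n) \<omega> x" unfolding drifts_up_def using g by blast
  qed
qed

text \<open>A point drifting under the limit drifts under all late members of the sequence. Hence
  the upper limit of the anchored sets lies in the anchored set of the limit, and its measure is at
  least \<open>c\<close> by continuity from above.\<close>

lemma closedin_thick: "closedin (skew_topology X) (thick c)"
proof -
  interpret K: Metric_space "skew_products X" "skew_dist X"
    by (rule Metric_space_skew_dist[OF compact_X X_nonempty])
  show ?thesis unfolding K.metric_closedin_iff_sequentially_closed
  proof (intro conjI allI impI)
    show "thick c \<subseteq> skew_products X" by (auto simp: thick_def)
    fix H F assume a: "range H \<subseteq> thick c \<and> limitin K.mtopology H F sequentially"
    have HS: "H n \<in> skew_products X" and Hc: "c \<le> measure M (Indiff X (H n))" for n
      using a by (auto simp: thick_def)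
    have F: "F \<in> skew_products X" using a K.limitin_mspace by blast
    note f = interval_cocycle_skew[OF F] and h = interval_cocycle_skew[OF HS]
    have lim: "\<forall>\<^sub>F n in sequentially. \<forall>\<omega>\<in>X. \<forall>x\<in>unit_interval. \<bar>fiber (H n) \<omega> x - fiber F \<omega> x\<bar> < e" if "e > 0" for e
    proof -
      have "\<forall>\<^sub>F n in sequentially. skew_dist X (H n) F < e"
        using a that unfolding K.limitin_metric by (auto elim: eventually_mono)
      then show ?thesis
      proof (rule eventually_mono)
        fix n assume "skew_dist X (H n) F < e"
        then show "\<forall>\<omega>\<in>X. \<forall>x\<in>unit_interval. \<bar>fiber (H n) \<omega> x - fiber F \<omega> x\<bar> < e"
          using fiber_diff_le_skew_dist[OF compact_X HS F] by (meson le_less_trans)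
      qed
    qed
    have lim': "\<forall>\<^sub>F n in sequentially. \<forall>\<omega>\<in>X. \<forall>x\<in>unit_interval.
        \<bar>reflect (fiber (H n)) \<omega> x - reflect (fiber F) \<omega> x\<bar> < e" if "e > 0" for e
    proof (rule eventually_mono[OF lim[OF that]], intro ballI)
      fix n \<omega> x assume l: "\<forall>\<omega>\<in>X. \<forall>x\<in>unit_interval. \<bar>fiber (H n) \<omega> x - fiber F \<omega> x\<bar> < e"
        and w: "\<omega> \<in> X" and x: "x \<in> unit_interval"
      have "1 - x \<in> unit_interval" using x by auto
      with l w have "\<bar>fiber (H n) \<omega> (1 - x) - fiber F \<omega> (1 - x)\<bar> < e" by blast
      then show "\<bar>reflect (fiber (H n)) \<omega> x - reflect (fiber F) \<omega> x\<bar> < e"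
        by (simp add: reflect_def abs_minus_commute)
    qed
    let ?I = "\<lambda>n. Indiff X (H n)"
    let ?U = "\<lambda>m. \<Union>n\<in>{m..}. ?I n"
    have meas: "?U m \<in> sets M" for m using Indiff_sets[OF HS] by (intro sets.countable_UN') auto
    have sub: "(\<Inter>m. ?U m) \<subseteq> Indiff X F"
    proof (rule subsetI, rule ccontr)
      fix p assume p: "p \<in> (\<Inter>m. ?U m)" "p \<notin> Indiff X F"
      obtain \<omega> x where px: "p = (\<omega>, x)" "\<omega> \<in> X" "x \<in> unit_interval"
        using p(1) by (auto simp: Indiff_def)
      have "drifts_up X (fiber F) \<omega> x \<or> drifts_up X (reflect (fiber F)) \<omega> (1 - x)"
        using p(2) px by (auto simp: Indiff_def Up_eq Down_eq)
      then have "\<forall>\<^sub>F n in sequentially. drifts_up X (fiber (H n)) \<omega> x \<or> drifts_up X (reflect (fiber (H n))) \<omega> (1 - x)"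
      proof
        assume "drifts_up X (fiber F) \<omega> x"
        from drifts_up_persists[OF f h lim px(2) this] show ?thesis by (auto elim: eventually_mono)
      next
        assume "drifts_up X (reflect (fiber F)) \<omega> (1 - x)"
        from drifts_up_persists[OF interval_cocycle_reflect[OF f] interval_cocycle_reflect[OF h] lim' px(2) this]
        show ?thesis by (auto elim: eventually_mono)
      qed
      then obtain m where "\<And>n. n \<ge> m \<Longrightarrow> drifts_up X (fiber (H n)) \<omega> x \<or> drifts_up X (reflect (fiber (H n))) \<omega> (1 - x)"
        unfolding eventually_sequentially by blast
      then have "p \<notin> ?U m" using px by (auto simp: Indiff_def Up_eq Down_eq)
      with p(1) show False by blast
    qed
    have "(\<lambda>m. measure M (?U m)) \<longlonglongrightarrow> measure M (\<Inter>m. ?U m)"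
    proof (rule S.finite_Lim_measure_decseq)
      show "decseq ?U" unfolding decseq_def by fastforce
    qed (use meas in auto)
    moreover have "c \<le> measure M (?U m)" for m
    proof -
      have "measure M (?I m) \<le> measure M (?U m)" by (rule S.finite_measure_mono) (use meas in auto)
      then show ?thesis using Hc[of m] by linarith
    qed
    ultimately have "c \<le> measure M (\<Inter>m. ?U m)" by (intro LIMSEQ_le_const) auto
    also have "\<dots> \<le> measure M (Indiff X F)" by (rule S.finite_measure_mono[OF sub Indiff_sets[OF F]])
    finally show "F \<in> thick c" using F by (simp add: thick_def)
  qed
qed

end


section \<open>Affine perturbations\<close>

lemma expanding_inverse:
  fixes L D :: "real \<Rightarrow> real"
  assumes der: "\<And>x. (L has_real_derivative D x) (at x)" and c: "c > 0" "\<And>x. c \<le> D x"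
  shows "inj L" "L (inv L y) = y" "\<bar>inv L y - inv L z\<bar> \<le> \<bar>y - z\<bar> / c"
    "(inv L has_real_derivative inverse (D (inv L y))) (at y)"
proof -
  have exp1: "c * (b - a) \<le> L b - L a" if ab: "a < b" for a b
  proof -
    obtain z where "L b - L a = (b - a) * D z" using MVT2[of a b L D] ab der by blast
    with c(2)[of z] ab show ?thesis by (simp add: mult.commute mult_left_mono)
  qed
  have exp: "c * \<bar>b - a\<bar> \<le> \<bar>L b - L a\<bar>" for a b
    using exp1[of a b] exp1[of b a] by (cases a b rule: linorder_cases) auto
  show inj: "inj L"
  proof (rule injI)
    fix a b assume "L a = L b"
    with exp[of b a] c(1) show "a = b" by (simp add: mult_le_0_iff)
  qed
  have cont: "continuous_on S L" for S
    by (meson DERIV_isCont continuous_at_imp_continuous_on der)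
  have "surj L"
    unfolding surj_def
  proof
    fix y
    \<comment> \<open>Growth at rate at least \<open>c\<close> on either side of 0 then brackets
      \<open>y\<close> between the values at \<open>- r\<close> and \<open>r\<close>.\<close>
    define r where "r = (\<bar>y\<bar> + \<bar>L 0\<bar> + 1) / c"
    have r: "0 < r" "c * r = \<bar>y\<bar> + \<bar>L 0\<bar> + 1" using c(1) by (auto simp: r_def)
    have "L (- r) \<le> y" "y \<le> L r" using exp1[of 0 r] exp1[of "- r" 0] r by auto
    then show "\<exists>x. y = L x" using IVT'[of L "- r" y r] cont r by force
  qed
  then have L_inv: "L (inv L y) = y" for y by (rule surj_f_inv_f)
  then show "L (inv L y) = y" .
  have lip: "\<bar>inv L y - inv L z\<bar> \<le> \<bar>y - z\<bar> / c" for y z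
    using exp[of "inv L y" "inv L z"] c(1) by (simp add: L_inv field_simps)
  then show "\<bar>inv L y - inv L z\<bar> \<le> \<bar>y - z\<bar> / c" .
  have "(1 / c)-lipschitz_on UNIV (inv L)"
    using lip c(1) by (auto intro!: lipschitz_onI simp: dist_real_def)
  then have isc: "isCont (inv L) y" for y
    using lipschitz_on_continuous_on continuous_on_eq_continuous_at[OF open_UNIV] by blast
  show "(inv L has_real_derivative inverse (D (inv L y))) (at y)"
  proof (rule DERIV_inverse_function[OF der, where a = "y - 1" and b = "y + 1"])
    show "D (inv L y) \<noteq> 0" using c(2)[of "inv L y"] c(1) by linarith
  qed (simp_all add: L_inv isc)
qed

lemma affine_unit_deriv:
  assumes f: "C1_on unit_interval f" and g: "\<forall>x\<in>unit_interval. g x = \<alpha> + \<beta> * f x"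
    and x: "x \<in> unit_interval"
  shows "(g has_real_derivative \<beta> * unit_deriv f x) (at x within unit_interval)"
    "unit_deriv g x = \<beta> * unit_deriv f x"
proof -
  have "((\<lambda>x. \<alpha> + \<beta> * f x) has_real_derivative \<beta> * unit_deriv f x) (at x within unit_interval)"
    using C1_on_unit_deriv(1)[OF f x] by (auto intro!: derivative_eq_intros)
  then show d: "(g has_real_derivative \<beta> * unit_deriv f x) (at x within unit_interval)"
    by (rule has_field_derivative_transform_within[where d = 1]) (use x g in auto)
  then show "unit_deriv g x = \<beta> * unit_deriv f x"
    using x vector_derivative_within_cbox[of 0 1 x g "\<beta> * unit_deriv f x"]
    by (simp add: has_real_derivative_iff_has_vector_derivative)
qed

lemma affine_linear_extension:
  assumes f: "C1_on unit_interval f" and g: "\<forall>x\<in>unit_interval. g x = \<alpha> + \<beta> * f x"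
  shows "linear_extension g x = \<alpha> + \<beta> * linear_extension f x"
proof -
  let ?c = "max 0 (min 1 x)"
  have c: "?c \<in> unit_interval" by auto
  show ?thesis unfolding linear_extension_def Let_def
    by (simp add: bspec[OF g c] affine_unit_deriv(2)[OF f g c] algebra_simps)
qed

text \<open>The inverse is that of \<open>f\<close> after \<open>(y - \<alpha>) / \<beta>\<close>,
  so smoothness on the new image follows from the chain rule.\<close>

lemma affine_C1_diffeo:
  assumes f: "C1_diffeo_onto_image f" and g: "\<forall>x\<in>unit_interval. g x = \<alpha> + \<beta> * f x"
    and \<beta>: "\<beta> > 0"
  shows "C1_diffeo_onto_image g"
proof -
  let ?I = unit_interval and ?s = "\<lambda>y. (y - \<alpha>) / \<beta>"
  have c1: "C1_on ?I f" and inj: "inj_on f ?I" and c2: "C1_on (f ` ?I) (inv_into ?I f)"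
    using f unfolding C1_diffeo_onto_image_def by auto
  have "C1_on ?I g" unfolding C1_on_def
    by (intro exI[of _ "\<lambda>x. \<beta> * unit_deriv f x"] conjI ballI affine_unit_deriv(1)[OF c1 g]
        continuous_intros C1_on_unit_deriv(2)[OF c1])
  moreover have injg: "inj_on g ?I" using inj g \<beta> by (auto simp: inj_on_def)
  moreover have "C1_on (g ` ?I) (inv_into ?I g)"
  proof -
    obtain u' where u': "\<And>y. y \<in> f ` ?I \<Longrightarrow> (inv_into ?I f has_real_derivative u' y) (at y within f ` ?I)"
      and cu: "continuous_on (f ` ?I) u'"
      using c2 unfolding C1_on_def by blast
    have s: "?s (g x) = f x" if "x \<in> ?I" for x using bspec[OF g that] \<beta> by simp
    have im: "?s ` g ` ?I = f ` ?I" using s unfolding image_image by (intro image_cong) auto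
    have eq: "inv_into ?I g y = inv_into ?I f (?s y)" if y: "y \<in> g ` ?I" for y
    proof -
      obtain x where x: "x \<in> ?I" "y = g x" using y by blast
      then have "inv_into ?I g y = x" using injg by simp
      moreover have "inv_into ?I f (?s y) = x" using x s[OF x(1)] inj by simp
      ultimately show ?thesis by simp
    qed
    show ?thesis unfolding C1_on_def
    proof (intro exI[of _ "\<lambda>y. u' (?s y) * (1 / \<beta>)"] conjI ballI)
      fix y assume y: "y \<in> g ` ?I"
      then have "?s y \<in> f ` ?I" using im by blast
      then have "(inv_into ?I f has_real_derivative u' (?s y)) (at (?s y) within ?s ` g ` ?I)"
        unfolding im by (rule u')
      moreover have "(?s has_real_derivative 1 / \<beta>) (at y within g ` ?I)"
        using \<beta> by (auto intro!: derivative_eq_intros)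
      ultimately have "(inv_into ?I f \<circ> ?s has_real_derivative u' (?s y) * (1 / \<beta>)) (at y within g ` ?I)"
        by (rule DERIV_image_chain)
      then show "(inv_into ?I g has_real_derivative u' (?s y) * (1 / \<beta>)) (at y within g ` ?I)"
        by (rule has_field_derivative_transform_within[where d = 1]) (use y eq in auto)
    next
      have "continuous_on (g ` ?I) (\<lambda>y. u' (?s y))"
        by (rule continuous_on_compose2[OF cu]) (use im \<beta> in \<open>auto intro!: continuous_intros\<close>)
      then show "continuous_on (g ` ?I) (\<lambda>y. u' (?s y) * (1 / \<beta>))" by (intro continuous_intros)
    qed
  qed
  ultimately show ?thesis unfolding C1_diffeo_onto_image_def by blast
qed

text \<open>The extensions are affinely related, so their inverses differ by precomposition with
  \<open>(y - \<alpha>) / \<beta>\<close>, which moves points of the unit interval by at most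
  \<open>2 * s\<close>. The first term is the change of the reciprocal derivative;
  \<open>2 * s / c\<close> bounds the displacement of the inverse as well as the effect of the
  factor \<open>1 / \<beta>\<close>.\<close>

lemma affine_C1_dist_inverse_le:
  assumes f: "C1_on unit_interval f" and g: "\<forall>x\<in>unit_interval. g x = \<alpha> + \<beta> * f x"
    and \<beta>: "1 / 2 \<le> \<beta>" and s: "\<bar>\<alpha>\<bar> + \<bar>1 - \<beta>\<bar> \<le> s"
    and c: "c > 0" "\<forall>x\<in>unit_interval. c \<le> unit_deriv f x"
    and t: "2 * s / c < t" "\<forall>x\<in>unit_interval. \<forall>y\<in>unit_interval. \<bar>x - y\<bar> < t \<longrightarrow>
      \<bar>unit_deriv f x - unit_deriv f y\<bar> \<le> e"
  shows "C1_dist_inverse f g \<le> e / c\<^sup>2 + 2 * s / c"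
proof -
  let ?L = "linear_extension f" and ?K = "linear_extension g"
  let ?cl = "\<lambda>x::real. max 0 (min 1 x)"
  let ?D = "\<lambda>x. unit_deriv f (?cl x)" and ?s = "\<lambda>y. (y - \<alpha>) / \<beta>"
  have D: "c \<le> ?D x" for x by (rule bspec[OF c(2)]) auto
  note L = expanding_inverse[OF DERIV_linear_extension[OF f] c(1) D]
  \<comment> \<open>Read off from the modulus of continuity at two equal points.\<close>
  have e0: "0 \<le> e" 
  proof -
    have "0 \<le> 2 * s / c" using s c(1) by (intro divide_nonneg_pos) linarith+
    then show ?thesis using bspec[OF bspec[OF t(2), of 0], of 0] t(1) by simp
  qed
  have K: "?K x = \<alpha> + \<beta> * ?L x" for x by (rule affine_linear_extension[OF f g])
  have injK: "inj ?K" using L(1) \<beta> unfolding K inj_def by auto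
  have invK: "inv ?K y = inv ?L (?s y)" for y
    by (rule inv_f_eq[OF injK]) (use \<beta> in \<open>simp add: K L(2)\<close>)
  have derK: "(inv ?K has_real_derivative inverse (?D (inv ?L (?s y))) * (1 / \<beta>)) (at y)" for y
  proof -
    have "(?s has_real_derivative 1 / \<beta>) (at y)" using \<beta> by (auto intro!: derivative_eq_intros)
    from DERIV_chain2[OF L(4)[of "?s y"] this] show ?thesis unfolding invK by simp
  qed
  show ?thesis unfolding C1_dist_inverse_def
  proof (rule C1_dist_leI)
    fix y :: real assume y: "y \<in> unit_interval"
    let ?a = "inv ?L y" and ?b = "inv ?L (?s y)"
    have d1: "unit_deriv (inv ?L) y = inverse (?D ?a)"
      using L(4)[of y] y
      by (intro vector_derivative_at_within_ivl) (auto simp: has_real_derivative_iff_has_vector_derivative)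
    have d2: "unit_deriv (inv ?K) y = inverse (?D ?b) * (1 / \<beta>)"
      using derK[of y] y
      by (intro vector_derivative_at_within_ivl) (auto simp: has_real_derivative_iff_has_vector_derivative)
    have \<beta>2: "1 / \<beta> \<le> 2" "0 < \<beta>" using \<beta> by (auto simp: field_simps)
    have s0: "0 \<le> s" using s by linarith
    have "\<bar>(1 - \<beta>) * y\<bar> \<le> \<bar>1 - \<beta>\<bar>" using y by (simp add: abs_mult mult_left_le)
    then have num: "\<bar>(1 - \<beta>) * y - \<alpha>\<bar> \<le> s" using s by linarith
    have \<beta>abs: "\<bar>- (1 / \<beta>)\<bar> = 1 / \<beta>" using \<beta>2(2) by simp
    have "y - ?s y = ((1 - \<beta>) * y - \<alpha>) * (- (1 / \<beta>))" using \<beta>2(2) by (simp add: field_simps)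
    then have "\<bar>y - ?s y\<bar> = \<bar>(1 - \<beta>) * y - \<alpha>\<bar> * (1 / \<beta>)" by (simp only: abs_mult \<beta>abs)
    also have "\<dots> \<le> s * 2" by (rule mult_mono[OF num \<beta>2(1) s0]) (use \<beta>2 in auto)
    finally have ys: "\<bar>y - ?s y\<bar> \<le> 2 * s" by simp
    have ab: "\<bar>?a - ?b\<bar> \<le> 2 * s / c"
      using order_trans[OF L(3)[of y "?s y"] divide_right_mono[OF ys]] c(1) by simp
    \<comment> \<open>The inverse may take values outside the unit interval. Clamping does not
      increase distances, so the modulus of continuity on the interval still applies.\<close>
    have "\<bar>?cl ?a - ?cl ?b\<bar> \<le> \<bar>?a - ?b\<bar>" by auto
    with ab t(1) have DD: "\<bar>?D ?a - ?D ?b\<bar> \<le> e" by (intro t(2)[rule_format]) auto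
    have Dp: "0 < ?D ?a" "0 < ?D ?b" using D[of ?a] D[of ?b] c(1) by linarith+
    have i1: "\<bar>inverse (?D ?a) - inverse (?D ?b)\<bar> \<le> e / c\<^sup>2"
    proof -
      have "\<bar>inverse (?D ?a) - inverse (?D ?b)\<bar> = \<bar>?D ?a - ?D ?b\<bar> / (?D ?a * ?D ?b)"
        using Dp by (simp add: inverse_diff_inverse abs_mult abs_minus_commute divide_inverse)
      also have "\<dots> \<le> e / (c * c)"
        using DD e0 c(1) Dp by (intro frac_le mult_mono D mult_pos_pos) auto
      finally show ?thesis by (simp add: power2_eq_square)
    qed
    have "1 - 1 / \<beta> = (1 - \<beta>) * (- (1 / \<beta>))" using \<beta>2(2) by (simp add: field_simps)
    then have "\<bar>1 - 1 / \<beta>\<bar> = \<bar>1 - \<beta>\<bar> * (1 / \<beta>)" by (simp only: abs_mult \<beta>abs)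
    also have "\<dots> \<le> s * 2" by (rule mult_mono[OF _ \<beta>2(1) s0]) (use \<beta>2 s in auto)
    finally have i2: "\<bar>1 - 1 / \<beta>\<bar> \<le> 2 * s" by simp
    have "inverse (?D ?b) \<le> 1 / c" using D[of ?b] c(1) Dp(2) by (simp add: field_simps)
    then have "inverse (?D ?b) * \<bar>1 - 1 / \<beta>\<bar> \<le> 1 / c * (2 * s)"
      using i2 c(1) by (intro mult_mono) auto
    moreover have "\<bar>inverse (?D ?b) - inverse (?D ?b) * (1 / \<beta>)\<bar> = inverse (?D ?b) * \<bar>1 - 1 / \<beta>\<bar>"
    proof -
      have "inverse (?D ?b) - inverse (?D ?b) * (1 / \<beta>) = inverse (?D ?b) * (1 - 1 / \<beta>)"
        by (simp only: right_diff_distrib mult_1_right)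
      moreover have "\<bar>inverse (?D ?b)\<bar> = inverse (?D ?b)" using Dp(2) by simp
      ultimately show ?thesis by (simp only: abs_mult)
    qed
    moreover have "1 / c * (2 * s) = 2 * s / c" by simp
    ultimately have i3: "\<bar>inverse (?D ?b) - inverse (?D ?b) * (1 / \<beta>)\<bar> \<le> 2 * s / c" by (simp only:)
    have "\<bar>p - w\<bar> \<le> u + v" if "\<bar>p - q\<bar> \<le> u" "\<bar>q - w\<bar> \<le> v" for p q w u v :: real
      using that by linarith
    from this[OF i1 i3]
    have "\<bar>inverse (?D ?a) - inverse (?D ?b) * (1 / \<beta>)\<bar> \<le> e / c\<^sup>2 + 2 * s / c" .
    moreover have "0 \<le> e / c\<^sup>2" using e0 by simp
    then have "\<bar>?a - ?b\<bar> \<le> e / c\<^sup>2 + 2 * s / c" using ab by linarith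
    ultimately show "max \<bar>inv ?L y - inv ?K y\<bar> \<bar>unit_deriv (inv ?L) y - unit_deriv (inv ?K) y\<bar> \<le> e / c\<^sup>2 + 2 * s / c"
      unfolding d1 d2 invK[of y] by (intro max.boundedI)
  qed
qed

definition affine_skew :: "(int \<Rightarrow> nat) set \<Rightarrow> real \<Rightarrow> real \<Rightarrow> skew_map \<Rightarrow> skew_map" where
  "affine_skew X \<alpha> \<beta> F = restrict (\<lambda>(\<omega>, x). (left_shift \<omega>, \<alpha> + \<beta> * fiber F \<omega> x)) (X \<times> unit_interval)"

lemma fiber_affine_skew:
  "\<omega> \<in> X \<Longrightarrow> x \<in> unit_interval \<Longrightarrow> fiber (affine_skew X \<alpha> \<beta> F) \<omega> x = \<alpha> + \<beta> * fiber F \<omega> x"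
  by (simp add: fiber_def affine_skew_def)

text \<open>The hypotheses force \<open>\<beta> \<le> 1\<close>. Differences of fibers and of their
  derivatives are multiplied by \<open>\<beta>\<close>, so continuity in the base is
  inherited.\<close>

lemma affine_skew_in:
  assumes F: "F \<in> skew_products X" and ab: "0 \<le> \<alpha>" "0 < \<beta>" "\<alpha> + \<beta> \<le> 1"
  shows "affine_skew X \<alpha> \<beta> F \<in> skew_products X"
proof -
  let ?G = "affine_skew X \<alpha> \<beta> F"
  have g: "fiber ?G \<omega> x = \<alpha> + \<beta> * fiber F \<omega> x" if "\<omega> \<in> X" "x \<in> unit_interval" for \<omega> x
    using that by (rule fiber_affine_skew)
  have "\<alpha> + \<beta> * z \<in> unit_interval" if "z \<in> unit_interval" for z
  proof -
    have "\<beta> * z \<le> \<beta> * 1" "0 \<le> \<beta> * z" using that ab(2) by (auto intro: mult_left_mono)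
    then have "0 \<le> \<alpha> + \<beta> * z" "\<alpha> + \<beta> * z \<le> 1" using ab by linarith+
    then show ?thesis by simp
  qed
  then have "fiber ?G \<omega> ` unit_interval \<subseteq> unit_interval" if "\<omega> \<in> X" for \<omega>
    using skew_productsD(1)[OF F that] g[OF that] by (auto simp: image_subset_iff)
  moreover have g': "\<forall>x\<in>unit_interval. fiber ?G \<omega> x = \<alpha> + \<beta> * fiber F \<omega> x" if "\<omega> \<in> X" for \<omega>
    using g[OF that] by blast
  moreover have "C1_diffeo_onto_image (fiber ?G \<omega>)" if "\<omega> \<in> X" for \<omega>
    by (rule affine_C1_diffeo[OF skew_productsD(2)[OF F that] g'[OF that] ab(2)])
  moreover have "strict_mono_on unit_interval (fiber ?G \<omega>)" if "\<omega> \<in> X" for \<omega>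
    using strict_mono_onD[OF skew_productsD(3)[OF F that]] g[OF that] ab(2)
    by (intro strict_mono_onI) simp
  moreover have "\<exists>\<delta>>0. \<forall>\<eta>\<in>X. shift_dist \<eta> \<omega> < \<delta> \<longrightarrow> C1_dist (fiber ?G \<eta>) (fiber ?G \<omega>) < \<epsilon>"
    if w: "\<omega> \<in> X" and e: "\<epsilon> > 0" for \<omega> \<epsilon>
  proof -
    obtain \<delta> where \<delta>: "\<delta> > 0" "\<And>\<eta>. \<eta> \<in> X \<Longrightarrow> shift_dist \<eta> \<omega> < \<delta> \<Longrightarrow> C1_dist (fiber F \<eta>) (fiber F \<omega>) < \<epsilon>"
      using skew_productsD(5)[OF F w e] by blast
    have "C1_dist (fiber ?G \<eta>) (fiber ?G \<omega>) < \<epsilon>" if n: "\<eta> \<in> X" "shift_dist \<eta> \<omega> < \<delta>" for \<eta>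
    proof -
      note c1 = skew_productsD(4)[OF F]
      obtain B C where BC: "C1_bounded B (fiber F \<eta>)" "C1_bounded C (fiber F \<omega>)"
        using C1_on_bounded c1 w n(1) by meson
      have "C1_dist (fiber ?G \<eta>) (fiber ?G \<omega>) \<le> C1_dist (fiber F \<eta>) (fiber F \<omega>)"
      proof (rule C1_dist_leI)
        fix x :: real assume x: "x \<in> unit_interval"
        let ?p = "fiber F \<eta> x - fiber F \<omega> x" and ?q = "unit_deriv (fiber F \<eta>) x - unit_deriv (fiber F \<omega>) x"
        have "fiber ?G \<eta> x - fiber ?G \<omega> x = \<beta> * ?p"
          using g[OF n(1) x] g[OF w x] by (simp add: algebra_simps)
        moreover have "unit_deriv (fiber ?G \<eta>) x - unit_deriv (fiber ?G \<omega>) x = \<beta> * ?q"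
          using affine_unit_deriv(2)[OF c1[OF n(1)] g'[OF n(1)] x] affine_unit_deriv(2)[OF c1[OF w] g'[OF w] x]
          by (simp add: algebra_simps)
        moreover have "\<bar>\<beta> * z\<bar> \<le> \<bar>z\<bar>" for z using ab by (simp add: abs_mult mult_left_le_one_le)
        ultimately have "\<bar>fiber ?G \<eta> x - fiber ?G \<omega> x\<bar> \<le> \<bar>?p\<bar>"
          "\<bar>unit_deriv (fiber ?G \<eta>) x - unit_deriv (fiber ?G \<omega>) x\<bar> \<le> \<bar>?q\<bar>" by metis+
        then show "max \<bar>fiber ?G \<eta> x - fiber ?G \<omega> x\<bar> \<bar>unit_deriv (fiber ?G \<eta>) x - unit_deriv (fiber ?G \<omega>) x\<bar>
            \<le> C1_dist (fiber F \<eta>) (fiber F \<omega>)"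
          using C1_dist_pointwise[OF BC x] by linarith
      qed
      then show ?thesis using \<delta>(2)[OF n] by simp
    qed
    then show ?thesis using \<delta>(1) by blast
  qed
  ultimately show ?thesis unfolding skew_products_def by (auto simp: affine_skew_def)
qed

context topological_markov_chain
begin

lemma uniform_deriv_lower_bound:
  assumes F: "F \<in> skew_products X"
  shows "\<exists>c>0. \<forall>\<omega>\<in>X. \<forall>x\<in>unit_interval. c \<le> unit_deriv (fiber F \<omega>) x"
proof (rule compact_uniform[OF compact_X])
  fix \<omega> assume w: "\<omega> \<in> X"
  let ?h = "unit_deriv (fiber F \<omega>)"
  obtain z where z: "z \<in> unit_interval" "\<And>x. x \<in> unit_interval \<Longrightarrow> ?h z \<le> ?h x"
    using continuous_attains_inf[of unit_interval ?h] C1_on_unit_deriv(2)[OF skew_productsD(4)[OF F w]] by auto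
  have pos: "0 < ?h z" by (rule unit_deriv_pos[OF skew_productsD(2,3)[OF F w] z(1)])
  obtain k where k: "\<And>\<eta> x. \<eta> \<in> X \<Longrightarrow> agree k \<eta> \<omega> \<Longrightarrow> x \<in> unit_interval \<Longrightarrow>
      \<bar>unit_deriv (fiber F \<eta>) x - ?h x\<bar> < ?h z / 2"
    using skew_products_C1_cont[OF F w half_gt_zero[OF pos]] by blast
  have "?h z / 2 \<le> unit_deriv (fiber F \<eta>) x" if "\<eta> \<in> X" "agree k \<eta> \<omega>" "x \<in> unit_interval" for \<eta> x
    using k[OF that] z(2)[OF that(3)] by linarith
  then show "\<exists>k. \<exists>t>0. \<forall>\<eta>\<in>X. agree k \<eta> \<omega> \<longrightarrow> (\<forall>x\<in>unit_interval. t \<le> unit_deriv (fiber F \<eta>) x)"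
    using half_gt_zero[OF pos] by blast
qed force

text \<open>Comparing inverses means comparing derivatives of one fiber map at two nearby points,
  which needs a modulus of continuity common to all fibers.\<close>

lemma equicontinuous_deriv:
  assumes F: "F \<in> skew_products X" and e: "e > 0"
  shows "\<exists>t>0. \<forall>\<omega>\<in>X. \<forall>x\<in>unit_interval. \<forall>y\<in>unit_interval. \<bar>x - y\<bar> < t \<longrightarrow>
    \<bar>unit_deriv (fiber F \<omega>) x - unit_deriv (fiber F \<omega>) y\<bar> \<le> e"
proof (rule compact_uniform[OF compact_X])
  fix \<omega> assume w: "\<omega> \<in> X"
  let ?h = "unit_deriv (fiber F \<omega>)"
  have "uniformly_continuous_on unit_interval ?h"
    by (rule compact_uniformly_continuous[OF C1_on_unit_deriv(2)[OF skew_productsD(4)[OF F w]]]) simp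
  then obtain t where t: "t > 0"
    "\<And>x y. x \<in> unit_interval \<Longrightarrow> y \<in> unit_interval \<Longrightarrow> \<bar>x - y\<bar> < t \<Longrightarrow> \<bar>?h x - ?h y\<bar> < e / 3"
    using e unfolding uniformly_continuous_on_def dist_real_def by (metis divide_pos_pos zero_less_numeral)
  have "e / 3 > 0" using e by simp
  then obtain k where k: "\<And>\<eta> x. \<eta> \<in> X \<Longrightarrow> agree k \<eta> \<omega> \<Longrightarrow> x \<in> unit_interval \<Longrightarrow>
      \<bar>unit_deriv (fiber F \<eta>) x - ?h x\<bar> < e / 3"
    using skew_products_C1_cont[OF F w] by blast
  have "\<bar>unit_deriv (fiber F \<eta>) x - unit_deriv (fiber F \<eta>) y\<bar> \<le> e"
    if n: "\<eta> \<in> X" "agree k \<eta> \<omega>" and xy: "x \<in> unit_interval" "y \<in> unit_interval" "\<bar>x - y\<bar> < t" for \<eta> x y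
  proof -
    have "\<bar>p' - q'\<bar> \<le> e" if "\<bar>p' - p\<bar> < e / 3" "\<bar>q' - q\<bar> < e / 3" "\<bar>p - q\<bar> < e / 3" for p p' q q'
      using that by linarith
    from this[OF k[OF n xy(1)] k[OF n xy(2)] t(2)[OF xy]] show ?thesis .
  qed
  then show "\<exists>k. \<exists>t>0. \<forall>\<eta>\<in>X. agree k \<eta> \<omega> \<longrightarrow> (\<forall>x\<in>unit_interval. \<forall>y\<in>unit_interval. \<bar>x - y\<bar> < t \<longrightarrow>
      \<bar>unit_deriv (fiber F \<eta>) x - unit_deriv (fiber F \<eta>) y\<bar> \<le> e)"
    using t(1) by blast
qed force

lemma affine_skew_close:
  assumes F: "F \<in> skew_products X" and ne: "X \<noteq> {}" and r: "r > 0"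
  shows "\<exists>d>0. \<forall>\<alpha> \<beta>. 0 \<le> \<alpha> \<longrightarrow> 1 / 2 \<le> \<beta> \<longrightarrow> \<alpha> + \<beta> \<le> 1 \<longrightarrow> \<bar>\<alpha>\<bar> + \<bar>1 - \<beta>\<bar> \<le> d \<longrightarrow>
    skew_dist X F (affine_skew X \<alpha> \<beta> F) < r"
proof -
  obtain c where c: "c > 0" "\<And>\<omega>. \<omega> \<in> X \<Longrightarrow> \<forall>x\<in>unit_interval. c \<le> unit_deriv (fiber F \<omega>) x"
    using uniform_deriv_lower_bound[OF F] by blast
  obtain B where B: "\<And>\<omega>. \<omega> \<in> X \<Longrightarrow> C1_bounded B (fiber F \<omega>)"
    using skew_products_uniform_bounds[OF compact_X F] by blast
  define e where "e = c\<^sup>2 * (r / 4)"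
  have e: "e > 0" "e / c\<^sup>2 = r / 4" using c(1) r by (auto simp: e_def)
  obtain t where t: "t > 0" "\<And>\<omega>. \<omega> \<in> X \<Longrightarrow> \<forall>x\<in>unit_interval. \<forall>y\<in>unit_interval. \<bar>x - y\<bar> < t \<longrightarrow>
      \<bar>unit_deriv (fiber F \<omega>) x - unit_deriv (fiber F \<omega>) y\<bar> \<le> e"
    using equicontinuous_deriv[OF F e(1)] by blast
  define b where "b = \<bar>B\<bar> + 1"
  have b: "b \<ge> 1" by (simp add: b_def)
  \<comment> \<open>The three bounds serve, in order, \<open>2 * d / c < t\<close> for the modulus
    of continuity, \<open>2 * d / c \<le> r / 4\<close> for the inverses and
    \<open>d * b \<le> r / 2\<close> for the maps and their derivatives.\<close>
  define d where "d = min (c * t / 4) (min (c * r / 8) (r / (2 * b)))"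
  have d: "d > 0" using c(1) t(1) r b by (simp add: d_def)
  have dt: "2 * d / c < t"
  proof -
    have "2 * d \<le> 2 * (c * t / 4)" unfolding d_def by (intro mult_left_mono min.cobounded1) simp
    also have "\<dots> < c * t" using c(1) t(1) by simp
    finally show ?thesis using c(1) by (simp add: field_simps)
  qed
  have "d \<le> c * r / 8" by (simp add: d_def)
  then have dr: "2 * d / c \<le> r / 4" using c(1) by (simp add: field_simps)
  have "d \<le> r / (2 * b)" by (simp add: d_def)
  then have db: "d * b \<le> r / 2" using b by (simp add: field_simps)
  have "skew_dist X F (affine_skew X \<alpha> \<beta> F) < r"
    if ab: "0 \<le> \<alpha>" "1 / 2 \<le> \<beta>" "\<alpha> + \<beta> \<le> 1" and s: "\<bar>\<alpha>\<bar> + \<bar>1 - \<beta>\<bar> \<le> d" for \<alpha> \<beta>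
  proof -
    let ?G = "affine_skew X \<alpha> \<beta> F"
    have G: "?G \<in> skew_products X" by (rule affine_skew_in[OF F]) (use ab in auto)
    \<comment> \<open>The bound is \<open>r / 2\<close> because a supremum of values below
      \<open>r\<close> could equal \<open>r\<close>.\<close>
    have "max (C1_dist (fiber F \<omega>) (fiber ?G \<omega>)) (C1_dist_inverse (fiber F \<omega>) (fiber ?G \<omega>)) \<le> r / 2"
      if w: "\<omega> \<in> X" for \<omega>
    proof -
      have g: "\<forall>x\<in>unit_interval. fiber ?G \<omega> x = \<alpha> + \<beta> * fiber F \<omega> x"
        using fiber_affine_skew[OF w] by blast
      note c1 = skew_productsD(4)[OF F w]
      have "C1_dist_inverse (fiber F \<omega>) (fiber ?G \<omega>) \<le> e / c\<^sup>2 + 2 * d / c"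
        by (rule affine_C1_dist_inverse_le[OF c1 g ab(2) s c(1) c(2)[OF w] dt t(2)[OF w]])
      then have "C1_dist_inverse (fiber F \<omega>) (fiber ?G \<omega>) \<le> r / 2" using e(2) dr by linarith
      moreover have "C1_dist (fiber F \<omega>) (fiber ?G \<omega>) \<le> r / 2"
      proof (rule C1_dist_leI)
        fix x :: real assume x: "x \<in> unit_interval"
        have "\<bar>fiber F \<omega> x\<bar> \<le> 1" using skew_productsD(1)[OF F w] x by fastforce
        then have "\<bar>(1 - \<beta>) * fiber F \<omega> x\<bar> \<le> \<bar>1 - \<beta>\<bar>" by (simp add: abs_mult mult_left_le)
        moreover have "fiber F \<omega> x - fiber ?G \<omega> x = (1 - \<beta>) * fiber F \<omega> x - \<alpha>"
          using bspec[OF g x] by (simp add: algebra_simps)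
        ultimately have "\<bar>fiber F \<omega> x - fiber ?G \<omega> x\<bar> \<le> d" using s by linarith
        moreover have "d \<le> d * b" using d b by simp
        ultimately have 1: "\<bar>fiber F \<omega> x - fiber ?G \<omega> x\<bar> \<le> r / 2" using db by linarith
        have "\<bar>unit_deriv (fiber F \<omega>) x\<bar> \<le> B" using B[OF w] x unfolding C1_bounded_def by blast
        then have "\<bar>unit_deriv (fiber F \<omega>) x\<bar> \<le> b" by (simp add: b_def)
        moreover have "\<bar>1 - \<beta>\<bar> \<le> d" using s by linarith
        ultimately have "\<bar>1 - \<beta>\<bar> * \<bar>unit_deriv (fiber F \<omega>) x\<bar> \<le> d * b" using d by (intro mult_mono) auto
        moreover have "unit_deriv (fiber F \<omega>) x - unit_deriv (fiber ?G \<omega>) x = (1 - \<beta>) * unit_deriv (fiber F \<omega>) x"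
          using affine_unit_deriv(2)[OF c1 g x] by (simp add: algebra_simps)
        ultimately have "\<bar>unit_deriv (fiber F \<omega>) x - unit_deriv (fiber ?G \<omega>) x\<bar> \<le> r / 2"
          using db by (simp add: abs_mult)
        with 1 show "max \<bar>fiber F \<omega> x - fiber ?G \<omega> x\<bar> \<bar>unit_deriv (fiber F \<omega>) x - unit_deriv (fiber ?G \<omega>) x\<bar> \<le> r / 2"
          by simp
      qed
      ultimately show ?thesis by simp
    qed
    then have "(SUP \<omega>\<in>X. max (C1_dist (fiber F \<omega>) (fiber ?G \<omega>)) (C1_dist_inverse (fiber F \<omega>) (fiber ?G \<omega>))) \<le> r / 2"
      by (rule cSUP_least[OF ne])
    then have "skew_dist X F ?G \<le> r / 2" using F G unfolding skew_dist_def by simp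
    then show ?thesis using r by simp
  qed
  with d show ?thesis by blast
qed

end

section \<open>Smallness of the level sets\<close>

context markov_shift
begin

text \<open>A ball inside \<open>thick c\<close> would contain infinitely many pairwise comparable
  members. Contracting by \<open>1 - \<epsilon>\<close> leaves room to lift by any amount below
  \<open>\<epsilon>\<close>, even when fiber maps of \<open>F\<close> reach the end points.\<close>

lemma nowhere_dense_thick:
  assumes c: "c > 0" shows "nowhere_dense_in (skew_topology X) (thick c)"
proof -
  interpret K: Metric_space "skew_products X" "skew_dist X"
    by (rule Metric_space_skew_dist[OF compact_X X_nonempty])
  have False if F_int: "F \<in> K.mtopology interior_of (thick c)" for F
  proof -
    have F: "F \<in> skew_products X" using F_int interior_of_subset[of K.mtopology "thick c"] by (auto simp: thick_def)
    obtain r where r: "r > 0" "K.mball F r \<subseteq> K.mtopology interior_of (thick c)"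
      using F_int openin_interior_of[of K.mtopology "thick c"] unfolding K.openin_mtopology by blast
    have r': "K.mball F r \<subseteq> thick c" by (rule subset_trans[OF r(2) interior_of_subset])
    obtain d where d: "d > 0" "\<And>\<alpha> \<beta>. 0 \<le> \<alpha> \<Longrightarrow> 1 / 2 \<le> \<beta> \<Longrightarrow> \<alpha> + \<beta> \<le> 1 \<Longrightarrow> \<bar>\<alpha>\<bar> + \<bar>1 - \<beta>\<bar> \<le> d \<Longrightarrow>
        skew_dist X F (affine_skew X \<alpha> \<beta> F) < r"
      using affine_skew_close[OF F X_nonempty r(1)] by blast
    \<comment> \<open>The contraction and the lift each cost at most \<open>\<epsilon>\<close>,
      together at most \<open>d\<close>; the bound \<open>1 / 2\<close> keeps the factor at least
      \<open>1 / 2\<close>.\<close>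
    define \<epsilon> where "\<epsilon> = min (1 / 2) (d / 2)"
    have \<epsilon>: "\<epsilon> > 0" "\<epsilon> \<le> 1 / 2" "2 * \<epsilon> \<le> d" using d(1) by (auto simp: \<epsilon>_def)
    let ?\<Phi> = "\<lambda>\<alpha>. affine_skew X \<alpha> (1 - \<epsilon>) F"
    have S: "?\<Phi> \<alpha> \<in> skew_products X" if "\<alpha> \<in> {0<..<\<epsilon>}" for \<alpha>
      by (rule affine_skew_in[OF F]) (use that \<epsilon> in auto)
    have "skew_less X (?\<Phi> s) (?\<Phi> t)" if "s < t" for s t
      using that unfolding skew_less_def by (simp add: fiber_affine_skew)
    then have "finite {\<alpha> \<in> {0<..<\<epsilon>}. ?\<Phi> \<alpha> \<in> thick c}"
      by (intro finite_thick_parameters[OF c S]) (meson linorder_neqE)+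
    moreover have "?\<Phi> \<alpha> \<in> thick c" if "\<alpha> \<in> {0<..<\<epsilon>}" for \<alpha>
    proof -
      have "skew_dist X F (?\<Phi> \<alpha>) < r" by (rule d(2)) (use that \<epsilon> in auto)
      then show ?thesis using r' F S[OF that] by auto
    qed
    then have "{\<alpha> \<in> {0<..<\<epsilon>}. ?\<Phi> \<alpha> \<in> thick c} = {0<..<\<epsilon>}" by blast
    ultimately show False using infinite_Ioo[OF \<epsilon>(1)] by (simp only:)
  qed
  moreover have "K.mtopology closure_of (thick c) = thick c" by (rule closure_of_closedin[OF closedin_thick])
  ultimately show ?thesis unfolding nowhere_dense_in_def by (auto simp: thick_def)
qed

lemma small_thick:
  assumes c: "c > 0" shows "small X (thick c)"
  unfolding small_def
proof (intro conjI allI impI closedin_thick nowhere_dense_thick[OF c])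
  interpret K: Metric_space "skew_products X" "skew_dist X"
    by (rule Metric_space_skew_dist[OF compact_X X_nonempty])
  fix a b :: real and \<Phi> assume "a < b \<and> continuous_family X a b \<Phi> \<and> monotone_family X a b \<Phi>"
  then have cont: "continuous_family X a b \<Phi>" and mono: "monotone_family X a b \<Phi>" by auto
  show "finite {\<tau> \<in> {a<..<b}. \<Phi> \<tau> \<in> thick c}"
  proof (rule finite_thick_parameters[OF c])
    show "\<Phi> t \<in> skew_products X" if "t \<in> {a<..<b}" for t
      using continuous_map_funspace[OF cont[unfolded continuous_family_def]] that by auto
    show "skew_less X (\<Phi> s) (\<Phi> t) \<or> skew_less X (\<Phi> t) (\<Phi> s)"
      if "s \<in> {a<..<b}" "t \<in> {a<..<b}" "s \<noteq> t" for s t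
      using mono that unfolding monotone_family_def by (metis linorder_neqE)
  qed
qed

lemma thick_anchored_eq: "thick_anchored X \<mu> = (\<Union>n. thick (1 / real (Suc n)))"
proof -
  have "0 < x \<longleftrightarrow> (\<exists>n. 1 / real (Suc n) \<le> x)" for x :: real
  proof
    assume "0 < x"
    then obtain n where "inverse (real (Suc n)) < x" using reals_Archimedean by blast
    then show "\<exists>n. 1 / real (Suc n) \<le> x" by (intro exI[of _ n]) (simp add: divide_inverse)
  next
    assume "\<exists>n. 1 / real (Suc n) \<le> x"
    then obtain n where "1 / real (Suc n) \<le> x" ..
    moreover have "0 < 1 / real (Suc n)" by simp
    ultimately show "0 < x" by linarith
  qed
  then show ?thesis unfolding thick_anchored_def thick_def by blast
qed

end

theorem theoremt:
  fixes N :: nat and A :: "nat \<Rightarrow> nat \<Rightarrow> bool"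
    and X :: "(int \<Rightarrow> nat) set" and \<mu> :: "(int \<Rightarrow> nat) measure"
  assumes "X = markov_chain_space N A"
    and "topologically_transitive X"
    and "markov_measure N A \<mu>"
    and "shift_invariant \<mu>"
    and "shift_ergodic \<mu>"
  shows "(\<exists>\<C>. countable \<C> \<and> (\<forall>C\<in>\<C>. small X C) \<and> thick_anchored X \<mu> \<subseteq> \<Union>\<C>) \<and>
         meager_in (skew_topology X) (thick_anchored X \<mu>)"
proof -
  interpret markov_shift N A X \<mu> by unfold_locales (fact assms)+
  \<comment> \<open>The union of these sets is exactly the set in question, so one family yields
    both the inclusion and the equality demanded by \<open>meager_in\<close>.\<close>
  let ?\<C> = "range (\<lambda>n. thick (1 / real (Suc n)))"
  have "countable ?\<C>" "\<forall>C\<in>?\<C>. small X C" by (auto intro: small_thick)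
  then show ?thesis unfolding meager_in_def thick_anchored_eq
    by (intro conjI exI[of _ ?\<C>]) (auto simp: small_def)
qed

end
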